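(* Let $(M,g_M)$ and $(N,g_N)$ be Riemannian manifolds and $p\in[1,\infty)$. Let $(u_\ell)_{\ell\in\mathbb{N}}$ be a sequence of maps in $\dot W^{1,p}(M,N)$ and $u\in\dot W^{1,p}(M,N)$. Then $(u_\ell)$ converges strongly to $u$ in $\dot W^{1,p}(M,N)$ if and only if $\lim_{\ell\to\infty}\dot\delta^C_{1,p}(u_\ell,u)=0$, where $$\dot\delta^C_{1,p}(u,v)=\int_M\frac{d(u,v)}{1+d(u,v)}\,d\mu+\Bigl(\int_M\bigl||Du|_{g_M^*\otimes g_N}-|Dv|_{g_M^*\otimes g_N}\bigr|^p\Bigr)^{1/p},$$ with $d$ a distance on $N$ inducing its topology and $\mu$ a finite positive absolutely continuous measure on $M$.
   Context: Manifolds are Hausdorff and have a countable basis; measure-theoretic notions on $M$ are defined via local charts. A map $u\colon M\to N$ is colocally weakly differentiable if $u$ is measurable and $f\circ u$ is weakly differentiable for every $f\in C^1_c(N,\mathbb{R})$. Its colocal weak derivative is the (existing and almost everywhere unique) measurable bundle morphism $Du\colon TM\to TN$ covering $u$ such that for every $f\in C^1_c(N,\mathbb{R})$, $D(f\circ u)=Df\circ Du$ almost everywhere in $M$. For linear $\xi\colon T_xM\to T_yN$, $|\xi|_{g_M^*\otimes g_N}^2=\sum_i g_N(\xi(e_i),\xi(e_i))$ with $(e_i)$ a $g_M$-orthonormal basis of $T_xM$. $\dot W^{1,p}(M,N)$ is the set of colocally weakly differentiable $u\colon M\to N$ with $|Du|_{g_M^*\otimes g_N}\in L^p(M)$ (Riemannian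 measure). A sequence of measurable maps $w_\ell\colon M\to Y$ into a manifold $Y$ converges locally in measure to a measurable $w\colon M\to Y$ if every $x\in M$ lies in the domain $V$ of a local chart $\psi\colon V\to\mathbb{R}^m$ such that for every open $U\subseteq Y$, $\lim_{\ell\to\infty}\mathcal{L}^m(\psi((w^{-1}(U)\cap V)\setminus w_\ell^{-1}(U)))=0$. For bundle morphisms $TM\to TN$, $Y=T^*M\otimes TN$, the vector bundle over $M\times N$ with fiber $\mathcal{L}(T_xM,T_yN)$ over $(x,y)$. $(u_\ell)$ converges strongly to $u$ in $\dot W^{1,p}(M,N)$ if $(Du_\ell)$ converges to $Du$ locally in measure and $(|Du_\ell|_{g_M^*\otimes g_N})$ converges to $|Du|_{g_M^*\otimes g_N}$ in $L^p(M)$. A Radon measure $\mu$ on $M$ is positive absolutely continuous if in local charts $\mu$ and Lebesgue measure are mutually absolutely continuous. Integrals without indicated measure are with respect to the Riemannian measure of $M$. *)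

theory Defs
  imports "HOL-Analysis.Analysis"
begin

text \<open>A manifold is a type of class t2_space and second_countable_topology together with a maximal
  \<open>C\<^sup>1\<close> atlas \<open>M\<close>. A chart is a pair \<open>(V, \<psi>)\<close>; the values of \<open>\<psi>\<close> outside \<open>V\<close> are irrelevant.\<close>

type_synonym ('a, 'm) chart = "'a set \<times> ('a \<Rightarrow> real ^ 'm)"

definition chart_inv :: "('a, 'm::finite) chart \<Rightarrow> real ^ 'm \<Rightarrow> 'a" where
  "chart_inv c = inv_into (fst c) (snd c)"

definition chart_image :: "('a, 'm::finite) chart \<Rightarrow> (real ^ 'm) set" where
  "chart_image c = snd c ` fst c"

definition topological_chart :: "('a::topological_space, 'm::finite) chart \<Rightarrow> bool" where
  "topological_chart c \<longleftrightarrow>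
     open (fst c) \<and> open (chart_image c) \<and> homeomorphism (fst c) (chart_image c) (snd c) (chart_inv c)"

definition C1_on :: "'v::real_normed_vector set \<Rightarrow> ('v \<Rightarrow> 'w::real_normed_vector) \<Rightarrow> bool" where
  "C1_on S f \<longleftrightarrow>
     (\<exists>f'. (\<forall>x\<in>S. (f has_derivative blinfun_apply (f' x)) (at x)) \<and> continuous_on S f')"

definition C1_compatible :: "('a, 'm::finite) chart \<Rightarrow> ('a, 'm) chart \<Rightarrow> bool" where
  "C1_compatible c c' \<longleftrightarrow>
     C1_on (snd c ` (fst c \<inter> fst c')) (snd c' \<circ> chart_inv c) \<and>
     C1_on (snd c' ` (fst c \<inter> fst c')) (snd c \<circ> chart_inv c')"

definition C1_structure ::
  "('a::{t2_space, second_countable_topology}, 'm::finite) chart set \<Rightarrow> bool" where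
  "C1_structure M \<longleftrightarrow>
     (\<forall>c\<in>M. topological_chart c) \<and>
     (\<Union>c\<in>M. fst c) = UNIV \<and>
     (\<forall>c\<in>M. \<forall>c'\<in>M. C1_compatible c c') \<and>
     (\<forall>c. topological_chart c \<and> (\<forall>c'\<in>M. C1_compatible c c') \<longrightarrow> c \<in> M)"

text \<open>The tangent space at \<open>x\<close> is modelled by \<open>real ^ 'm\<close>: a vector \<open>v\<close> stands for the tangent vector
  whose coordinates in an arbitrarily chosen chart \<open>ref_chart M x\<close> around \<open>x\<close> are \<open>v\<close>. These choices
  need not depend continuously on \<open>x\<close>; every regularity, topological or measurability condition on
  tensors below is therefore imposed after passing to the coordinates of a chart on its whole domain
  with \<open>chart_diff\<close>, and so does not depend on them.\<close>

definition ref_chart :: "('a, 'm::finite) chart set \<Rightarrow> 'a \<Rightarrow> ('a, 'm) chart" where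
  "ref_chart M x = (SOME c. c \<in> M \<and> x \<in> fst c)"

definition mdiff ::
  "('a, 'm::finite) chart set \<Rightarrow> ('a \<Rightarrow> 'w::real_normed_vector) \<Rightarrow> 'a \<Rightarrow> real ^ 'm \<Rightarrow> 'w" where
  "mdiff M f x =
     frechet_derivative (f \<circ> chart_inv (ref_chart M x)) (at (snd (ref_chart M x) x))"

text \<open>\<open>chart_diff M c x\<close> is the isomorphism from the tangent space at \<open>x\<close> onto coordinate space
  induced by \<open>c\<close>, where \<open>x \<in> fst c\<close>.\<close>

definition chart_diff ::
  "('a, 'm::finite) chart set \<Rightarrow> ('a, 'm) chart \<Rightarrow> 'a \<Rightarrow> real ^ 'm \<Rightarrow> real ^ 'm" where
  "chart_diff M c x = mdiff M (snd c) x"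

definition C1c_functions :: "('a::topological_space, 'm::finite) chart set \<Rightarrow> ('a \<Rightarrow> real) set" where
  "C1c_functions M =
     {f. (\<forall>c\<in>M. C1_on (chart_image c) (f \<circ> chart_inv c)) \<and> compact (closure {x. f x \<noteq> 0})}"

definition gram_matrix ::
  "('a, 'm::finite) chart set \<Rightarrow> ('a \<Rightarrow> real ^ 'm \<Rightarrow> real ^ 'm \<Rightarrow> real) \<Rightarrow> ('a, 'm) chart \<Rightarrow> 'a
     \<Rightarrow> real ^ 'm ^ 'm" where
  "gram_matrix M g c x =
     (\<chi> i j. g x (inv (chart_diff M c x) (axis i 1)) (inv (chart_diff M c x) (axis j 1)))"

definition riemannian_manifold ::
  "('a::{t2_space, second_countable_topology}, 'm::finite) chart set
     \<Rightarrow> ('a \<Rightarrow> real ^ 'm \<Rightarrow> real ^ 'm \<Rightarrow> real) \<Rightarrow> bool" where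
  "riemannian_manifold M g \<longleftrightarrow>
     C1_structure M \<and>
     (\<forall>x. bilinear (g x) \<and> (\<forall>v w. g x v w = g x w v) \<and> (\<forall>v. v \<noteq> 0 \<longrightarrow> g x v v > 0)) \<and>
     (\<forall>c\<in>M. continuous_on (fst c) (gram_matrix M g c))"

text \<open>Measure theory on a manifold, in local charts. Measurable means Lebesgue measurable.\<close>

definition lebesgue_sets :: "('a, 'm::finite) chart set \<Rightarrow> 'a set set" where
  "lebesgue_sets M = {B. \<forall>c\<in>M. snd c ` (B \<inter> fst c) \<in> sets lebesgue}"

definition almost_everywhere :: "('a, 'm::finite) chart set \<Rightarrow> ('a \<Rightarrow> bool) \<Rightarrow> bool" where
  "almost_everywhere M P \<longleftrightarrow> (\<forall>c\<in>M. negligible (snd c ` ({x. \<not> P x} \<inter> fst c)))"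

definition measurable_map :: "('a, 'm::finite) chart set \<Rightarrow> 'y topology \<Rightarrow> ('a \<Rightarrow> 'y) \<Rightarrow> bool" where
  "measurable_map M T w \<longleftrightarrow> (\<forall>U. openin T U \<longrightarrow> w -` U \<in> lebesgue_sets M)"

definition converges_locally_in_measure ::
  "('a, 'm::finite) chart set \<Rightarrow> 'y topology \<Rightarrow> (nat \<Rightarrow> 'a \<Rightarrow> 'y) \<Rightarrow> ('a \<Rightarrow> 'y) \<Rightarrow> bool" where
  "converges_locally_in_measure M T ws w \<longleftrightarrow>
     (\<forall>x. \<exists>c\<in>M. x \<in> fst c \<and>
        (\<forall>U. openin T U \<longrightarrow>
           (\<lambda>l. emeasure lebesgue (snd c ` ((w -` U \<inter> fst c) - ws l -` U))) \<longlonglongrightarrow> 0))"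

definition riemannian_measure ::
  "('a, 'm::finite) chart set \<Rightarrow> ('a \<Rightarrow> real ^ 'm \<Rightarrow> real ^ 'm \<Rightarrow> real) \<Rightarrow> 'a measure" where
  "riemannian_measure M g =
     (THE \<nu>. space \<nu> = UNIV \<and> sets \<nu> = lebesgue_sets M \<and>
        (\<forall>c\<in>M. \<forall>B\<in>lebesgue_sets M. B \<subseteq> fst c \<longrightarrow>
           emeasure \<nu> B =
             (\<integral>\<^sup>+y\<in>snd c ` B. ennreal (sqrt (det (gram_matrix M g c (chart_inv c y)))) \<partial>lebesgue)))"

definition radon_measure :: "'a::topological_space measure \<Rightarrow> bool" where
  "radon_measure \<mu> \<longleftrightarrow>
     sets \<mu> = sets borel \<and>
     (\<forall>K. compact K \<longrightarrow> emeasure \<mu> K < \<infinity>) \<and>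
     (\<forall>B\<in>sets borel. emeasure \<mu> B = (SUP K\<in>{K. K \<subseteq> B \<and> compact K}. emeasure \<mu> K))"

definition positive_absolutely_continuous ::
  "('a::topological_space, 'm::finite) chart set \<Rightarrow> 'a measure \<Rightarrow> bool" where
  "positive_absolutely_continuous M \<mu> \<longleftrightarrow>
     (\<forall>c\<in>M. \<forall>B\<in>sets borel. B \<subseteq> fst c \<longrightarrow>
        (B \<in> null_sets \<mu> \<longleftrightarrow> snd c ` B \<in> null_sets lborel))"

definition in_Lp :: "'a measure \<Rightarrow> real \<Rightarrow> ('a \<Rightarrow> real) \<Rightarrow> bool" where
  "in_Lp \<nu> p f \<longleftrightarrow> f \<in> borel_measurable \<nu> \<and> integrable \<nu> (\<lambda>x. \<bar>f x\<bar> powr p)"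

definition Lp_converges :: "'a measure \<Rightarrow> real \<Rightarrow> (nat \<Rightarrow> 'a \<Rightarrow> real) \<Rightarrow> ('a \<Rightarrow> real) \<Rightarrow> bool" where
  "Lp_converges \<nu> p fs f \<longleftrightarrow>
     (\<forall>l. in_Lp \<nu> p (fs l)) \<and> in_Lp \<nu> p f \<and>
     (\<lambda>l. (\<integral>x. \<bar>fs l x - f x\<bar> powr p \<partial>\<nu>) powr (1 / p)) \<longlonglongrightarrow> 0"

text \<open>Weak differentiability of real functions, first on an open set \<open>S\<close> of Euclidean space and then on
  a manifold, where the weak derivative is a field of covectors.\<close>

definition locally_integrable_on :: "('v::euclidean_space \<Rightarrow> real) \<Rightarrow> 'v set \<Rightarrow> bool" where
  "locally_integrable_on f S \<longleftrightarrow> (\<forall>K. compact K \<and> K \<subseteq> S \<longrightarrow> f absolutely_integrable_on K)"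

definition has_weak_derivative_on ::
  "('v::euclidean_space \<Rightarrow> real) \<Rightarrow> ('v \<Rightarrow> 'v \<Rightarrow> real) \<Rightarrow> 'v set \<Rightarrow> bool" where
  "has_weak_derivative_on f f' S \<longleftrightarrow>
     locally_integrable_on f S \<and> (\<forall>v. locally_integrable_on (\<lambda>y. f' y v) S) \<and>
     (\<forall>\<phi> v. C1_on UNIV \<phi> \<and> compact (closure {y. \<phi> y \<noteq> 0}) \<and> closure {y. \<phi> y \<noteq> 0} \<subseteq> S \<longrightarrow>
        (LINT y:S|lebesgue. f y * frechet_derivative \<phi> (at y) v) =
        - (LINT y:S|lebesgue. \<phi> y * f' y v))"

definition has_weak_derivative ::
  "('a, 'm::finite) chart set \<Rightarrow> ('a \<Rightarrow> real) \<Rightarrow> ('a \<Rightarrow> (real ^ 'm) \<Rightarrow>\<^sub>L real) \<Rightarrow> bool" where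
  "has_weak_derivative M f \<omega> \<longleftrightarrow>
     (\<forall>c\<in>M. has_weak_derivative_on (f \<circ> chart_inv c)
        (\<lambda>y v. \<omega> (chart_inv c y) (inv (chart_diff M c (chart_inv c y)) v)) (chart_image c))"

definition weakly_differentiable :: "('a, 'm::finite) chart set \<Rightarrow> ('a \<Rightarrow> real) \<Rightarrow> bool" where
  "weakly_differentiable M f \<longleftrightarrow> (\<exists>\<omega>. has_weak_derivative M f \<omega>)"

text \<open>The total space of the bundle \<open>T\<^sup>*M \<otimes> TN\<close> over \<open>M \<times> N\<close> is the type
  \<open>'a \<times> 'b \<times> ((real ^ 'm) \<Rightarrow>\<^sub>L (real ^ 'n))\<close>. The map \<open>hom_param\<close> is the inverse of the bundle chart induced
  by a chart \<open>c\<close> of \<open>M\<close> and a chart \<open>e\<close> of \<open>N\<close>; a set is open iff all its preimages under these local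
  parametrizations are open.\<close>

type_synonym ('a, 'b, 'm, 'n) hom_bundle = "'a \<times> 'b \<times> ((real ^ 'm) \<Rightarrow>\<^sub>L (real ^ 'n))"

definition hom_param ::
  "('a, 'm::finite) chart set \<Rightarrow> ('b, 'n::finite) chart set \<Rightarrow> ('a, 'm) chart \<Rightarrow> ('b, 'n) chart
     \<Rightarrow> (real ^ 'm) \<times> (real ^ 'n) \<times> ((real ^ 'm) \<Rightarrow>\<^sub>L (real ^ 'n)) \<Rightarrow> ('a, 'b, 'm, 'n) hom_bundle" where
  "hom_param M N c e = (\<lambda>(a, b, \<eta>).
     (chart_inv c a, chart_inv e b,
      Blinfun (\<lambda>v. inv (chart_diff N e (chart_inv e b)) (\<eta> (chart_diff M c (chart_inv c a) v)))))"

definition hom_open ::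
  "('a, 'm::finite) chart set \<Rightarrow> ('b, 'n::finite) chart set \<Rightarrow> ('a, 'b, 'm, 'n) hom_bundle set \<Rightarrow> bool"
  where
  "hom_open M N U \<longleftrightarrow>
     (\<forall>c\<in>M. \<forall>e\<in>N.
        open (hom_param M N c e -` U \<inter> (chart_image c \<times> chart_image e \<times> UNIV)))"

definition hom_topology ::
  "('a, 'm::finite) chart set \<Rightarrow> ('b, 'n::finite) chart set \<Rightarrow> ('a, 'b, 'm, 'n) hom_bundle topology"
  where
  "hom_topology M N = topology (hom_open M N)"

lemma openin_hom_topology: "openin (hom_topology M N) = hom_open M N"
proof -
  have "istopology (hom_open M N)"
    unfolding istopology_def
  proof (intro conjI allI impI)
    fix S T assume "hom_open M N S" and "hom_open M N T"
    then have "open ((hom_param M N c e -` S \<inter> (chart_image c \<times> chart_image e \<times> UNIV)) \<inter>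
                     (hom_param M N c e -` T \<inter> (chart_image c \<times> chart_image e \<times> UNIV)))"
      if "c \<in> M" "e \<in> N" for c e
      using that unfolding hom_open_def by (blast intro!: open_Int[of "_ \<inter> _" "_ \<inter> _"])
    moreover have "(hom_param M N c e -` S \<inter> (chart_image c \<times> chart_image e \<times> UNIV)) \<inter>
                     (hom_param M N c e -` T \<inter> (chart_image c \<times> chart_image e \<times> UNIV))
                 = hom_param M N c e -` (S \<inter> T) \<inter> (chart_image c \<times> chart_image e \<times> UNIV)" for c e
      by blast
    ultimately show "hom_open M N (S \<inter> T)"
      by (simp add: hom_open_def)
  next
    fix K assume K: "\<forall>S\<in>K. hom_open M N S"
    have "open (\<Union>S\<in>K. hom_param M N c e -` S \<inter> (chart_image c \<times> chart_image e \<times> UNIV))"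
      if "c \<in> M" "e \<in> N" for c e
      using that K unfolding hom_open_def by (blast intro!: open_UN)
    moreover have "(\<Union>S\<in>K. hom_param M N c e -` S \<inter> (chart_image c \<times> chart_image e \<times> UNIV))
                 = hom_param M N c e -` (\<Union>K) \<inter> (chart_image c \<times> chart_image e \<times> UNIV)" for c e
      by blast
    ultimately show "hom_open M N (\<Union>K)"
      by (simp add: hom_open_def)
  qed
  then show ?thesis
    by (simp add: hom_topology_def)
qed

text \<open>A bundle morphism from \<open>TM\<close> to \<open>TN\<close> covering \<open>u\<close> is given by its fibre maps \<open>D x\<close>, from the tangent
  space at \<open>x\<close> to the tangent space at \<open>u x\<close>; \<open>bundle_section u D\<close> is the same morphism as a map
  into \<open>T\<^sup>*M \<otimes> TN\<close>.\<close>

definition bundle_section ::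
  "('a \<Rightarrow> 'b) \<Rightarrow> ('a \<Rightarrow> (real ^ 'm) \<Rightarrow>\<^sub>L (real ^ 'n)) \<Rightarrow> 'a \<Rightarrow> ('a, 'b, 'm::finite, 'n::finite) hom_bundle"
  where
  "bundle_section u D = (\<lambda>x. (x, u x, D x))"

definition colocally_weakly_differentiable ::
  "('a, 'm::finite) chart set \<Rightarrow> ('b::topological_space, 'n::finite) chart set \<Rightarrow> ('a \<Rightarrow> 'b) \<Rightarrow> bool" where
  "colocally_weakly_differentiable M N u \<longleftrightarrow>
     measurable_map M euclidean u \<and> (\<forall>f\<in>C1c_functions N. weakly_differentiable M (f \<circ> u))"

definition has_colocal_weak_derivative ::
  "('a, 'm::finite) chart set \<Rightarrow> ('b::topological_space, 'n::finite) chart set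
     \<Rightarrow> ('a \<Rightarrow> 'b) \<Rightarrow> ('a \<Rightarrow> (real ^ 'm) \<Rightarrow>\<^sub>L (real ^ 'n)) \<Rightarrow> bool" where
  "has_colocal_weak_derivative M N u D \<longleftrightarrow>
     measurable_map M (hom_topology M N) (bundle_section u D) \<and>
     (\<forall>f\<in>C1c_functions N. \<exists>\<omega>. has_weak_derivative M (f \<circ> u) \<omega> \<and>
        almost_everywhere M (\<lambda>x. \<forall>v. \<omega> x v = mdiff N f (u x) (D x v)))"

definition colocal_weak_derivative ::
  "('a, 'm::finite) chart set \<Rightarrow> ('b::topological_space, 'n::finite) chart set
     \<Rightarrow> ('a \<Rightarrow> 'b) \<Rightarrow> 'a \<Rightarrow> (real ^ 'm) \<Rightarrow>\<^sub>L (real ^ 'n)" where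
  "colocal_weak_derivative M N u = (SOME D. has_colocal_weak_derivative M N u D)"

text \<open>The value of \<open>hs_norm\<close> does not depend on the orthonormal basis \<open>e\<close>.\<close>

definition hs_norm ::
  "(real ^ 'm \<Rightarrow> real ^ 'm \<Rightarrow> real) \<Rightarrow> (real ^ 'n \<Rightarrow> real ^ 'n \<Rightarrow> real)
     \<Rightarrow> ((real ^ 'm::finite) \<Rightarrow>\<^sub>L (real ^ 'n::finite)) \<Rightarrow> real" where
  "hs_norm g h \<xi> =
     (let e = (SOME e :: 'm \<Rightarrow> real ^ 'm. \<forall>i j. g (e i) (e j) = (if i = j then 1 else 0))
      in sqrt (\<Sum>i\<in>UNIV. h (\<xi> (e i)) (\<xi> (e i))))"

definition deriv_norm ::
  "('a, 'm::finite) chart set \<Rightarrow> ('a \<Rightarrow> real ^ 'm \<Rightarrow> real ^ 'm \<Rightarrow> real)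
     \<Rightarrow> ('b::topological_space, 'n::finite) chart set \<Rightarrow> ('b \<Rightarrow> real ^ 'n \<Rightarrow> real ^ 'n \<Rightarrow> real)
     \<Rightarrow> ('a \<Rightarrow> 'b) \<Rightarrow> 'a \<Rightarrow> real" where
  "deriv_norm M gM N gN u x = hs_norm (gM x) (gN (u x)) (colocal_weak_derivative M N u x)"

text \<open>The second conjunct holds for every colocally weakly differentiable map; it makes explicit that
  \<open>colocal_weak_derivative M N u\<close>, being a Hilbert choice, is a colocal weak derivative of \<open>u\<close>.\<close>

definition sobolev_maps ::
  "('a, 'm::finite) chart set \<Rightarrow> ('a \<Rightarrow> real ^ 'm \<Rightarrow> real ^ 'm \<Rightarrow> real)
     \<Rightarrow> ('b::topological_space, 'n::finite) chart set \<Rightarrow> ('b \<Rightarrow> real ^ 'n \<Rightarrow> real ^ 'n \<Rightarrow> real)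
     \<Rightarrow> real \<Rightarrow> ('a \<Rightarrow> 'b) set" where
  "sobolev_maps M gM N gN p =
     {u. colocally_weakly_differentiable M N u \<and>
         has_colocal_weak_derivative M N u (colocal_weak_derivative M N u) \<and>
         in_Lp (riemannian_measure M gM) p (deriv_norm M gM N gN u)}"

definition converges_strongly ::
  "('a, 'm::finite) chart set \<Rightarrow> ('a \<Rightarrow> real ^ 'm \<Rightarrow> real ^ 'm \<Rightarrow> real)
     \<Rightarrow> ('b::topological_space, 'n::finite) chart set \<Rightarrow> ('b \<Rightarrow> real ^ 'n \<Rightarrow> real ^ 'n \<Rightarrow> real)
     \<Rightarrow> real \<Rightarrow> (nat \<Rightarrow> 'a \<Rightarrow> 'b) \<Rightarrow> ('a \<Rightarrow> 'b) \<Rightarrow> bool" where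
  "converges_strongly M gM N gN p us u \<longleftrightarrow>
     converges_locally_in_measure M (hom_topology M N)
       (\<lambda>l. bundle_section (us l) (colocal_weak_derivative M N (us l)))
       (bundle_section u (colocal_weak_derivative M N u)) \<and>
     Lp_converges (riemannian_measure M gM) p
       (\<lambda>l. deriv_norm M gM N gN (us l)) (deriv_norm M gM N gN u)"

text \<open>The first integral is over the completion of the Borel measure \<open>\<mu>\<close> since \<open>u\<close> and \<open>v\<close> are only
  Lebesgue measurable.\<close>

definition sobolev_dist ::
  "('a::topological_space, 'm::finite) chart set \<Rightarrow> ('a \<Rightarrow> real ^ 'm \<Rightarrow> real ^ 'm \<Rightarrow> real)
     \<Rightarrow> ('b::topological_space, 'n::finite) chart set \<Rightarrow> ('b \<Rightarrow> real ^ 'n \<Rightarrow> real ^ 'n \<Rightarrow> real)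
     \<Rightarrow> real \<Rightarrow> ('b \<Rightarrow> 'b \<Rightarrow> real) \<Rightarrow> 'a measure \<Rightarrow> ('a \<Rightarrow> 'b) \<Rightarrow> ('a \<Rightarrow> 'b) \<Rightarrow> real" where
  "sobolev_dist M gM N gN p d \<mu> u v =
     (\<integral>x. d (u x) (v x) / (1 + d (u x) (v x)) \<partial>completion \<mu>) +
     (\<integral>x. \<bar>deriv_norm M gM N gN u x - deriv_norm M gM N gN v x\<bar> powr p
        \<partial>riemannian_measure M gM) powr (1 / p)"

end

theory Submission
  imports Defs
begin

text \<open>Convergence in the distance gives \<open>u\<^sub>l \<rightarrow> u\<close> almost everywhere along subsequences and
  \<open>|Du\<^sub>l| \<rightarrow> |Du|\<close> in \<open>L\<^sup>1\<close> on compact sets. For a function \<open>f\<close> that is a coordinate of a chart of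
  \<open>N\<close> near a given point and is cut off away from it, \<open>D(f \<circ> u\<^sub>l)\<close> converges to \<open>D(f \<circ> u)\<close> as a
  distribution. Its norm is at most \<open>C |Du\<^sub>l|\<close>, and these majorants converge in \<open>L\<^sup>1\<close>, so the
  convergence persists against bounded measurable functions, also for \<open>p = 1\<close>. On the set where
  \<open>u\<close> lies near the given point and all quantities are bounded, weak convergence together with
  convergence of the norms yields convergence to \<open>0\<close> of the integral of \<open>|F\<^sub>l - F|\<^sup>2\<close>, where \<open>F\<^sub>l\<close> and
  \<open>F\<close> are the coordinate matrices of the derivatives. Hence \<open>Du\<^sub>l \<rightarrow> Du\<close> almost everywhere along a
  further subsequence, which is enough for local convergence in measure.

  Conversely, local convergence in measure of the derivatives contains that of the maps, and
  \<open>d / (1 + d)\<close> is bounded while \<open>\<mu>\<close> is finite.\<close>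

section \<open>Change of variables over arbitrary finite index types\<close>

text \<open>Four obstacles shape the proof. For p = 1 there is no reflexivity, and the sets and
  weights that occur (where u lies in a chart domain, the metric of \<open>N\<close> along u) are
  only measurable; L^1 convergence of the majorants makes up for both. Squares of derivatives need
  not be integrable when p < 2, so energies are compared only on sets where all norms of the
  sequence have a common bound \<open>m\<close>; along a subsequence the norms converge almost
  everywhere, so these sets exhaust a ball up to a null set. The values of the maps u_l may leave
  any given chart around the value of u; derivatives are therefore read through globally defined
  cut-off coordinates, bounded by the norm at every point of \<open>N\<close>. The measures involved
  are not comparable by inequalities; almost everywhere convergence mediates between them, because
  \<open>\<mu>\<close> and Lebesgue measure in charts have the same null sets, and the price is that
  limits are tested through subsequences. Moreover, the Riemannian measure is a definite
  description: existence and uniqueness, hence a change of variables under transition maps, come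
  before any integral.\<close>

text \<open>The change of variables theorem of HOL-Analysis is stated for well-ordered index types only. It is
  transported to an arbitrary finite index type along a well-ordered copy of that type.\<close>

typedef 'a wo_copy = "UNIV :: 'a set" by simp
instantiation wo_copy :: (finite) wellorder begin
definition less_eq_wo_copy :: "'a wo_copy \<Rightarrow> 'a wo_copy \<Rightarrow> bool" where
  "less_eq_wo_copy x y \<longleftrightarrow> to_nat_on UNIV (Rep_wo_copy x) \<le> to_nat_on UNIV (Rep_wo_copy y)"
definition less_wo_copy :: "'a wo_copy \<Rightarrow> 'a wo_copy \<Rightarrow> bool" where
  "less_wo_copy x y \<longleftrightarrow> to_nat_on UNIV (Rep_wo_copy x) < to_nat_on UNIV (Rep_wo_copy y)"
instance
proof
  fix x y z :: "'a wo_copy" and P :: "'a wo_copy \<Rightarrow> bool"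
  show "(x < y) = (x \<le> y \<and> \<not> y \<le> x)" by (auto simp: less_eq_wo_copy_def less_wo_copy_def)
  show "x \<le> x" by (simp add: less_eq_wo_copy_def)
  show "x \<le> y \<Longrightarrow> y \<le> z \<Longrightarrow> x \<le> z" by (simp add: less_eq_wo_copy_def)
  show "x \<le> y \<Longrightarrow> y \<le> x \<Longrightarrow> x = y"
    by (metis (full_types) Rep_wo_copy_inject UNIV_I antisym countable_finite finite_code inj_onD
        inj_on_to_nat_on less_eq_wo_copy_def)
  show "x \<le> y \<or> y \<le> x" by (auto simp: less_eq_wo_copy_def)
  show "P x" if "\<And>x. (\<And>y. y < x \<Longrightarrow> P y) \<Longrightarrow> P x"
    by (rule measure_induct_rule[of "\<lambda>x. to_nat_on UNIV (Rep_wo_copy x)"], rule that)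
        (simp add: less_wo_copy_def)
qed
end
instance wo_copy :: (finite) finite
proof
  show "finite (UNIV :: 'a wo_copy set)"
    by (rule finite_imageD[of Rep_wo_copy]) (auto intro: inj_onI simp: Rep_wo_copy_inject)
qed

section \<open>Lebesgue measure and determinants under relabelling of coordinates\<close>

definition to_wo :: "real ^ 'm::finite \<Rightarrow> real ^ ('m wo_copy)" where
  "to_wo v = (\<chi> i. v $ Rep_wo_copy i)"
definition of_wo :: "real ^ ('m::finite wo_copy) \<Rightarrow> real ^ 'm" where
  "of_wo v = (\<chi> i. v $ Abs_wo_copy i)"

lemma of_wo_to_wo [simp]: "of_wo (to_wo v) = v"
  by (simp add: of_wo_def to_wo_def Abs_wo_copy_inverse)
lemma to_wo_of_wo [simp]: "to_wo (of_wo v) = v"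
  by (simp add: of_wo_def to_wo_def Rep_wo_copy_inverse)
lemma linear_to_wo: "linear to_wo" by (rule linearI) (auto simp: to_wo_def vec_eq_iff)
lemma linear_of_wo: "linear of_wo" by (rule linearI) (auto simp: of_wo_def vec_eq_iff)

lemma bij_Rep_wo_copy: "bij Rep_wo_copy"
  by (metis Abs_wo_copy_inverse Rep_wo_copy_inverse UNIV_I bij_betw_def injI surj_def)

text \<open>Relabelling carries boxes to boxes with the same edge lengths, and a Borel measure with
  the right value on boxes is \<open>lborel\<close>.\<close>

lemma distr_lborel_to_wo: "distr lborel borel (to_wo :: real ^ 'm::finite \<Rightarrow> _) = lborel"
proof (rule lborel_eqI[symmetric])
  have [measurable]: "to_wo \<in> borel_measurable borel"
    by (intro borel_measurable_continuous_onI linear_continuous_on linear_to_wo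
        linear_conv_bounded_linear[THEN iffD1])
  fix l u :: "real ^ ('m wo_copy)"
  assume le: "\<And>b. b \<in> Basis \<Longrightarrow> l \<bullet> b \<le> u \<bullet> b"
  have lu: "l $ i \<le> u $ i" for i using le[of "axis i 1"] by (simp add: inner_axis axis_in_Basis_iff)
  have eq: "to_wo -` box l u = box (of_wo l) (of_wo u)"
  proof -
    have "(\<forall>i. l $ i < to_wo v $ i \<and> to_wo v $ i < u $ i) \<longleftrightarrow>
        (\<forall>i. of_wo l $ i < v $ i \<and> v $ i < of_wo u $ i)" for v
    proof -
      have "(\<forall>i. P (Rep_wo_copy i) i) \<longleftrightarrow> (\<forall>i. P i (Abs_wo_copy i))" for P :: "'m \<Rightarrow> 'm wo_copy \<Rightarrow> bool"
        by (metis Rep_wo_copy_inverse Abs_wo_copy_inverse UNIV_I)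
      then show ?thesis by (simp add: to_wo_def of_wo_def)
    qed
    then show ?thesis by (auto simp: mem_box_cart)
  qed
  have le': "b \<in> Basis \<Longrightarrow> of_wo l \<bullet> b \<le> of_wo u \<bullet> b" for b
    using lu by (auto simp: Basis_vec_def inner_axis of_wo_def)
  \<comment> \<open>A product over basis vectors becomes one over indices, which can be reindexed
    along the bijection of index types.\<close>
  have pr: "(\<Prod>b\<in>Basis. v \<bullet> b) = (\<Prod>i\<in>UNIV. v $ i)" for v :: "real ^ 'k::finite"
  proof -
    have "bij_betw (\<lambda>i. axis i (1::real)) UNIV (Basis :: (real ^ 'k) set)"
      by (auto simp: bij_betw_def inj_on_def axis_eq_axis Basis_vec_def)
    from prod.reindex_bij_betw[OF this, symmetric, of "\<lambda>b. v \<bullet> b"] show ?thesis by (simp add: inner_axis)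
  qed
  have "emeasure (distr lborel borel to_wo) (box l u) = emeasure lborel (box (of_wo l) (of_wo u))"
    by (simp add: emeasure_distr eq)
  also have "\<dots> = (\<Prod>b\<in>Basis. (of_wo u - of_wo l) \<bullet> b)"
    by (rule emeasure_lborel_box) (use le' in auto)
  also have "\<dots> = (\<Prod>i\<in>UNIV. (of_wo u - of_wo l) $ i)" unfolding pr ..
  also have "\<dots> = (\<Prod>i\<in>UNIV. (u - l) $ i)"
    using prod.reindex_bij_betw[OF bij_Rep_wo_copy, of "\<lambda>i. ((of_wo u - of_wo l) $ i)"]
    by (simp add: of_wo_def Rep_wo_copy_inverse)
  also have "\<dots> = (\<Prod>b\<in>Basis. (u - l) \<bullet> b)" unfolding pr ..
  finally show "emeasure (distr lborel borel to_wo) (box l u) = (\<Prod>b\<in>Basis. (u - l) \<bullet> b)" .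
qed simp

text \<open>The Borel statement \<open>distr_lborel_to_wo\<close> says in particular that preimages
  of null sets are null, so it survives completion of both measures.\<close>

lemma
  shows to_wo_measurable_lebesgue: "to_wo \<in> lebesgue \<rightarrow>\<^sub>M lebesgue"
    and distr_lebesgue_to_wo: "distr lebesgue lebesgue to_wo = lebesgue"
proof -
  have [measurable]: "to_wo \<in> borel \<rightarrow>\<^sub>M borel"
    by (intro borel_measurable_continuous_onI linear_continuous_on linear_to_wo
        linear_conv_bounded_linear[THEN iffD1])
  have d: "distr lebesgue lborel to_wo = lborel"
    by (simp add: distr_completion distr_lborel_to_wo[symmetric] cong: distr_cong)
  show "to_wo \<in> lebesgue \<rightarrow>\<^sub>M lebesgue"
    by (rule completion.measurable_completion2) (auto simp: d measurable_completion)
  have "distr lebesgue lebesgue to_wo = completion (distr lebesgue lborel to_wo)"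
    by (rule completion.completion_distr_eq[symmetric]) (auto simp: d measurable_completion)
  then show "distr lebesgue lebesgue to_wo = lebesgue" by (simp add: d)
qed

lemma bij_Abs_wo_copy: "bij Abs_wo_copy"
  by (metis Abs_wo_copy_inverse Rep_wo_copy_inverse UNIV_I bij_betw_def injI surj_def)

text \<open>Conjugation with the bijection of index types maps permutations to permutations of the
  same sign, so the two Leibniz sums agree term by term.\<close>

lemma det_wo_copy:
  fixes A :: "real ^ 'm::finite ^ 'm"
  shows "det (\<chi> i j. A $ Rep_wo_copy i $ Rep_wo_copy j) = det A"
proof -
  let ?c = "\<lambda>p. Abs_wo_copy \<circ> p \<circ> Rep_wo_copy"
  have inv: "inv Abs_wo_copy = Rep_wo_copy"
    by (metis Abs_wo_copy_inverse UNIV_I Rep_wo_copy_inverse inv_unique_comp comp_def fun_eq_iff id_def)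
  have mp: "map_permutation UNIV Abs_wo_copy p = ?c p" for p :: "'m \<Rightarrow> 'm"
    using bij_is_surj[OF bij_Abs_wo_copy] by (auto simp: map_permutation_def restrict_id_def fun_eq_iff inv)
  have s: "sign (?c p) = sign p" if "p permutes UNIV" for p :: "'m \<Rightarrow> 'm"
    unfolding mp[symmetric] by (rule sign_map_permutation) (use that bij_is_inj[OF bij_Abs_wo_copy] in auto)
  have b: "bij_betw ?c {p. p permutes (UNIV :: 'm set)} {p. p permutes UNIV}"
  proof (rule bij_betwI[where g="\<lambda>q. Rep_wo_copy \<circ> q \<circ> Abs_wo_copy"])
    have "bij p \<Longrightarrow> bij (Abs_wo_copy \<circ> p \<circ> Rep_wo_copy)" for p :: "'m \<Rightarrow> 'm"
      by (intro bij_comp bij_Abs_wo_copy bij_Rep_wo_copy)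
    then show "?c \<in> {p. p permutes (UNIV :: 'm set)} \<rightarrow> {p. p permutes UNIV}"
      by (auto simp: permutes_def bij_iff)
    have "bij p \<Longrightarrow> bij (Rep_wo_copy \<circ> p \<circ> Abs_wo_copy)" for p :: "'m wo_copy \<Rightarrow> 'm wo_copy"
      by (intro bij_comp bij_Abs_wo_copy bij_Rep_wo_copy)
    then show "(\<lambda>q. Rep_wo_copy \<circ> q \<circ> Abs_wo_copy) \<in> {p. p permutes UNIV} \<rightarrow> {p. p permutes (UNIV :: 'm set)}"
      by (auto simp: permutes_def bij_iff)
  qed (auto simp: fun_eq_iff Abs_wo_copy_inverse Rep_wo_copy_inverse)
  have pr: "(\<Prod>i\<in>UNIV. A $ Rep_wo_copy i $ Rep_wo_copy (?c p i)) = (\<Prod>i\<in>UNIV. A $ i $ p i)" for p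
    using prod.reindex_bij_betw[OF bij_Rep_wo_copy, of "\<lambda>i. A $ i $ p i"]
    by (simp add: Abs_wo_copy_inverse)
  show ?thesis
    unfolding det_def
    by (subst sum.reindex_bij_betw[OF b, symmetric], rule sum.cong)
       (use pr s in \<open>auto simp del: o_apply\<close>)
qed

lemma matrix_conj_wo:
  fixes L :: "real ^ 'm::finite \<Rightarrow> real ^ 'm"
  shows "matrix (to_wo \<circ> L \<circ> of_wo) = (\<chi> i j. matrix L $ Rep_wo_copy i $ Rep_wo_copy j)"
proof -
  have *: "of_wo (axis j 1) = (axis (Rep_wo_copy j) 1 :: real ^ 'm)" for j
    by (auto simp: of_wo_def axis_def vec_eq_iff Abs_wo_copy_inverse Rep_wo_copy_inverse)
  show ?thesis
    by (simp add: * matrix_def to_wo_def)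
qed

text \<open>Bridge between two notions of integral: the change of variables theorem speaks of
  absolute integrability and the value of a real integral, while a measure needs an extended
  nonnegative integral that may be infinite.\<close>

lemma set_nn_integral_eq_absolute_integral:
  fixes f :: "'v::euclidean_space \<Rightarrow> real"
  assumes m: "(\<lambda>x. indicator S x * f x) \<in> borel_measurable lebesgue" and nn: "\<And>x. x \<in> S \<Longrightarrow> 0 \<le> f x"
  shows "(\<integral>\<^sup>+x\<in>S. ennreal (f x) \<partial>lebesgue) =
         (if f absolutely_integrable_on S then ennreal (integral S f) else \<infinity>)"
proof -
  have e: "(\<integral>\<^sup>+x\<in>S. ennreal (f x) \<partial>lebesgue) = (\<integral>\<^sup>+x. ennreal (indicator S x * f x) \<partial>lebesgue)"
    by (intro nn_integral_cong) (auto simp: indicator_def)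
  show ?thesis
  proof (cases "f absolutely_integrable_on S")
    case True
    then have i: "integrable lebesgue (\<lambda>x. indicator S x * f x)" by (simp add: set_integrable_def)
    have "(\<integral>\<^sup>+x. ennreal (indicator S x * f x) \<partial>lebesgue) = ennreal (\<integral>x. indicator S x * f x \<partial>lebesgue)"
      by (rule nn_integral_eq_integral[OF i]) (use nn in \<open>auto simp: indicator_def\<close>)
    also have "(\<integral>x. indicator S x * f x \<partial>lebesgue) = integral S f"
      using set_lebesgue_integral_eq_integral(2)[OF True] by (simp add: set_lebesgue_integral_def)
    finally show ?thesis using True e by simp
  next
    case False
    have "(\<integral>\<^sup>+x. ennreal (indicator S x * f x) \<partial>lebesgue) = \<infinity>"
    proof (rule ccontr)
      assume "\<not> ?thesis"
      then have "integrable lebesgue (\<lambda>x. indicator S x * f x)"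
        by (intro integrableI_nonneg m) (use nn in \<open>auto simp: indicator_def less_top\<close>)
      then show False using False by (simp add: set_integrable_def)
    qed
    then show ?thesis using False e by simp
  qed
qed

lemma set_nn_integral_change_of_variables_wellorder:
  fixes g :: "real ^ 'm::{finite,wellorder} \<Rightarrow> real ^ 'm::_"
  assumes S: "S \<in> sets lebesgue"
    and der: "\<And>x. x \<in> S \<Longrightarrow> (g has_derivative g' x) (at x within S)"
    and inj: "inj_on g S" and nn: "\<And>x. x \<in> g ` S \<Longrightarrow> 0 \<le> f x"
    and m1: "(\<lambda>x. indicator (g ` S) x * f x) \<in> borel_measurable lebesgue"
    and m2: "(\<lambda>x. indicator S x * (\<bar>det (matrix (g' x))\<bar> * f (g x))) \<in> borel_measurable lebesgue"
  shows "(\<integral>\<^sup>+x\<in>g ` S. ennreal (f x) \<partial>lebesgue) =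
         (\<integral>\<^sup>+x\<in>S. ennreal (\<bar>det (matrix (g' x))\<bar> * f (g x)) \<partial>lebesgue)"
proof -
  let ?d = "\<lambda>x. \<bar>det (matrix (g' x))\<bar> * f (g x)"
  \<comment> \<open>The integrand is embedded into \<open>real ^ 1\<close> because the theorem
    treats vector-valued functions.\<close>
  have iff: "?d absolutely_integrable_on S \<and> integral S ?d = b
      \<longleftrightarrow> f absolutely_integrable_on (g ` S) \<and> integral (g ` S) f = b" for b
  proof -
    have "(\<lambda>x. \<bar>det (matrix (g' x))\<bar> *\<^sub>R (vec (f (g x)) :: real ^ 1)) absolutely_integrable_on S \<and>
           integral S (\<lambda>x. \<bar>det (matrix (g' x))\<bar> *\<^sub>R (vec (f (g x)) :: real ^ 1)) = vec b
         \<longleftrightarrow> (\<lambda>x. vec (f x) :: real ^ 1) absolutely_integrable_on (g ` S) \<and> integral (g ` S) (\<lambda>x. vec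
             (f x) :: real ^ 1) = vec b"
      by (rule has_absolute_integral_change_of_variables[OF S der inj])
    then show ?thesis
      by (simp add: absolutely_integrable_on_1_iff integral_on_1_eq vec_eq_iff)
  qed
  show ?thesis
  proof -
    have "(\<integral>\<^sup>+x\<in>g ` S. ennreal (f x) \<partial>lebesgue) =
         (if f absolutely_integrable_on g ` S then ennreal (integral (g ` S) f) else \<infinity>)"
      by (rule set_nn_integral_eq_absolute_integral[OF m1]) (use nn in auto)
    moreover have "(\<integral>\<^sup>+x\<in>S. ennreal (?d x) \<partial>lebesgue) =
         (if ?d absolutely_integrable_on S then ennreal (integral S ?d) else \<infinity>)"
      by (rule set_nn_integral_eq_absolute_integral[OF m2]) (use nn in auto)
    \<comment> \<open>Each of the two integrals is inserted as the value \<open>b\<close>, so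
      integrability passes in both directions and the infinite cases coincide too.\<close>
    ultimately show ?thesis using iff[of "integral S ?d"] iff[of "integral (g ` S) f"] by auto
  qed
qed

lemma nn_integral_to_wo:
  fixes f :: "real ^ ('m::finite wo_copy) \<Rightarrow> ennreal"
  assumes "f \<in> borel_measurable lebesgue"
  shows "(\<integral>\<^sup>+x. f x \<partial>lebesgue) = (\<integral>\<^sup>+x. f (to_wo x) \<partial>lebesgue)"
  by (subst distr_lebesgue_to_wo[symmetric], rule nn_integral_distr)
      (use assms to_wo_measurable_lebesgue in auto)

lemma of_wo_measurable_lebesgue: "of_wo \<in> lebesgue \<rightarrow>\<^sub>M (lebesgue :: (real ^ 'm::finite) measure)"
proof -
  have b: "of_wo \<in> borel \<rightarrow>\<^sub>M (borel :: (real ^ 'm) measure)"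
    by (intro borel_measurable_continuous_onI linear_continuous_on linear_of_wo
        linear_conv_bounded_linear[THEN iffD1])
  have b': "to_wo \<in> (borel :: (real ^ 'm) measure) \<rightarrow>\<^sub>M borel"
    by (intro borel_measurable_continuous_onI linear_continuous_on linear_to_wo
        linear_conv_bounded_linear[THEN iffD1])
  have "distr lborel borel of_wo = distr (distr lborel borel to_wo) borel (of_wo :: _ \<Rightarrow> real ^ 'm)"
    by (simp only: distr_lborel_to_wo)
  also have "\<dots> = distr lborel borel (of_wo \<circ> to_wo)"
    using b b' by (subst distr_distr) auto
  also have "\<dots> = distr lborel lborel (\<lambda>x. x)"
    by (rule distr_cong) auto
  also have "\<dots> = lborel" by (rule distr_id)
  finally have d1: "distr lborel borel of_wo = (lborel :: (real ^ 'm) measure)" .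
  have d: "distr lebesgue lborel of_wo = (lborel :: (real ^ 'm) measure)"
    using b by (simp add: distr_completion d1[symmetric] cong: distr_cong)
  show ?thesis
    by (rule completion.measurable_completion2) (use b in \<open>auto simp: d measurable_completion\<close>)
qed

text \<open>Conjugate with \<open>to_wo\<close>: this preserves Lebesgue measure and the Jacobian
  determinant, and moves the claim to a well-ordered index type.\<close>

lemma set_nn_integral_change_of_variables:
  fixes g :: "real ^ 'm::finite \<Rightarrow> real ^ 'm"
  assumes S: "S \<in> sets lebesgue"
    and der: "\<And>x. x \<in> S \<Longrightarrow> (g has_derivative g' x) (at x within S)"
    and inj: "inj_on g S" and nn: "\<And>x. x \<in> g ` S \<Longrightarrow> 0 \<le> f x"
    and m1: "(\<lambda>x. indicator (g ` S) x * f x) \<in> borel_measurable lebesgue"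
    and m2: "(\<lambda>x. indicator S x * (\<bar>det (matrix (g' x))\<bar> * f (g x))) \<in> borel_measurable lebesgue"
  shows "(\<integral>\<^sup>+x\<in>g ` S. ennreal (f x) \<partial>lebesgue) =
         (\<integral>\<^sup>+x\<in>S. ennreal (\<bar>det (matrix (g' x))\<bar> * f (g x)) \<partial>lebesgue)"
proof -
  let ?g = "to_wo \<circ> g \<circ> of_wo" and ?g' = "\<lambda>x. to_wo \<circ> g' (of_wo x) \<circ> of_wo"
  let ?S = "of_wo -` S" and ?f = "\<lambda>x. f (of_wo x)"
  have img: "?g ` ?S = of_wo -` (g ` S)"
  proof safe
    fix x y assume "of_wo x = g y" "y \<in> S"
    then have "x = ?g (to_wo y)" "to_wo y \<in> ?S" by (auto simp flip: \<open>of_wo x = g y\<close>)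
    then show "x \<in> ?g ` ?S" by blast
  qed auto
  have bl: "bounded_linear of_wo" "bounded_linear to_wo"
    by (auto simp: linear_to_wo linear_of_wo linear_conv_bounded_linear[symmetric])
  have "(\<integral>\<^sup>+x\<in>?g ` ?S. ennreal (?f x) \<partial>lebesgue) =
         (\<integral>\<^sup>+x\<in>?S. ennreal (\<bar>det (matrix (?g' x))\<bar> * ?f (?g x)) \<partial>lebesgue)"
  proof (rule set_nn_integral_change_of_variables_wellorder)
    show "?S \<in> sets lebesgue"
      using measurable_sets[OF of_wo_measurable_lebesgue S] by simp
    show "(?g has_derivative ?g' x) (at x within ?S)" if "x \<in> ?S" for x
    proof -
      have 1: "(of_wo has_derivative of_wo) (at x within ?S)"
        by (rule bounded_linear_imp_has_derivative[OF bl(1)])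
      have "(g has_derivative g' (of_wo x)) (at (of_wo x) within of_wo ` ?S)"
        using der[of "of_wo x"] that by (auto intro: has_derivative_subset)
      from diff_chain_within[OF 1 this]
      have 2: "(g \<circ> of_wo has_derivative g' (of_wo x) \<circ> of_wo) (at x within ?S)" .
      from diff_chain_within[OF this bounded_linear_imp_has_derivative[OF bl(2)]]
      show ?thesis by (simp add: comp_assoc)
    qed
    show "inj_on ?g ?S"
    proof (rule inj_onI)
      fix x y assume xy: "x \<in> ?S" "y \<in> ?S" "?g x = ?g y"
      then have "of_wo (?g x) = of_wo (?g y)" by simp
      then have "g (of_wo x) = g (of_wo y)" by simp
      then have "of_wo x = of_wo y" using inj xy by (auto dest: inj_onD)
      then have "to_wo (of_wo x) = to_wo (of_wo y)" by simp
      then show "x = y" by simp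
    qed
    show "0 \<le> ?f x" if "x \<in> ?g ` ?S" for x using that nn unfolding img by auto
    have "(\<lambda>x. indicator (g ` S) (of_wo x) * f (of_wo x)) \<in> borel_measurable lebesgue"
      using measurable_compose[OF of_wo_measurable_lebesgue m1] .
    then show "(\<lambda>x. indicator (?g ` ?S) x * ?f x) \<in> borel_measurable lebesgue"
      unfolding img by (simp add: indicator_def)
    show "(\<lambda>x. indicator ?S x * (\<bar>det (matrix (?g' x))\<bar> * ?f (?g x))) \<in> borel_measurable lebesgue"
      using measurable_compose[OF of_wo_measurable_lebesgue m2]
      by (simp add: matrix_conj_wo det_wo_copy indicator_def)
  qed
  also have "(\<integral>\<^sup>+x\<in>?g ` ?S. ennreal (?f x) \<partial>lebesgue)
      = (\<integral>\<^sup>+x. ennreal (indicator (g ` S) (of_wo x) * f (of_wo x)) \<partial>lebesgue)"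
    unfolding img by (intro nn_integral_cong) (auto simp: indicator_def)
  also have "\<dots> = (\<integral>\<^sup>+x. ennreal (indicator (g ` S) x * f x) \<partial>lebesgue)"
    using measurable_compose[OF of_wo_measurable_lebesgue m1]
    by (subst nn_integral_to_wo) auto
  also have "\<dots> = (\<integral>\<^sup>+x\<in>g ` S. ennreal (f x) \<partial>lebesgue)"
    by (intro nn_integral_cong) (auto simp: indicator_def)
  also have "(\<integral>\<^sup>+x\<in>?S. ennreal (\<bar>det (matrix (?g' x))\<bar> * ?f (?g x)) \<partial>lebesgue) =
    (\<integral>\<^sup>+x. ennreal (indicator S (of_wo x) * (\<bar>det (matrix (g' (of_wo x)))\<bar> * f (g (of_wo x)))) \<partial>lebesgue)"
    by (intro nn_integral_cong) (auto simp: indicator_def matrix_conj_wo det_wo_copy)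
  also have "\<dots> = (\<integral>\<^sup>+x. ennreal (indicator S x * (\<bar>det (matrix (g' x))\<bar> * f (g x))) \<partial>lebesgue)"
    using measurable_compose[OF of_wo_measurable_lebesgue m2]
    by (subst nn_integral_to_wo) auto
  also have "\<dots> = (\<integral>\<^sup>+x\<in>S. ennreal (\<bar>det (matrix (g' x))\<bar> * f (g x)) \<partial>lebesgue)"
    by (intro nn_integral_cong) (auto simp: indicator_def)
  finally show ?thesis .
qed

section \<open>C1 calculus and charts\<close>

lemma C1_on_subset: "C1_on T f \<Longrightarrow> S \<subseteq> T \<Longrightarrow> C1_on S f"
  unfolding C1_on_def by (meson continuous_on_subset subsetD)

lemma C1_on_has_derivative: "C1_on S f \<Longrightarrow> x \<in> S \<Longrightarrow> (f has_derivative frechet_derivative f (at x)) (at x)"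
  unfolding C1_on_def using frechet_derivative_works differentiableI by blast

text \<open>Derivatives are unique, so whatever witness \<open>C1_on\<close> provides is this
  canonical one. Local facts about it can then be glued, as in \<open>C1_on_locally\<close>.\<close>

lemma C1_on_continuous_derivative:
  assumes "C1_on S f" shows "continuous_on S (\<lambda>x. Blinfun (frechet_derivative f (at x)))"
proof -
  from assms obtain f' where f': "\<And>x. x \<in> S \<Longrightarrow>
      (f has_derivative blinfun_apply (f' x)) (at x)" "continuous_on S f'"
    unfolding C1_on_def by blast
  have "Blinfun (frechet_derivative f (at x)) = f' x" if "x \<in> S" for x
    using frechet_derivative_at[OF f'(1)[OF that], symmetric] by (simp add: blinfun_apply_inverse)
  with f'(2) show ?thesis by (simp cong: continuous_on_cong)
qed

lemma C1_on_locally: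
  assumes "\<And>x. x \<in> S \<Longrightarrow> \<exists>T. open T \<and> x \<in> T \<and> C1_on T f"
  shows "C1_on S f"
  unfolding C1_on_def
proof (intro exI conjI ballI)
  fix x assume "x \<in> S"
  then obtain T where T: "open T" "x \<in> T" "C1_on T f" using assms by blast
  have "(f has_derivative frechet_derivative f (at x)) (at x)"
    by (rule C1_on_has_derivative[OF T(3,2)])
  then show "(f has_derivative blinfun_apply (Blinfun (frechet_derivative f (at x)))) (at x)"
    by (simp add: bounded_linear_Blinfun_apply has_derivative_bounded_linear)
next
  show "continuous_on S (\<lambda>x. Blinfun (frechet_derivative f (at x)))"
    unfolding continuous_on_eq_continuous_within
  proof
    fix x assume "x \<in> S"
    then obtain T where T: "open T" "x \<in> T" "C1_on T f" using assms by blast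
    then show "continuous (at x within S) (\<lambda>x. Blinfun (frechet_derivative f (at x)))"
      using C1_on_continuous_derivative[OF T(3)]
      by (metis continuous_at_imp_continuous_at_within continuous_on_eq_continuous_at)
  qed
qed

lemma C1_on_cong:
  assumes "C1_on S f" "open S" "\<And>x. x \<in> S \<Longrightarrow> f x = g x"
  shows "C1_on S g"
  using assms unfolding C1_on_def
  by (metis has_derivative_transform_within_open)

lemma C1_on_comp:
  assumes "C1_on S f" "C1_on T g" "f ` S \<subseteq> T"
  shows "C1_on S (g \<circ> f)"
proof -
  from assms obtain f' where f': "\<And>x. x \<in> S \<Longrightarrow>
      (f has_derivative blinfun_apply (f' x)) (at x)" "continuous_on S f'"
    unfolding C1_on_def by blast
  from assms obtain g' where g': "\<And>x. x \<in> T \<Longrightarrow>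
      (g has_derivative blinfun_apply (g' x)) (at x)" "continuous_on T g'"
    unfolding C1_on_def by blast
  have cf: "continuous_on S f"
    using f'(1) by (meson continuous_at_imp_continuous_on has_derivative_continuous)
  show ?thesis
    unfolding C1_on_def
  proof (intro exI conjI ballI)
    fix x assume x: "x \<in> S"
    have "(g \<circ> f has_derivative (blinfun_apply (g' (f x)) \<circ> blinfun_apply (f' x))) (at x)"
      by (rule diff_chain_at) (use f' g' x assms(3) in auto)
    then show "(g \<circ> f has_derivative blinfun_apply (g' (f x) o\<^sub>L f' x)) (at x)"
      by (simp add: blinfun_compose.rep_eq)
  next
    have "continuous_on S (\<lambda>x. g' (f x))"
      by (rule continuous_on_compose2[OF g'(2) cf assms(3)])
    then show "continuous_on S (\<lambda>x. g' (f x) o\<^sub>L f' x)"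
      using f'(2) by (intro continuous_intros)
  qed
qed

lemma C1_on_bounded_linear: "bounded_linear f \<Longrightarrow> C1_on S f"
  unfolding C1_on_def
  by (rule exI[of _ "\<lambda>_. Blinfun f"])
      (auto simp: bounded_linear_Blinfun_apply bounded_linear_imp_has_derivative)

lemma C1_on_const: "C1_on S (\<lambda>_. c)"
  unfolding C1_on_def by (rule exI[of _ "\<lambda>_. 0"]) (auto simp: zero_blinfun.rep_eq)

lemma C1_on_add:
  assumes "C1_on S f" "C1_on S g" shows "C1_on S (\<lambda>x. f x + g x)"
proof -
  from assms obtain f' g' where
    f': "\<And>x. x \<in> S \<Longrightarrow> (f has_derivative blinfun_apply (f' x)) (at x)" "continuous_on S f'"
    and g': "\<And>x. x \<in> S \<Longrightarrow> (g has_derivative blinfun_apply (g' x)) (at x)" "continuous_on S g'"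
    unfolding C1_on_def by metis
  then show ?thesis unfolding C1_on_def
    by (intro exI[of _ "\<lambda>x. f' x
        + g' x"]) (auto intro!: continuous_intros has_derivative_add simp: plus_blinfun.rep_eq)
qed

lemma C1_on_mult:
  fixes f g :: "'v::real_normed_vector \<Rightarrow> real"
  assumes "C1_on S f" "C1_on S g" shows "C1_on S (\<lambda>x. f x * g x)"
proof -
  from assms obtain f' g' where
    f': "\<And>x. x \<in> S \<Longrightarrow> (f has_derivative blinfun_apply (f' x)) (at x)" "continuous_on S f'"
    and g': "\<And>x. x \<in> S \<Longrightarrow> (g has_derivative blinfun_apply (g' x)) (at x)" "continuous_on S g'"
    unfolding C1_on_def by metis
  have c: "continuous_on S f" "continuous_on S g"
    using f'(1) g'(1) by (meson continuous_at_imp_continuous_on has_derivative_continuous)+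
  have d: "((\<lambda>x. f x * g x) has_derivative blinfun_apply (f x *\<^sub>R g' x + g x *\<^sub>R f' x)) (at x)" if "x \<in> S"
      for x
    using has_derivative_mult[OF f'(1)[OF that] g'(1)[OF that]]
    by (simp add: plus_blinfun.rep_eq scaleR_blinfun.rep_eq fun_eq_iff mult_ac has_derivative_def)
  show ?thesis unfolding C1_on_def
    by (rule exI[of _ "\<lambda>x. f x *\<^sub>R g' x + g x *\<^sub>R f' x"]) (use d c f' g' in \<open>auto intro!: continuous_intros\<close>)
qed

lemma C1_on_real_polynomial_function:
  "real_polynomial_function p \<Longrightarrow> C1_on S p"
proof (induction rule: real_polynomial_function.induct)
  case (linear f) then show ?case by (rule C1_on_bounded_linear)
next
  case (const c) show ?case by (rule C1_on_const)
next
  case (add f g) from add.IH show ?case by (rule C1_on_add)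
next
  case (mult f g) from mult.IH show ?case by (rule C1_on_mult)
qed

lemma topological_chartD:
  assumes "topological_chart c"
  shows "open (fst c)" "open (chart_image c)"
    "\<And>x. x \<in> fst c \<Longrightarrow> snd c x \<in> chart_image c"
    "\<And>x. x \<in> fst c \<Longrightarrow> chart_inv c (snd c x) = x"
    "\<And>y. y \<in> chart_image c \<Longrightarrow> chart_inv c y \<in> fst c"
    "\<And>y. y \<in> chart_image c \<Longrightarrow> snd c (chart_inv c y) = y"
    "continuous_on (fst c) (snd c)" "continuous_on (chart_image c) (chart_inv c)"
    "inj_on (snd c) (fst c)"
proof -
  have h: "homeomorphism (fst c) (chart_image c) (snd c) (chart_inv c)"
    and o: "open (fst c)" "open (chart_image c)"
    using assms by (auto simp: topological_chart_def)
  show "open (fst c)" "open (chart_image c)" by fact+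
  show "\<And>x. x \<in> fst c \<Longrightarrow> snd c x \<in> chart_image c" by (auto simp: chart_image_def)
  show 4: "\<And>x. x \<in> fst c \<Longrightarrow> chart_inv c (snd c x) = x"
    "\<And>y. y \<in> chart_image c \<Longrightarrow> chart_inv c y \<in> fst c"
    "\<And>y. y \<in> chart_image c \<Longrightarrow> snd c (chart_inv c y) = y"
    "continuous_on (fst c) (snd c)" "continuous_on (chart_image c) (chart_inv c)"
    using h by (auto simp: homeomorphism_def)
  show "inj_on (snd c) (fst c)" using 4(1) by (rule inj_on_inverseI)
qed

lemma C1_structureD:
  assumes "C1_structure M"
  shows "\<And>c. c \<in> M \<Longrightarrow> topological_chart c" "\<And>x. \<exists>c\<in>M. x \<in> fst c"
    "\<And>c c'. c \<in> M \<Longrightarrow> c' \<in> M \<Longrightarrow> C1_compatible c c'"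
    "\<And>c. topological_chart c \<Longrightarrow> (\<And>c'. c' \<in> M \<Longrightarrow> C1_compatible c c') \<Longrightarrow> c \<in> M"
  using assms unfolding C1_structure_def by (blast, blast, blast, blast)

lemma open_chart_preimage:
  assumes "topological_chart c" "open W" shows "open (chart_image c \<inter> chart_inv c -` W)"
  using continuous_open_preimage[OF topological_chartD(8,2)[OF assms(1)] assms(2)] .

lemma open_chart_preimage':
  assumes "topological_chart c" "open W" shows "open (fst c \<inter> snd c -` W)"
  using continuous_open_preimage[OF topological_chartD(7,1)[OF assms(1)] assms(2)] .

lemma chart_image_Int:
  assumes "topological_chart c" shows "snd c ` (B \<inter> fst c) = chart_image c \<inter> chart_inv c -` B"
  using topological_chartD(3-6)[OF assms] by (force simp: image_iff)

lemma chart_image_subset: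
  assumes "topological_chart c" "B \<subseteq> fst c" shows "snd c ` B = chart_image c \<inter> chart_inv c -` B"
  using chart_image_Int[OF assms(1), of B] assms(2) by (simp add: Int_absorb2)

section \<open>Transition maps, tangent coordinates and restriction of charts\<close>

locale C1_manifold =
  fixes M :: "('a::{t2_space, second_countable_topology}, 'm::finite) chart set"
  assumes C1_structure: "C1_structure M"
begin

lemmas top_chart = C1_structureD(1)[OF C1_structure]
lemmas chart_ex = C1_structureD(2)[OF C1_structure]
lemmas maximal = C1_structureD(4)[OF C1_structure]
lemmas chart_open = topological_chartD(1)[OF top_chart]
lemmas image_open = topological_chartD(2)[OF top_chart]
lemmas chart_into = topological_chartD(3)[OF top_chart]
lemmas inv_left [simp] = topological_chartD(4)[OF top_chart]
lemmas inv_into_dom = topological_chartD(5)[OF top_chart]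
lemmas inv_right [simp] = topological_chartD(6)[OF top_chart]
lemmas chart_cont = topological_chartD(7)[OF top_chart]
lemmas inv_cont = topological_chartD(8)[OF top_chart]
lemmas chart_inj = topological_chartD(9)[OF top_chart]
lemmas image_Int = chart_image_Int[OF top_chart]
lemmas image_sub = chart_image_subset[OF top_chart]

abbreviation transition where "transition c c' \<equiv> snd c' \<circ> chart_inv c"

lemma transition_C1:
  assumes "c \<in> M" "c' \<in> M"
  shows "C1_on (snd c ` (fst c \<inter> fst c')) (transition c c')"
  using C1_structureD(3)[OF C1_structure assms] by (simp add: C1_compatible_def)

lemma overlap_open:
  assumes "c \<in> M" "c' \<in> M" shows "open (snd c ` (fst c \<inter> fst c'))"
  using image_Int[OF assms(1), of "fst c'"] open_chart_preimage[OF top_chart[OF assms(1)] chart_open[OF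
      assms(2)]]
  by (simp add: Int_commute)

lemma transition_has_derivative:
  assumes "c \<in> M" "c' \<in> M" "x \<in> fst c" "x \<in> fst c'"
  shows "(transition c c' has_derivative frechet_derivative (transition c c') (at (snd c x))) (at (snd c x))"
  using C1_on_has_derivative[OF transition_C1[OF assms(1,2)], of "snd c x"] assms(3,4) by blast

lemma transition_trans:
  assumes "c \<in> M" "c' \<in> M" "x \<in> fst c" "x \<in> fst c'"
    and f: "(f \<circ> chart_inv c' has_derivative f') (at (snd c' x))"
  shows "(f \<circ> chart_inv c has_derivative f' \<circ> frechet_derivative (transition c c') (at (snd c x))) (at
      (snd c x))"
proof -
  have "(f \<circ> chart_inv c' \<circ> transition c c' has_derivative f' \<circ> frechet_derivative (transition c c') (at
      (snd c x))) (at (snd c x))"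
    by (rule diff_chain_at[OF transition_has_derivative[OF assms(1-4)]]) (use f assms in simp)
  then show ?thesis
  proof (rule has_derivative_transform_within_open[OF _ overlap_open[OF assms(1,2)]])
    show "snd c x \<in> snd c ` (fst c \<inter> fst c')" using assms by blast
    show "(f \<circ> chart_inv c' \<circ> transition c c') y = (f \<circ> chart_inv c) y" if "y \<in> snd c ` (fst c \<inter> fst c')"
        for y
      using that assms by auto
  qed
qed

lemma transition_self:
  assumes "c \<in> M" "x \<in> fst c"
  shows "(transition c c has_derivative id) (at (snd c x))"
  by (rule has_derivative_transform_within_open[OF has_derivative_id image_open[OF assms(1)]])
     (use assms chart_into in auto)

lemma ref_chart: "ref_chart M x \<in> M" "x \<in> fst (ref_chart M x)"
proof -
  have "ref_chart M x \<in> M \<and> x \<in> fst (ref_chart M x)"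
    unfolding ref_chart_def using chart_ex[of x] by (metis (mono_tags, lifting) someI_ex)
  then show "ref_chart M x \<in> M" "x \<in> fst (ref_chart M x)" by auto
qed

text \<open>By the chain rule the composite is the derivative of the coordinate change from
  \<open>c\<close> to itself, which is the identity near the point.\<close>

lemma transition_inverse:
  assumes "c \<in> M" "c' \<in> M" "x \<in> fst c" "x \<in> fst c'"
  shows "frechet_derivative (transition c' c) (at (snd c' x)) \<circ> frechet_derivative (transition c c') (at
      (snd c x)) = id"
  using transition_trans[OF assms transition_has_derivative[OF assms(2,1,4,3)]]
    transition_self[OF assms(1,3)] has_derivative_unique by blast

text \<open>Removes the arbitrary reference chart: a differential may be computed in any chart
  around the point, with \<open>chart_diff\<close> translating tangent vectors.\<close>

lemma mdiff_eq:
  assumes "c \<in> M" "x \<in> fst c" and f: "(f \<circ> chart_inv c has_derivative f') (at (snd c x))"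
  shows "mdiff M f x = f' \<circ> chart_diff M c x"
  unfolding mdiff_def chart_diff_def
  using frechet_derivative_at[OF transition_trans[OF ref_chart(1) assms(1) ref_chart(2) assms(2) f]] by simp

lemma chart_diff_eq:
  "chart_diff M c x = frechet_derivative (transition (ref_chart M x) c) (at (snd (ref_chart M x) x))"
  unfolding chart_diff_def mdiff_def ..

lemma chart_diff_linear:
  assumes "c \<in> M" "x \<in> fst c" shows "linear (chart_diff M c x)"
  unfolding chart_diff_eq
  using transition_has_derivative[OF ref_chart(1) assms(1) ref_chart(2) assms(2)] has_derivative_linear
      by blast

lemma chart_diff_bij:
  assumes "c \<in> M" "x \<in> fst c" shows "bij (chart_diff M c x)"
  unfolding chart_diff_eq
  by (rule o_bij[OF transition_inverse[OF ref_chart(1) assms(1) ref_chart(2) assms(2)]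
       transition_inverse[OF assms(1) ref_chart(1) assms(2) ref_chart(2)]])

lemma chart_diff_transition:
  assumes "c \<in> M" "c' \<in> M" "x \<in> fst c" "x \<in> fst c'"
  shows "chart_diff M c' x = frechet_derivative (transition c c') (at (snd c x)) \<circ> chart_diff M c x"
  unfolding chart_diff_def[of M c']
  by (rule mdiff_eq[OF assms(1,3) transition_has_derivative[OF assms]])

lemma inv_chart_diff [simp]:
  assumes "c \<in> M" "x \<in> fst c"
  shows "chart_diff M c x (inv (chart_diff M c x) v) = v" "inv (chart_diff M c x) (chart_diff M c x v) = v"
  using chart_diff_bij[OF assms] by (simp_all add: bij_is_surj surj_f_inv_f bij_is_inj)

lemma inv_chart_diff_linear:
  assumes "c \<in> M" "x \<in> fst c" shows "linear (inv (chart_diff M c x))"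
proof -
  let ?L = "chart_diff M c x"
  interpret L: linear ?L by (rule chart_diff_linear[OF assms])
  note inj = injD[OF bij_is_inj[OF chart_diff_bij[OF assms]]]
  have "?L (inv ?L (v + w)) = ?L (inv ?L v + inv ?L w)" "?L (inv ?L (r *\<^sub>R v)) = ?L (r *\<^sub>R inv ?L v)"
      for v w r
    unfolding L.add L.scale inv_chart_diff(1)[OF assms] by (rule refl)+
  then show ?thesis by (intro linearI) (blast dest: inj)+
qed

text \<open>Local convergence in measure asks for a chart on whose entire domain the measures tend
  to 0. Shrinking a domain to a coordinate ball of finite volume is the way to get one; maximality
  keeps the result in the atlas.\<close>

lemma chart_restrict:
  assumes "c \<in> M" "open W" "W \<subseteq> fst c"
  shows "(W, snd c) \<in> M" "chart_image (W, snd c) = snd c ` W" "\<And>y. y \<in> snd c ` W \<Longrightarrow>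
      chart_inv (W, snd c) y = chart_inv c y"
proof -
  let ?d = "(W, snd c)"
  show im: "chart_image ?d = snd c ` W" by (simp add: chart_image_def)
  have injW: "inj_on (snd c) W" using chart_inj[OF assms(1)] assms(3) by (rule inj_on_subset)
  show ci: "chart_inv ?d y = chart_inv c y" if y: "y \<in> snd c ` W" for y
  proof -
    obtain x where x: "x \<in> W" "y = snd c x" using y by blast
    have "chart_inv ?d y = x" using x injW by (simp add: chart_inv_def)
    also have "x = chart_inv c y" using x assms by auto
    finally show ?thesis .
  qed
  have oW: "open (snd c ` W)"
    using image_sub[OF assms(1,3)] open_chart_preimage[OF top_chart[OF assms(1)] assms(2)] by simp
  have sub: "snd c ` W \<subseteq> chart_image c" using assms(3) by (auto simp: chart_image_def)
  have top: "topological_chart ?d"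
    unfolding topological_chart_def im
  proof (intro conjI)
    show "homeomorphism (fst ?d) (snd c ` W) (snd ?d) (chart_inv ?d)"
    proof (rule homeomorphismI)
      show "continuous_on (fst ?d) (snd ?d)"
        using chart_cont[OF assms(1)] assms(3) by (auto intro: continuous_on_subset)
      show "continuous_on (snd c ` W) (chart_inv ?d)"
        using continuous_on_subset[OF inv_cont[OF assms(1)] sub] ci by (simp cong: continuous_on_cong)
    qed (use ci assms in auto)
  qed (use assms oW in auto)
  show "?d \<in> M"
  proof (rule maximal[OF top])
    fix c' assume c': "c' \<in> M"
    have 1: "C1_on (snd c ` (W \<inter> fst c')) (snd c' \<circ> chart_inv ?d)"
    proof (rule C1_on_cong)
      show "C1_on (snd c ` (W \<inter> fst c')) (snd c' \<circ> chart_inv c)"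
        by (rule C1_on_subset[OF transition_C1[OF assms(1) c']]) (use assms(3) in auto)
      have "W \<inter> fst c' \<subseteq> fst c" using assms(3) by auto
      from image_sub[OF assms(1) this] open_chart_preimage[OF top_chart[OF assms(1)], of "W \<inter> fst c'"]
      show "open (snd c ` (W \<inter> fst c'))" using assms(2) chart_open[OF c'] by auto
    qed (use ci in auto)
    have 2: "C1_on (snd c' ` (W \<inter> fst c')) (snd c \<circ> chart_inv c')"
      by (rule C1_on_subset[OF transition_C1[OF c' assms(1)]]) (use assms(3) in auto)
    show "C1_compatible ?d c'" using 1 2 by (simp add: C1_compatible_def)
  qed
qed

end

section \<open>Inner products, orthonormal frames and Gram matrices\<close>

definition inner_form :: "('v::real_vector \<Rightarrow> 'v \<Rightarrow> real) \<Rightarrow> bool" where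
  "inner_form g \<longleftrightarrow> bilinear g \<and> (\<forall>v w. g v w = g w v) \<and> (\<forall>v. v \<noteq> 0 \<longrightarrow> g v v > 0)"

lemma inner_formD:
  assumes "inner_form g"
  shows "bilinear g" "g v w = g w v" "v \<noteq> 0 \<Longrightarrow> g v v > 0" "g v v \<ge> 0"
    "linear (g v)" "linear (\<lambda>v. g v w)"
proof -
  show b: "bilinear g" "g v w = g w v" "v \<noteq> 0 \<Longrightarrow> g v v > 0" for v w
    using assms by (auto simp: inner_form_def)
  then show "linear (g v)" "linear (\<lambda>v. g v w)" using b(1) unfolding bilinear_def by blast+
  show "g v v \<ge> 0" using b(3)[of v] bilinear_lzero[OF b(1)] by (cases "v = 0") auto
qed

definition orthonormal_frame :: "('v \<Rightarrow> 'v \<Rightarrow> real) \<Rightarrow> ('m \<Rightarrow> 'v) \<Rightarrow> bool" where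
  "orthonormal_frame g e \<longleftrightarrow> (\<forall>i j. g (e i) (e j) = (if i = j then 1 else 0))"

text \<open>Gram-Schmidt, by induction over the set of indices already served. Without existence the
  choice inside \<open>hs_norm\<close> would say nothing.\<close>

lemma orthonormal_frame_exists:
  fixes g :: "real ^ 'm::finite \<Rightarrow> real ^ 'm \<Rightarrow> real"
  assumes g: "inner_form g"
  shows "\<exists>e :: 'm \<Rightarrow> real ^ 'm. orthonormal_frame g e"
proof -
  note [simp] = bilinear_lsub[OF inner_formD(1)[OF g]] bilinear_rsub[OF inner_formD(1)[OF g]]
    bilinear_lmul[OF inner_formD(1)[OF g]] bilinear_rmul[OF inner_formD(1)[OF g]]
    bilinear_lzero[OF inner_formD(1)[OF g]] bilinear_rzero[OF inner_formD(1)[OF g]]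
  have "\<exists>e :: 'm \<Rightarrow> real ^ 'm. \<forall>i\<in>I. \<forall>j\<in>I. g (e i) (e j) = (if i = j then 1 else 0)" for I :: "'m set"
    using finite[of I]
  proof (induction I rule: finite_induct)
    case empty then show ?case by simp
  next
    case (insert k I)
    then obtain e :: "'m \<Rightarrow> real ^ 'm" where e: "\<And>i j. i \<in> I \<Longrightarrow> j \<in> I \<Longrightarrow>
        g (e i) (e j) = (if i = j then 1 else 0)" by blast
    \<comment> \<open>Fewer than \<open>CARD('m)\<close> vectors cannot span, so some vector lies
      outside; subtracting its components leaves a nonzero vector orthogonal to the previous
      ones.\<close>
    have "dim (span (e ` I)) \<le> card I"
      by (metis card_image_le dim_le_card' dim_span finite finite_imageI order_trans)
    also have "card I < CARD('m)"
      by (rule psubset_card_mono) (use insert in auto)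
    finally have "span (e ` I) \<noteq> UNIV"
        by (metis DIM_cart DIM_real dim_UNIV mult.right_neutral order_less_irrefl)
    then obtain v where v: "v \<notin> span (e ` I)" by blast
    define w where "w = v - (\<Sum>i\<in>I. g v (e i) *\<^sub>R e i)"
    have w0: "w \<noteq> 0"
    proof
      assume "w = 0"
      then have "v = (\<Sum>i\<in>I. g v (e i) *\<^sub>R e i)" by (simp add: w_def)
      also have "\<dots> \<in> span (e ` I)" by (intro span_sum span_scale span_base) auto
      finally show False using v by simp
    qed
    have o: "g w (e j) = 0" if "j \<in> I" for j
    proof -
      have "g (\<Sum>i\<in>I. g v (e i) *\<^sub>R e i) (e j) = (\<Sum>i\<in>I. g v (e i) * g (e i) (e j))"
        using linear_sum[OF inner_formD(6)[OF g], of "\<lambda>i. g v (e i) *\<^sub>R e i" I "e j"] by simp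
      also have "\<dots> = (\<Sum>i\<in>I. if i = j then g v (e j) else 0)"
        by (rule sum.cong) (use e that in auto)
      finally show ?thesis using that insert.hyps(1) by (simp add: w_def)
    qed
    have gw: "g w w > 0" using inner_formD(3)[OF g w0] .
    show ?case
    proof (intro exI[of _ "e(k := (1 / sqrt (g w w)) *\<^sub>R w)"] ballI)
      have o': "g (e j) w = 0" if "j \<in> I" for j using o[OF that] inner_formD(2)[OF g, of w "e j"] by simp
      fix i j assume "i \<in> insert k I" "j \<in> insert k I"
      then consider "i = k" "j = k" | "i = k" "j \<noteq> k" "j \<in> I" | "j
          = k" "i \<noteq> k" "i \<in> I" | "i \<noteq> k" "j \<noteq> k" "i \<in> I" "j \<in> I"
        by blast
      then show "g ((e(k := (1 / sqrt (g w w)) *\<^sub>R w)) i) ((e(k := (1 / sqrt (g w w)) *\<^sub>R w)) j) = (if i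
          = j then 1 else 0)"
        by cases (use gw o o' e in simp_all)
    qed
  qed
  from this[of UNIV] show ?thesis by (auto simp: orthonormal_frame_def)
qed

text \<open>The chosen frame depends on \<open>g\<close> alone, so one frame serves all
  \<open>h\<close> and \<open>\<xi>\<close> simultaneously.\<close>

lemma hs_norm_frame:
  fixes g :: "real ^ 'm::finite \<Rightarrow> real ^ 'm \<Rightarrow> real"
  assumes g: "inner_form g"
  obtains e :: "'m \<Rightarrow> real ^ 'm"
    where "orthonormal_frame g e" "\<And>h (\<xi> :: (real ^ 'm) \<Rightarrow>\<^sub>L (real ^ 'n)). hs_norm g h \<xi>
        = sqrt (\<Sum>i\<in>UNIV. h (\<xi> (e i)) (\<xi> (e i)))"
proof
  let ?e = "SOME e :: 'm \<Rightarrow> real ^ 'm. orthonormal_frame g e"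
  show "orthonormal_frame g ?e" using someI_ex[OF orthonormal_frame_exists[OF g]] .
  show "hs_norm g h \<xi> = sqrt (\<Sum>i\<in>UNIV. h (\<xi> (?e i)) (\<xi> (?e i)))" for h and \<xi> :: "(real ^ 'm) \<Rightarrow>\<^sub>L (real ^ 'n)"
    by (simp add: hs_norm_def orthonormal_frame_def Let_def)
qed

lemma hs_norm_nonneg:
  fixes g :: "real ^ 'm::finite \<Rightarrow> real ^ 'm \<Rightarrow> real" and h :: "real ^ 'n::finite \<Rightarrow> real ^ 'n \<Rightarrow> real"
  assumes "inner_form g" "inner_form h" shows "0 \<le> hs_norm g h \<xi>"
proof -
  obtain e :: "'m \<Rightarrow> real ^ 'm"
    where e: "\<And>h (\<xi> :: (real ^ 'm) \<Rightarrow>\<^sub>L (real ^ 'n)). hs_norm g h \<xi> = sqrt (\<Sum>i\<in>UNIV. h (\<xi> (e i)) (\<xi> (e i)))"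
    using hs_norm_frame[OF assms(1)] by blast
  show ?thesis unfolding e by (intro real_sqrt_ge_zero sum_nonneg inner_formD(4)[OF assms(2)])
qed

text \<open>Orthonormal vectors are independent, and there are as many of them as the dimension,
  hence they span.\<close>

lemma frame_expansion:
  fixes g :: "real ^ 'm::finite \<Rightarrow> real ^ 'm \<Rightarrow> real"
  assumes g: "inner_form g" and e: "orthonormal_frame g (e :: 'm \<Rightarrow> real ^ 'm)"
  shows "v = (\<Sum>i\<in>UNIV. g v (e i) *\<^sub>R e i)" and "\<bar>g v (e i)\<bar> \<le> sqrt (g v v)"
proof -
  note bl = inner_formD(1)[OF g]
  note [simp] = bilinear_lsub[OF bl] bilinear_rsub[OF bl] bilinear_lmul[OF bl] bilinear_rmul[OF bl]
    bilinear_lzero[OF bl] bilinear_rzero[OF bl]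
  have ee: "g (e i) (e j) = (if i = j then 1 else 0)" for i j using e by (simp add: orthonormal_frame_def)
  have gs: "g (\<Sum>i\<in>I. f i *\<^sub>R e i) (e j) = (\<Sum>i\<in>I. f i * g (e i) (e j))" for f j I
    using linear_sum[OF inner_formD(6)[OF g], of "\<lambda>i. f i *\<^sub>R e i" I "e j"] by simp
  have gs': "g (\<Sum>i\<in>UNIV. f i *\<^sub>R e i) (e j) = f j" for f j
  proof -
    have "(\<Sum>i\<in>UNIV. f i * g (e i) (e j)) = (\<Sum>i\<in>UNIV. if i = j then f j else 0)"
      by (rule sum.cong) (auto simp: ee)
    then show ?thesis unfolding gs by simp
  qed
  have inj: "inj e"
  proof (rule injI)
    fix i j assume "e i = e j" then show "i = j" using ee[of i j] ee[of j j] by (auto split: if_splits)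
  qed
  have "independent (range e)"
  proof
    assume "dependent (range e)"
    then obtain u w where uw: "w \<in> range e" "u w \<noteq> 0" "(\<Sum>v\<in>range e. u v *\<^sub>R v) = 0"
      using dependent_finite[of "range e"] by auto
    then obtain j where j: "w = e j" by blast
    have "(\<Sum>i\<in>UNIV. u (e i) *\<^sub>R e i) = 0" using uw(3) by (simp add: sum.reindex[OF inj])
    then have "u (e j) = 0" using gs'[of "\<lambda>i. u (e i)" j] by simp
    then show False using uw j by simp
  qed
  moreover have "card (range e) = DIM(real ^ 'm)" using inj by (simp add: card_image)
  ultimately have "span (range e) = UNIV"
    using card_eq_dim[of "range e" UNIV]
        by (metis card_ge_dim_independent dim_UNIV order_refl subset_UNIV top.extremum_uniqueI)
  then have "v \<in> span (range e)" by simp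
  then obtain u where "v = (\<Sum>w\<in>range e. u w *\<^sub>R w)"
    using span_finite[of "range e"] by auto
  then have u: "v = (\<Sum>i\<in>UNIV. u (e i) *\<^sub>R e i)" by (simp add: sum.reindex[OF inj])
  have "g v (e j) = u (e j)" for j by (subst u) (rule gs')
  with u show "v = (\<Sum>i\<in>UNIV. g v (e i) *\<^sub>R e i)" by simp
  \<comment> \<open>Bessel's inequality for a single frame vector.\<close>
  have "0 \<le> g (v - g v (e i) *\<^sub>R e i) (v - g v (e i) *\<^sub>R e i)" by (rule inner_formD(4)[OF g])
  also have "\<dots> = g v v - (g v (e i))\<^sup>2"
    using ee inner_formD(2)[OF g, of "e i" v] by (simp add: power2_eq_square)
  finally show "\<bar>g v (e i)\<bar> \<le> sqrt (g v v)" by (intro real_le_rsqrt) simp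
qed

text \<open>A bound at one point only; a bound uniform over the manifold comes from compactness in
  \<open>chart_pullback_bound\<close>.\<close>

lemma inner_form_bounds_functional:
  fixes h :: "real ^ 'n::finite \<Rightarrow> real ^ 'n \<Rightarrow> real"
  assumes h: "inner_form h" and \<phi>: "linear \<phi>"
  obtains L where "0 \<le> L" "\<And>v. \<bar>\<phi> v :: real\<bar> \<le> L * sqrt (h v v)"
proof -
  obtain e :: "'n \<Rightarrow> real ^ 'n" where e: "orthonormal_frame h e" using orthonormal_frame_exists[OF h] by blast
  let ?L = "\<Sum>i\<in>UNIV. \<bar>\<phi> (e i)\<bar>"
  have "\<bar>\<phi> v\<bar> \<le> ?L * sqrt (h v v)" for v
  proof -
    have "\<phi> v = \<phi> (\<Sum>i\<in>UNIV. h v (e i) *\<^sub>R e i)" using frame_expansion(1)[OF h e] by simp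
    also have "\<dots> = (\<Sum>i\<in>UNIV. h v (e i) * \<phi> (e i))"
      using linear_sum[OF \<phi>, of "\<lambda>i. h v (e i) *\<^sub>R e i" UNIV] by (simp add: linear_scale[OF \<phi>])
    also have "\<bar>\<dots>\<bar> \<le> (\<Sum>i\<in>UNIV. \<bar>h v (e i)\<bar> * \<bar>\<phi> (e i)\<bar>)"
      by (rule order_trans[OF sum_abs]) (simp add: abs_mult)
    also have "\<dots> \<le> (\<Sum>i\<in>UNIV. sqrt (h v v) * \<bar>\<phi> (e i)\<bar>)"
      by (intro sum_mono mult_right_mono frame_expansion(2)[OF h e]) auto
    finally show ?thesis by (simp add: sum_distrib_left mult.commute)
  qed
  then show ?thesis by (intro that[of ?L]) (auto intro: sum_nonneg)
qed

text \<open>Expand \<open>b\<close> in an orthonormal frame: each coefficient is at most the length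
  of \<open>b\<close>, and each frame vector has an image of length at most the Hilbert-Schmidt
  norm. The factor \<open>CARD('m)\<close> counts the terms.\<close>

lemma functional_le_hs_norm:
  fixes g :: "real ^ 'm::finite \<Rightarrow> real ^ 'm \<Rightarrow> real" and h :: "real ^ 'n::finite \<Rightarrow> real ^ 'n \<Rightarrow> real"
  assumes g: "inner_form g" and h: "inner_form h" and \<phi>: "linear \<phi>"
    and L: "0 \<le> L" "\<And>v. \<bar>\<phi> v :: real\<bar> \<le> L * sqrt (h v v)"
  shows "\<bar>\<phi> (blinfun_apply \<xi> b)\<bar> \<le> CARD('m) * sqrt (g b b) * L * hs_norm g h \<xi>"
proof -
  obtain e :: "'m \<Rightarrow> real ^ 'm" where e: "orthonormal_frame g e"
    and hs: "\<And>h (\<xi> :: (real ^ 'm) \<Rightarrow>\<^sub>L (real ^ 'n)). hs_norm g h \<xi> = sqrt (\<Sum>i\<in>UNIV. h (\<xi> (e i)) (\<xi> (e i)))"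
    using hs_norm_frame[OF g] by blast
  have le: "sqrt (h (\<xi> (e i)) (\<xi> (e i))) \<le> hs_norm g h \<xi>" for i
    unfolding hs by (intro real_sqrt_le_mono member_le_sum) (auto intro: inner_formD(4)[OF h])
  have lin: "linear (\<lambda>v. \<phi> (\<xi> v))"
    using linear_compose[OF _ \<phi>, of "blinfun_apply \<xi>"]
    by (simp add: o_def blinfun.bounded_linear_right bounded_linear.linear)
  have "\<phi> (\<xi> b) = \<phi> (\<xi> (\<Sum>i\<in>UNIV. g b (e i) *\<^sub>R e i))" using frame_expansion(1)[OF g e, of b] by simp
  also have "\<dots> = (\<Sum>i\<in>UNIV. g b (e i) * \<phi> (\<xi> (e i)))"
    using linear_sum[OF lin, of "\<lambda>i. g b (e i) *\<^sub>R e i" UNIV] by (simp add: linear_scale[OF lin])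
  also have "\<bar>\<dots>\<bar> \<le> (\<Sum>i\<in>UNIV. \<bar>g b (e i)\<bar> * \<bar>\<phi> (\<xi> (e i))\<bar>)"
    by (rule order_trans[OF sum_abs]) (simp add: abs_mult)
  also have "\<dots> \<le> (\<Sum>i\<in>(UNIV :: 'm set). sqrt (g b b) * (L * hs_norm g h \<xi>))"
    by (intro sum_mono mult_mono frame_expansion(2)[OF g e] order_trans[OF L(2)] mult_left_mono le L(1))
       (auto simp: inner_formD(4)[OF g])
  finally show ?thesis by (simp add: mult_ac)
qed

text \<open>The Hilbert--Schmidt product in coordinates, with \<open>H\<close> the Gram matrix of the target
    and \<open>K\<close> the inverse Gram
  matrix of the source.\<close>

definition hs_product ::
  "real ^ 'n ^ 'n \<Rightarrow> real ^ 'm ^ 'm \<Rightarrow> real ^ 'm ^ 'n \<Rightarrow> real ^ 'm::finite ^ 'n::finite \<Rightarrow> real" where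
  "hs_product H K A B = (\<Sum>p\<in>UNIV. \<Sum>q\<in>UNIV. \<Sum>k\<in>UNIV. \<Sum>l\<in>UNIV. H $ p $ q * K $ k $ l * A $ p $ k * B $ q $ l)"

lemma hs_product_diff:
  "hs_product H K (A - B) (A - B)
      = hs_product H K A A - hs_product H K A B - hs_product H K B A + hs_product H K B B"
  unfolding hs_product_def sum_subtractf[symmetric] sum.distrib[symmetric]
  by (intro sum.cong refl) (simp add: algebra_simps)

lemma hs_product_diff_left: "hs_product H K A B - hs_product H' K A B = hs_product (H - H') K A B"
  unfolding hs_product_def sum_subtractf[symmetric] by (intro sum.cong refl) (simp add: algebra_simps)

lemma linear_eq_sum_axis:
  fixes f :: "real ^ 'm::finite \<Rightarrow> 'w::real_vector"
  assumes "linear f" shows "f v = (\<Sum>k\<in>UNIV. v $ k *\<^sub>R f (axis k 1))"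
proof -
  have "f v = f (\<Sum>k\<in>UNIV. v $ k *\<^sub>R axis k 1)" using basis_expansion[of v]
      by (simp add: scalar_mult_eq_scaleR)
  then show ?thesis by (simp add: linear_sum[OF assms] linear_scale[OF assms])
qed

lemma bilinear_eq_sum_axis:
  fixes f :: "real ^ 'm::finite \<Rightarrow> real ^ 'm \<Rightarrow> real"
  assumes "bilinear f" shows "f v w = (\<Sum>j\<in>UNIV. \<Sum>k\<in>UNIV. v $ j * w $ k * f (axis j 1) (axis k 1))"
proof -
  have l: "linear (\<lambda>v. f v w)" "linear (f v)" for v w using assms by (auto simp: bilinear_def)
  have "f v w = (\<Sum>j\<in>UNIV. v $ j * f (axis j 1) w)"
    using linear_eq_sum_axis[OF l(1), of v w] by simp
  also have "\<dots> = (\<Sum>j\<in>UNIV. v $ j * (\<Sum>k\<in>UNIV. w $ k * f (axis j 1) (axis k 1)))"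
    by (intro sum.cong refl arg_cong2[where f="(*)"]) (use linear_eq_sum_axis[OF l(2), of _ w] in simp)
  finally show ?thesis by (simp add: sum_distrib_left mult.assoc)
qed

text \<open>Identifies the Hilbert choice \<open>matrix_inv\<close> with any inverse found by
  computation.\<close>

lemma matrix_left_inverse_unique:
  fixes A B :: "real ^ 'm::finite ^ 'm"
  assumes BA: "B ** A = mat 1" shows "B = matrix_inv A"
proof -
  have AB: "A ** B = mat 1" using BA matrix_left_right_inverse by blast
  then have "A ** matrix_inv A = mat 1"
    unfolding matrix_inv_def using BA by (metis (mono_tags, lifting) someI_ex)
  then show ?thesis using BA by (metis matrix_mul_assoc matrix_mul_lid matrix_mul_rid)
qed

section \<open>Gram matrices and the volume density\<close>

locale riemannian_atlas = C1_manifold M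
  for M :: "('a::{t2_space, second_countable_topology}, 'm::finite) chart set" +
  fixes g :: "'a \<Rightarrow> real ^ 'm \<Rightarrow> real ^ 'm \<Rightarrow> real"
  assumes form: "inner_form (g x)"
    and gram_cont: "c \<in> M \<Longrightarrow> continuous_on (fst c) (gram_matrix M g c)"
begin

abbreviation gram where "gram c x \<equiv> gram_matrix M g c x"

lemma gram_form:
  assumes "c \<in> M" "x \<in> fst c"
  shows "g x v w = (\<Sum>j\<in>UNIV. \<Sum>k\<in>UNIV. chart_diff M c x v $ j * chart_diff M c x w $ k * gram c x $ j $ k)"
proof -
  let ?A = "inv (chart_diff M c x)"
  have lin: "linear ?A" using inv_chart_diff_linear[OF assms] .
  have "bilinear (\<lambda>v w. g x (?A v) (?A w))"
    using inner_formD(5,6)[OF form[of x]] linear_compose[OF lin]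
    by (auto simp: bilinear_def o_def)
  from bilinear_eq_sum_axis[OF this, of "chart_diff M c x v" "chart_diff M c x w"] assms
  show ?thesis by (simp add: gram_matrix_def)
qed

text \<open>In the basis of an orthonormal frame the metric becomes the identity matrix. Taking
  determinants gives positivity, and moving a factor to the other side exhibits
  \<open>E ** transpose E\<close> as the inverse of the Gram matrix.\<close>

lemma gram_frame:
  fixes e :: "'m \<Rightarrow> real ^ 'm"
  assumes "c \<in> M" "x \<in> fst c" "orthonormal_frame (g x) e"
  defines "E \<equiv> (\<chi> k i. chart_diff M c x (e i) $ k)"
  shows "transpose E ** gram c x ** E = mat 1" "0 < det (gram c x)" "E ** transpose E = matrix_inv (gram c x)"
proof -
  have "(transpose E ** gram c x ** E) $ i $ l = g x (e i) (e l)" for i l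
  proof -
    have "(transpose E ** gram c x ** E) $ i $ l
        = (\<Sum>k\<in>UNIV. (\<Sum>j\<in>UNIV. E $ j $ i * gram c x $ j $ k) * E $ k $ l)"
      by (simp add: matrix_matrix_mult_def transpose_def)
    also have "\<dots> = (\<Sum>j\<in>UNIV. \<Sum>k\<in>UNIV. E $ j $ i * E $ k $ l * gram c x $ j $ k)"
      by (subst sum.swap) (simp add: sum_distrib_right sum_distrib_left mult_ac)
    also have "\<dots> = g x (e i) (e l)" unfolding gram_form[OF assms(1,2)] E_def by simp
    finally show ?thesis .
  qed
  then show 1: "transpose E ** gram c x ** E = mat 1"
    using assms(3) by (simp add: vec_eq_iff mat_def orthonormal_frame_def)
  have "det E * det (gram c x) * det E = 1"
    using arg_cong[OF 1, of det] by (simp add: det_mul)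
  then have "(det E)\<^sup>2 * det (gram c x) = 1" by (simp add: power2_eq_square mult_ac)
  then show "0 < det (gram c x)"
      by (metis zero_le_power2 zero_less_mult_pos zero_less_one less_eq_real_def mult_zero_left zero_neq_one)
  have "(E ** transpose E) ** gram c x = mat 1"
    using 1 matrix_left_right_inverse[of "transpose E ** gram c x" E] by (simp add: matrix_mul_assoc)
  then show "E ** transpose E = matrix_inv (gram c x)"
    by (rule matrix_left_inverse_unique)
qed

lemma gram_det_pos:
  assumes "c \<in> M" "x \<in> fst c" shows "0 < det (gram c x)"
  using orthonormal_frame_exists[OF form, of x] gram_frame(2)[OF assms] by blast

lemma gram_transition:
  assumes "c \<in> M" "c' \<in> M" "x \<in> fst c" "x \<in> fst c'"
  defines "J \<equiv> matrix (frechet_derivative (transition c c') (at (snd c x)))"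
  shows "gram c x = transpose J ** gram c' x ** J"
proof -
  let ?T = "frechet_derivative (transition c c') (at (snd c x))"
  have *: "chart_diff M c' x (inv (chart_diff M c x) (axis i 1)) $ j = J $ j $ i" for i j
    unfolding chart_diff_transition[OF assms(1-4)] using assms by (simp add: J_def matrix_def)
  show ?thesis
  proof (simp only: vec_eq_iff, intro allI)
    fix i l
    have "gram c x $ i $ l = (\<Sum>j\<in>UNIV. \<Sum>k\<in>UNIV. J $ j $ i * J $ k $ l * gram c' x $ j $ k)"
      unfolding gram_matrix_def[of M g c] by (simp add: gram_form[OF assms(2,4)] *)
    also have "\<dots> = (\<Sum>k\<in>UNIV. (\<Sum>j\<in>UNIV. J $ j $ i * gram c' x $ j $ k) * J $ k $ l)"
      by (subst sum.swap) (simp add: sum_distrib_right sum_distrib_left mult_ac)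
    also have "\<dots> = (transpose J ** gram c' x ** J) $ i $ l"
      by (simp add: matrix_matrix_mult_def transpose_def)
    finally show "gram c x $ i $ l = (transpose J ** gram c' x ** J) $ i $ l" .
  qed
qed

text \<open>Density of the Riemannian measure against Lebesgue measure in the chart
  \<open>c\<close>.\<close>

definition vol :: "('a, 'm) chart \<Rightarrow> real ^ 'm \<Rightarrow> real" where
  "vol c y = sqrt (det (gram c (chart_inv c y)))"

text \<open>The Gram matrix changes by congruence with the Jacobian, so the square root of its
  determinant acquires exactly the factor of the change of variables formula.\<close>

lemma vol_transition:
  assumes "c \<in> M" "c' \<in> M" "y \<in> snd c ` (fst c \<inter> fst c')"
  shows "vol c y = \<bar>det (matrix (frechet_derivative (transition c c') (at y)))\<bar> * vol c' (transition c c' y)"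
proof -
  obtain x where x: "x \<in> fst c" "x \<in> fst c'" "y = snd c x" using assms by blast
  then show ?thesis
    using assms gram_transition[OF assms(1,2) x(1,2)]
    by (simp add: vol_def det_mul det_transpose real_sqrt_mult)
qed

lemma vol_pos: "c \<in> M \<Longrightarrow> y \<in> chart_image c \<Longrightarrow> 0 < vol c y"
  using gram_det_pos inv_into_dom by (auto simp: vol_def)

lemma continuous_on_det:
  fixes A :: "'t::topological_space \<Rightarrow> real ^ 'k::finite ^ 'k"
  assumes "continuous_on S A" shows "continuous_on S (\<lambda>x. det (A x))"
  unfolding det_def using assms by (intro continuous_intros)

lemma gram_coord_cont:
  "c \<in> M \<Longrightarrow> continuous_on (chart_image c) (\<lambda>y. gram c (chart_inv c y))"
  by (rule continuous_on_compose2[OF gram_cont inv_cont]) (use inv_into_dom in blast)+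

lemma vol_cont: "c \<in> M \<Longrightarrow> continuous_on (chart_image c) (vol c)"
  unfolding vol_def by (intro continuous_intros continuous_on_det gram_coord_cont)

end

lemma riemannian_atlasI: "riemannian_manifold M g \<Longrightarrow> riemannian_atlas M g"
  by unfold_locales (auto simp: riemannian_manifold_def inner_form_def)

section \<open>The Riemannian measure\<close>

lemma indicator_mult_measurable_lebesgue:
  fixes f :: "'v::euclidean_space \<Rightarrow> real"
  assumes "continuous_on T f" "S \<subseteq> T" "S \<in> sets lebesgue"
  shows "(\<lambda>x. indicator S x * f x) \<in> borel_measurable lebesgue"
proof -
  have "f \<in> borel_measurable (lebesgue_on S)"
    by (rule continuous_imp_measurable_on_sets_lebesgue[OF continuous_on_subset[OF assms(1,2)] assms(3)])
  then show ?thesis using assms(3) by (subst (asm) borel_measurable_restrict_space_iff) auto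
qed

text \<open>Tonelli for series, with one of them read as an integral over the counting
  measure.\<close>

lemma suminf_ennreal_swap: "(\<Sum>i. \<Sum>k. f i k :: ennreal) = (\<Sum>k. \<Sum>i. f i k)"
proof -
  have "(\<Sum>i. \<Sum>k. f i k) = (\<Sum>i. \<integral>\<^sup>+k. f i k \<partial>count_space UNIV)" by (simp add: nn_integral_count_space_nat)
  also have "\<dots> = (\<integral>\<^sup>+k. (\<Sum>i. f i k) \<partial>count_space UNIV)" by (rule nn_integral_suminf[symmetric]) simp
  finally show ?thesis by (simp add: nn_integral_count_space_nat)
qed

context C1_manifold
begin

lemma lebesgue_sets_iff: "B \<in> lebesgue_sets M \<longleftrightarrow> (\<forall>c\<in>M. chart_image c \<inter> chart_inv c -` B \<in> sets lebesgue)"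
  by (auto simp: lebesgue_sets_def image_Int)

lemma lebesgue_sets_image: "B \<in> lebesgue_sets M \<Longrightarrow> c \<in> M \<Longrightarrow> snd c ` (B \<inter> fst c) \<in> sets lebesgue"
  by (simp add: lebesgue_sets_def)

lemma lebesgue_sets_image_sub: "B \<in> lebesgue_sets M \<Longrightarrow> c \<in> M \<Longrightarrow> B \<subseteq> fst c \<Longrightarrow> snd c ` B \<in> sets lebesgue"
  using lebesgue_sets_image by (metis Int_absorb2)

lemma open_lebesgue_sets: "open U \<Longrightarrow> U \<in> lebesgue_sets M"
  unfolding lebesgue_sets_iff
proof
  fix c assume "open U" "c \<in> M"
  then have "open (chart_image c \<inter> chart_inv c -` U)" by (intro open_chart_preimage top_chart)
  then show "chart_image c \<inter> chart_inv c -` U \<in> sets lebesgue" by simp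
qed

lemma sigma_algebra_lebesgue_sets: "sigma_algebra UNIV (lebesgue_sets M)"
  unfolding sigma_algebra_iff2
proof (intro conjI ballI allI impI)
  show "lebesgue_sets M \<subseteq> Pow UNIV" by simp
  show "{} \<in> lebesgue_sets M" by (simp add: lebesgue_sets_iff)
  fix s assume s: "s \<in> lebesgue_sets M"
  show "UNIV - s \<in> lebesgue_sets M"
    unfolding lebesgue_sets_iff
  proof
    fix c assume c: "c \<in> M"
    have "chart_image c \<inter> chart_inv c -` (UNIV - s) = chart_image c - (chart_image c \<inter> chart_inv c -` s)"
        by auto
    also have "\<dots> \<in> sets lebesgue" using s c image_open[OF c] by (auto simp: lebesgue_sets_iff)
    finally show "chart_image c \<inter> chart_inv c -` (UNIV - s) \<in> sets lebesgue" .
  qed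
next
  fix A :: "nat \<Rightarrow> 'a set" assume A: "range A \<subseteq> lebesgue_sets M"
  have "(\<Union>i. chart_image c \<inter> chart_inv c -` A i) \<in> sets lebesgue" if "c \<in> M" for c
    using A that by (intro sets.countable_UN) (auto simp: lebesgue_sets_iff)
  then show "(\<Union>i. A i) \<in> lebesgue_sets M" by (simp add: lebesgue_sets_iff vimage_UN)
qed

sublocale leb: sigma_algebra UNIV "lebesgue_sets M" by (rule sigma_algebra_lebesgue_sets)

text \<open>Lindelof, from the countable basis. Countability lets measurable sets, null sets and
  measures be assembled from pieces inside charts.\<close>

lemma countable_atlas:
  obtains cs where "\<And>k::nat. cs k \<in> M" "(\<Union>k. fst (cs k)) = UNIV"
proof -
  obtain F where F: "F \<subseteq> fst ` M" "countable F" "\<Union>F = \<Union>(fst ` M)"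
    using Lindelof[of "fst ` M"] chart_open by (metis (no_types, lifting) image_iff)
  then obtain C where C: "C \<subseteq> M" "countable C" "F = fst ` C"
    using countable_subset_image[of F fst M] F(1,2) by metis
  have "x \<in> \<Union>(fst ` M)" for x using chart_ex[of x] by blast
  then have U: "\<Union>(fst ` C) = UNIV" using F(3) C(3) by (metis UNIV_eq_I)
  then have "C \<noteq> {}" by auto
  then have r: "range (from_nat_into C) = C" using C(2) by (rule range_from_nat_into)
  show ?thesis
  proof (rule that[of "from_nat_into C"])
    show "from_nat_into C k \<in> M" for k using r C(1) by blast
    have "(\<Union>k. fst (from_nat_into C k)) = \<Union>(fst ` range (from_nat_into C))" by blast
    also have "\<dots> = UNIV" unfolding r using U .
    finally show "(\<Union>k. fst (from_nat_into C k)) = UNIV" .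
  qed
qed

end

context riemannian_atlas
begin

text \<open>The density law \<open>vol_transition\<close> turns the change of variables formula for
  the transition map into chart independence of the volume.\<close>

lemma vol_nn_integral_transition:
  assumes c: "c \<in> M" "c' \<in> M" and B: "B \<in> lebesgue_sets M" "B \<subseteq> fst c" "B \<subseteq> fst c'"
  shows "(\<integral>\<^sup>+y\<in>snd c ` B. ennreal (vol c y) \<partial>lebesgue) = (\<integral>\<^sup>+y\<in>snd c' ` B. ennreal (vol c' y) \<partial>lebesgue)"
proof -
  let ?T = "transition c c'" and ?S = "snd c ` B"
  have img: "?T ` ?S = snd c' ` B"
    unfolding image_image using B c by (intro image_cong refl) auto
  have S: "?S \<in> sets lebesgue" "snd c' ` B \<in> sets lebesgue"
    using lebesgue_sets_image_sub B c by auto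
  have sub: "?S \<subseteq> snd c ` (fst c \<inter> fst c')" using B by auto
  have vt: "\<bar>det (matrix (frechet_derivative ?T (at y)))\<bar> * vol c' (?T y) = vol c y" if "y \<in> ?S" for y
    using vol_transition[OF c] that sub by auto
  have sub2: "?S \<subseteq> chart_image c" "snd c' ` B \<subseteq> chart_image c'" using B by (auto simp: chart_image_def)
  have "(\<integral>\<^sup>+y\<in>?T ` ?S. ennreal (vol c' y) \<partial>lebesgue) =
     (\<integral>\<^sup>+y\<in>?S. ennreal (\<bar>det (matrix (frechet_derivative ?T (at y)))\<bar> * vol c' (?T y)) \<partial>lebesgue)"
  proof (rule set_nn_integral_change_of_variables[OF S(1)])
    show "(?T has_derivative frechet_derivative ?T (at y)) (at y within ?S)" if "y \<in> ?S" for y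
      using C1_on_has_derivative[OF transition_C1[OF c]] that sub has_derivative_at_withinI by blast
    show "inj_on ?T ?S"
    proof (rule inj_onI)
      fix y z assume yz: "y \<in> ?S" "z \<in> ?S" "?T y = ?T z"
      then obtain a b where ab: "a \<in> B" "b \<in> B" "y = snd c a" "z = snd c b" by blast
      then have "a \<in> fst c" "b \<in> fst c" "a \<in> fst c'" "b \<in> fst c'" using B by auto
      then show "y = z" using ab yz c inj_onD[OF chart_inj[OF c(2)], of a b] by simp
    qed
    show "0 \<le> vol c' y" if "y \<in> ?T ` ?S" for y using that sub2 vol_pos[OF c(2)] unfolding img
        by (meson less_imp_le subsetD)
    show "(\<lambda>x. indicator (?T ` ?S) x * vol c' x) \<in> borel_measurable lebesgue"
      unfolding img by (rule indicator_mult_measurable_lebesgue[OF vol_cont[OF c(2)] sub2(2) S(2)])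
    \<comment> \<open>On the image of \<open>B\<close> the pulled back density is
      \<open>vol c\<close>, whose continuity yields measurability.\<close>
    have "(\<lambda>x. indicator ?S x * (\<bar>det (matrix (frechet_derivative ?T (at x)))\<bar> * vol c' (?T x)))
        = (\<lambda>x. indicator ?S x * vol c x)"
    proof
      fix x show "indicator ?S x * (\<bar>det (matrix (frechet_derivative ?T (at x)))\<bar> * vol c' (?T x))
          = indicator ?S x * vol c x"
        using vt[of x] by (cases "x \<in> ?S") simp_all
    qed
    then show "(\<lambda>x. indicator ?S x * (\<bar>det (matrix (frechet_derivative ?T (at x)))\<bar> * vol c' (?T x)))
        \<in> borel_measurable lebesgue"
      using indicator_mult_measurable_lebesgue[OF vol_cont[OF c(1)] sub2(1) S(1)] by simp
  qed
  also have "\<dots> = (\<integral>\<^sup>+y\<in>?S. ennreal (vol c y) \<partial>lebesgue)"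
  proof (rule nn_integral_cong)
    fix y show "ennreal (\<bar>det (matrix (frechet_derivative ?T (at y)))\<bar> * vol c' (?T y)) * indicator ?S y
        = ennreal (vol c y) * indicator ?S y"
      using vt[of y] by (cases "y \<in> ?S") simp_all
  qed
  finally show ?thesis unfolding img by simp
qed

definition chart_vol :: "('a, 'm) chart \<Rightarrow> 'a set \<Rightarrow> ennreal" where
  "chart_vol c B = (\<integral>\<^sup>+y\<in>snd c ` B. ennreal (vol c y) \<partial>lebesgue)"

text \<open>In a fixed chart the volume is a measure with a density, evaluated on images;
  injectivity of the chart keeps disjoint sets disjoint.\<close>

lemma chart_vol_suminf:
  assumes c: "c \<in> M" and A: "\<And>i::nat. A i \<in> lebesgue_sets M" "\<And>i. A i \<subseteq> fst c" "disjoint_family A"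
  shows "(\<Sum>i. chart_vol c (A i)) = chart_vol c (\<Union>i. A i)"
proof -
  let ?f = "\<lambda>y. ennreal (indicator (chart_image c) y * vol c y)"
  have f: "?f \<in> borel_measurable lebesgue"
    using indicator_mult_measurable_lebesgue[OF vol_cont[OF c] order_refl] image_open[OF c] by simp
  have S: "snd c ` A i \<in> sets lebesgue" for i using lebesgue_sets_image_sub A c by auto
  have eq: "chart_vol c B = emeasure (density lebesgue ?f) (snd c ` B)"
      if "B \<subseteq> fst c" "snd c ` B \<in> sets lebesgue" for B
    unfolding chart_vol_def emeasure_density[OF f that(2)]
    using that(1) by (intro nn_integral_cong) (auto simp: indicator_def chart_image_def)
  have dj: "disjoint_family (\<lambda>i. snd c ` A i)"
    unfolding disjoint_family_on_def
  proof (intro ballI impI)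
    fix i j :: nat assume "i \<noteq> j"
    then have "A i \<inter> A j = {}" using A(3) by (auto simp: disjoint_family_on_def)
    then show "snd c ` A i \<inter> snd c ` A j = {}"
      using inj_on_image_Int[OF chart_inj[OF c] A(2)[of i] A(2)[of j]] by simp
  qed
  have "(\<Sum>i. chart_vol c (A i)) = (\<Sum>i. emeasure (density lebesgue ?f) (snd c ` A i))"
    using eq A(2) S by simp
  also have "\<dots> = emeasure (density lebesgue ?f) (\<Union>i. snd c ` A i)"
    by (rule suminf_emeasure) (use S dj in auto)
  also have "\<dots> = chart_vol c (\<Union>i. A i)"
    using A(2) S by (subst eq) (auto simp: image_UN intro!: sets.countable_UN)
  finally show ?thesis .
qed

text \<open>Cut the manifold into countably many disjoint pieces, each inside one chart, and add the
  chart volumes of the parts of a set.\<close>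

lemma riemannian_measure_exists:
  "\<exists>\<nu>. space \<nu> = UNIV \<and> sets \<nu> = lebesgue_sets M \<and>
     (\<forall>c\<in>M. \<forall>B\<in>lebesgue_sets M. B \<subseteq> fst c \<longrightarrow> emeasure \<nu> B = chart_vol c B)"
proof -
  obtain cs where cs: "\<And>k::nat. cs k \<in> M" "(\<Union>k. fst (cs k)) = UNIV" using countable_atlas by blast
  define P where "P = disjointed (\<lambda>k. fst (cs k))"
  have P: "P k \<subseteq> fst (cs k)" "disjoint_family P" "(\<Union>k. P k) = UNIV" "P k \<in> lebesgue_sets M" for k
  proof -
    show "P k \<subseteq> fst (cs k)" unfolding P_def by (rule disjointed_subset)
    show "disjoint_family P" "(\<Union>k. P k) = UNIV"
      using cs(2) by (simp_all add: P_def disjoint_family_disjointed UN_disjointed_eq)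
    have "range (\<lambda>k. fst (cs k)) \<subseteq> lebesgue_sets M"
      using open_lebesgue_sets[OF chart_open[OF cs(1)]] by auto
    from leb.range_disjointed_sets[OF this] show "P k \<in> lebesgue_sets M" by (auto simp: P_def)
  qed
  define m where "m B = (\<Sum>k. chart_vol (cs k) (B \<inter> P k))" for B
  have add: "countably_additive (lebesgue_sets M) m"
    unfolding countably_additive_def
  proof (intro allI impI)
    fix A :: "nat \<Rightarrow> 'a set" assume A: "range A \<subseteq> lebesgue_sets M" "disjoint_family A" "(\<Union>i. A i)
        \<in> lebesgue_sets M"
    have "(\<Sum>i. m (A i)) = (\<Sum>k. \<Sum>i. chart_vol (cs k) (A i \<inter> P k))"
      unfolding m_def by (rule suminf_ennreal_swap)
    also have "\<dots> = (\<Sum>k. chart_vol (cs k) (\<Union>i. A i \<inter> P k))"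
    proof (intro suminf_cong chart_vol_suminf cs)
      fix i k
      have "A i \<in> lebesgue_sets M" using A(1) by blast
      then show "A i \<inter> P k \<in> lebesgue_sets M" by (rule leb.Int[OF _ P(4)])
      show "A i \<inter> P k \<subseteq> fst (cs k)" using P(1)[of k] by blast
      show "disjoint_family (\<lambda>i. A i \<inter> P k)" using A(2) unfolding disjoint_family_on_def by blast
    qed
    also have "\<dots> = m (\<Union>i. A i)" by (simp add: m_def)
    finally show "(\<Sum>i. m (A i)) = m (\<Union>i. A i)" .
  qed
  have pos: "positive (lebesgue_sets M) m"
    by (simp add: positive_def m_def chart_vol_def)
  show ?thesis
  proof (intro exI[of _ "measure_of UNIV (lebesgue_sets M) m"] conjI ballI impI)
    fix c B assume c: "c \<in> M" and B: "B \<in> lebesgue_sets M" "B \<subseteq> fst c"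
    have "emeasure (measure_of UNIV (lebesgue_sets M) m) B = m B"
      by (rule emeasure_measure_of_sigma[OF sigma_algebra_lebesgue_sets pos add B(1)])
    \<comment> \<open>Each part lies both in its own chart \<open>cs k\<close> and in
      \<open>c\<close>, so all parts can be measured in \<open>c\<close>, where countable additivity
      reassembles \<open>B\<close>.\<close>
    also have "\<dots> = (\<Sum>k. chart_vol c (B \<inter> P k))"
      unfolding m_def chart_vol_def
    proof (intro suminf_cong vol_nn_integral_transition cs c)
      fix k
      show "B \<inter> P k \<in> lebesgue_sets M" by (rule leb.Int[OF B(1) P(4)])
      show "B \<inter> P k \<subseteq> fst (cs k)" "B \<inter> P k \<subseteq> fst c" using P(1)[of k] B(2) by blast+
    qed
    also have "\<dots> = chart_vol c (\<Union>k. B \<inter> P k)"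
    proof (rule chart_vol_suminf[OF c])
      fix k
      show "B \<inter> P k \<in> lebesgue_sets M" by (rule leb.Int[OF B(1) P(4)])
      show "B \<inter> P k \<subseteq> fst c" using B(2) by blast
      show "disjoint_family (\<lambda>k. B \<inter> P k)" using P(2) unfolding disjoint_family_on_def by blast
    qed
    also have "(\<Union>k. B \<inter> P k) = B" using P(3) by auto
    finally show "emeasure (measure_of UNIV (lebesgue_sets M) m) B = chart_vol c B" .
  qed (simp_all add: leb.sigma_sets_eq)
qed

text \<open>Every measurable set is a countable disjoint union of pieces inside charts, and there
  the values are prescribed.\<close>

lemma riemannian_measure_unique:
  assumes "space \<nu> = UNIV" "sets \<nu> = lebesgue_sets M"
    "\<And>c B. c \<in> M \<Longrightarrow> B \<in> lebesgue_sets M \<Longrightarrow> B \<subseteq> fst c \<Longrightarrow> emeasure \<nu> B = chart_vol c B"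
    and "space \<nu>' = UNIV" "sets \<nu>' = lebesgue_sets M"
    "\<And>c B. c \<in> M \<Longrightarrow> B \<in> lebesgue_sets M \<Longrightarrow> B \<subseteq> fst c \<Longrightarrow> emeasure \<nu>' B = chart_vol c B"
  shows "\<nu> = \<nu>'"
proof (rule measure_eqI)
  show "sets \<nu> = sets \<nu>'" using assms by simp
  fix B assume "B \<in> sets \<nu>"
  then have B: "B \<in> lebesgue_sets M" using assms by simp
  obtain cs where cs: "\<And>k::nat. cs k \<in> M" "(\<Union>k. fst (cs k)) = UNIV" using countable_atlas by blast
  define A where "A = disjointed (\<lambda>k. B \<inter> fst (cs k))"
  have UA: "(\<Union>k. A k) = B" using cs(2) by (auto simp: A_def UN_disjointed_eq)
  have A: "A k \<in> lebesgue_sets M" "A k \<subseteq> fst (cs k)" "disjoint_family A" for k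
  proof -
    have "range (\<lambda>k. B \<inter> fst (cs k)) \<subseteq> lebesgue_sets M"
      using B open_lebesgue_sets[OF chart_open[OF cs(1)]] by blast
    from leb.range_disjointed_sets[OF this] show "A k \<in> lebesgue_sets M" by (auto simp: A_def)
    show "A k \<subseteq> fst (cs k)" using disjointed_subset[of "\<lambda>k. B \<inter> fst (cs k)" k] by (auto simp: A_def)
    show "disjoint_family A" by (simp add: A_def disjoint_family_disjointed)
  qed
  have "emeasure \<nu> (\<Union>k. A k) = (\<Sum>k. emeasure \<nu> (A k))"
    by (rule suminf_emeasure[symmetric]) (use A assms in auto)
  also have "\<dots> = (\<Sum>k. emeasure \<nu>' (A k))" by (simp add: assms(3)[OF cs(1) A(1,2)] assms(6)[OF cs(1) A(1,2)])
  also have "\<dots> = emeasure \<nu>' (\<Union>k. A k)"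
    by (rule suminf_emeasure) (use A assms in auto)
  finally show "emeasure \<nu> B = emeasure \<nu>' B" unfolding UA .
qed

text \<open>Discharges the definite description in the definition; every later use of the Riemannian
  measure goes back to these three facts.\<close>

lemma riemannian_measure:
  shows "space (riemannian_measure M g) = UNIV" "sets (riemannian_measure M g) = lebesgue_sets M"
    and "\<And>c B. c \<in> M \<Longrightarrow> B \<in> lebesgue_sets M \<Longrightarrow> B \<subseteq> fst c \<Longrightarrow> emeasure (riemannian_measure M g) B = chart_vol c B"
proof -
  let ?P = "\<lambda>\<nu>. space \<nu> = UNIV \<and> sets \<nu> = lebesgue_sets M \<and>
     (\<forall>c\<in>M. \<forall>B\<in>lebesgue_sets M. B \<subseteq> fst c \<longrightarrow> emeasure \<nu> B = chart_vol c B)"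
  have "?P (THE \<nu>. ?P \<nu>)"
  proof (rule theI')
    obtain \<nu> where "?P \<nu>" using riemannian_measure_exists by blast
    show "\<exists>!\<nu>. ?P \<nu>"
    proof (rule ex1I[of ?P, OF \<open>?P \<nu>\<close>])
      fix \<nu>' assume "?P \<nu>'"
      then show "\<nu>' = \<nu>" using \<open>?P \<nu>\<close> by (intro riemannian_measure_unique) simp_all
    qed
  qed
  moreover have "(THE \<nu>. ?P \<nu>) = riemannian_measure M g"
    by (simp add: riemannian_measure_def chart_vol_def vol_def)
  ultimately show "space (riemannian_measure M g) = UNIV" "sets (riemannian_measure M g) = lebesgue_sets M"
    "\<And>c B. c \<in> M \<Longrightarrow> B \<in> lebesgue_sets M \<Longrightarrow> B \<subseteq> fst c \<Longrightarrow> emeasure (riemannian_measure M g) B = chart_vol c B"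
    by simp_all
qed

end

section \<open>The Hilbert-Schmidt norm in coordinates\<close>

definition coord_matrix ::
  "('a, 'm::finite) chart set \<Rightarrow> ('b, 'n::finite) chart set \<Rightarrow> ('a, 'm) chart \<Rightarrow> ('b, 'n) chart \<Rightarrow> 'a \<Rightarrow> 'b
    \<Rightarrow> (real ^ 'm) \<Rightarrow>\<^sub>L (real ^ 'n) \<Rightarrow> real ^ 'm ^ 'n" where
  "coord_matrix M N c e x y \<xi> = matrix (\<lambda>v. chart_diff N e y (\<xi> (inv (chart_diff M c x) v)))"

locale riemannian_pair = M: riemannian_atlas M gM + N: riemannian_atlas N gN
  for M :: "('a::{t2_space, second_countable_topology}, 'm::finite) chart set"
    and gM :: "'a \<Rightarrow> real ^ 'm \<Rightarrow> real ^ 'm \<Rightarrow> real"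
    and N :: "('b::{t2_space, second_countable_topology}, 'n::finite) chart set"
    and gN :: "'b \<Rightarrow> real ^ 'n \<Rightarrow> real ^ 'n \<Rightarrow> real"
begin

lemma coord_linear:
  assumes "c \<in> M" "x \<in> fst c" "e \<in> N" "y \<in> fst e"
  shows "linear (\<lambda>v. chart_diff N e y (blinfun_apply \<xi> (inv (chart_diff M c x) v)))"
proof -
  have "linear (blinfun_apply \<xi>)" by (simp add: blinfun.bounded_linear_right bounded_linear.linear)
  from linear_compose[OF linear_compose[OF M.inv_chart_diff_linear[OF assms(1,2)] this]
      N.chart_diff_linear[OF assms(3,4)]]
  show ?thesis by (simp add: o_def)
qed

text \<open>Write an orthonormal frame in coordinates; summing over the frame first produces
  \<open>E ** transpose E\<close>, which is the inverse Gram matrix by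
  \<open>gram_frame\<close>.\<close>

lemma hs_norm_coord:
  fixes \<xi> :: "(real ^ 'm) \<Rightarrow>\<^sub>L (real ^ 'n)"
  assumes "c \<in> M" "x \<in> fst c" "e \<in> N" "y \<in> fst e"
  defines "F \<equiv> coord_matrix M N c e x y \<xi>"
  shows "(hs_norm (gM x) (gN y) \<xi>)\<^sup>2 = hs_product (N.gram e y) (matrix_inv (M.gram c x)) F F"
proof -
  obtain f :: "'m \<Rightarrow> real ^ 'm" where f: "orthonormal_frame (gM x) f"
    and hs: "\<And>h (\<xi> :: (real ^ 'm) \<Rightarrow>\<^sub>L (real ^ 'n)). hs_norm (gM x) h \<xi>
        = sqrt (\<Sum>i\<in>UNIV. h (\<xi> (f i)) (\<xi> (f i)))"
    using hs_norm_frame[OF M.form] by blast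
  define E :: "real ^ 'm ^ 'm" where "E = (\<chi> k i. chart_diff M c x (f i) $ k)"
  let ?t = "\<lambda>p q k l i. N.gram e y $ p $ q * F $ p $ k * F $ q $ l * (E $ k $ i * E $ l $ i)"
  have cf: "chart_diff N e y (\<xi> (f i)) $ p = (\<Sum>k\<in>UNIV. F $ p $ k * E $ k $ i)" for i p
  proof -
    have "chart_diff N e y (\<xi> (f i)) = chart_diff N e y (\<xi> (inv (chart_diff M c x) (chart_diff M c x (f i))))"
      using assms by simp
    also have "\<dots> $ p = (\<Sum>k\<in>UNIV. F $ p $ k * E $ k $ i)"
      by (subst linear_eq_sum_axis[OF coord_linear[OF assms(1-4)]])
         (simp add: F_def coord_matrix_def matrix_def E_def mult.commute)
    finally show ?thesis .
  qed
  have "(hs_norm (gM x) (gN y) \<xi>)\<^sup>2 = (\<Sum>i\<in>UNIV. gN y (\<xi> (f i)) (\<xi> (f i)))"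
    unfolding hs by (intro real_sqrt_pow2 sum_nonneg inner_formD(4)[OF N.form])
  also have "\<dots> = (\<Sum>i\<in>UNIV. \<Sum>p\<in>UNIV. \<Sum>q\<in>UNIV. \<Sum>k\<in>UNIV. \<Sum>l\<in>UNIV. ?t p q k l i)"
    unfolding N.gram_form[OF assms(3,4)] cf
    by (simp only: sum_product sum_distrib_right) (intro sum.cong refl, simp add: sum_distrib_left mult_ac)
  also have "\<dots> = (\<Sum>p\<in>UNIV. \<Sum>q\<in>UNIV. \<Sum>k\<in>UNIV. \<Sum>l\<in>UNIV. \<Sum>i\<in>UNIV. ?t p q k l i)"
    by (subst sum.swap, rule sum.cong[OF refl])+ simp
  also have "\<dots> = (\<Sum>p\<in>UNIV. \<Sum>q\<in>UNIV. \<Sum>k\<in>UNIV. \<Sum>l\<in>UNIV. N.gram e y $ p $ q * (E ** transpose E) $ k $ l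
      * F $ p $ k * F $ q $ l)"
    by (intro sum.cong refl) (simp add: matrix_matrix_mult_def transpose_def sum_distrib_left
        sum_distrib_right mult_ac)
  also have "\<dots> = hs_product (N.gram e y) (matrix_inv (M.gram c x)) F F"
    using M.gram_frame(3)[OF assms(1,2) f] by (simp add: hs_product_def E_def)
  finally show ?thesis .
qed

end

section \<open>Weak convergence with convergent majorants\<close>

text \<open>An elementary C1 function that vanishes on a half-line. All bumps and plateaus are built
  from it, since test functions need only be C1.\<close>

definition pos_square :: "real \<Rightarrow> real" where "pos_square t = (max 0 t)\<^sup>2"

lemma pos_square_C1: "C1_on UNIV pos_square"
  unfolding C1_on_def
proof (intro exI conjI ballI)
  fix t :: real
  have "(pos_square has_real_derivative 2 * max 0 t) (at t)"
  proof -
    consider "t < 0" | "t = 0" | "t > 0" by linarith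
    then show ?thesis
    proof cases
      case 1
      have "((\<lambda>_. 0) has_real_derivative 0) (at t)" by simp
      then have "(pos_square has_real_derivative 0) (at t)"
        by (rule has_field_derivative_transform_within_open[where S="{..<0}"])
            (use 1 in \<open>auto simp: pos_square_def\<close>)
      then show ?thesis using 1 by simp
    next
      case 3
      have "((\<lambda>t. t\<^sup>2) has_real_derivative 2 * t) (at t)" by (auto intro!: derivative_eq_intros)
      then have "(pos_square has_real_derivative 2 * t) (at t)"
        by (rule has_field_derivative_transform_within_open[where S="{0<..}"])
            (use 3 in \<open>auto simp: pos_square_def\<close>)
      then show ?thesis using 3 by simp
    next
      case 2
      \<comment> \<open>At 0 the difference quotient is itself \<open>max 0 h\<close>, which is
        continuous with value 0.\<close>
      have "((\<lambda>h. max 0 h) \<longlongrightarrow> max 0 0) (at (0::real))" by (intro tendsto_intros)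
      then have "((\<lambda>h. max 0 h) \<longlongrightarrow> 0) (at (0::real))" by simp
      moreover have "(pos_square (0 + h) - pos_square 0) / h = max 0 h" for h
        by (auto simp: pos_square_def max_def power2_eq_square)
      ultimately show ?thesis using 2 by (simp add: DERIV_def)
    qed
  qed
  moreover have "blinfun_apply (blinfun_scaleR_left (2 * max 0 t)) = (*) (2 * max 0 t)"
    by (rule ext) simp
  ultimately show "(pos_square has_derivative blinfun_apply (blinfun_scaleR_left (2 * max 0 t))) (at t)"
    by (simp only: has_field_derivative_def)
next
  show "continuous_on UNIV (\<lambda>t::real. blinfun_scaleR_left (2 * max 0 t) :: real \<Rightarrow>\<^sub>L real)"
    by (intro bounded_linear.continuous_on[OF bounded_linear_blinfun_scaleR_left] continuous_intros)
qed

lemma norm_square_C1: "C1_on UNIV (\<lambda>y::'v::euclidean_space. (y - a) \<bullet> (y - a))"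
  unfolding C1_on_def
proof (intro exI conjI ballI)
  fix x
  show "((\<lambda>y. (y - a) \<bullet> (y - a)) has_derivative blinfun_apply (2 *\<^sub>R blinfun_inner_left (x - a))) (at x)"
    by (auto intro!: derivative_eq_intros simp: scaleR_blinfun.rep_eq inner_commute)
next
  show "continuous_on UNIV (\<lambda>x. 2 *\<^sub>R blinfun_inner_left (x - a))"
    by (intro continuous_intros bounded_linear.continuous_on[OF bounded_linear_blinfun_inner_left])
qed

definition bump :: "'v::euclidean_space \<Rightarrow> real \<Rightarrow> 'v \<Rightarrow> real" where
  "bump a R y = pos_square (R\<^sup>2 - (y - a) \<bullet> (y - a))"

lemma bump_C1: "C1_on UNIV (bump a R)"
proof -
  have "C1_on UNIV (\<lambda>y. R\<^sup>2 + (- 1) * ((y - a) \<bullet> (y - a)))"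
    by (intro C1_on_add C1_on_const C1_on_mult norm_square_C1)
  from C1_on_comp[OF this pos_square_C1] show ?thesis
    by (simp add: o_def bump_def[abs_def])
qed

text \<open>The bump decreases with the distance from \<open>a\<close>: \<open>R ^ 4\<close> is its
  value at the centre, and the lower bound is its value on the sphere of radius
  \<open>r\<close>.\<close>

lemma bump_bounds:
  assumes "0 < r" "r < R"
  shows "0 \<le> bump a R y" "bump a R y \<le> R ^ 4" "y \<notin> ball a R \<Longrightarrow> bump a R y = 0"
    "y \<in> ball a r \<Longrightarrow> (R\<^sup>2 - r\<^sup>2)\<^sup>2 \<le> bump a R y"
proof -
  have n: "(y - a) \<bullet> (y - a) = (dist a y)\<^sup>2"
      by (simp add: dist_norm norm_minus_commute[of a] power2_norm_eq_inner)
  show "0 \<le> bump a R y" by (simp add: bump_def pos_square_def)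
  have "max 0 (R\<^sup>2 - (dist a y)\<^sup>2) \<le> R\<^sup>2" by simp
  then have "(max 0 (R\<^sup>2 - (dist a y)\<^sup>2))\<^sup>2 \<le> (R\<^sup>2)\<^sup>2" by (intro power_mono) auto
  then show "bump a R y \<le> R ^ 4" unfolding bump_def pos_square_def n by (simp flip: power_mult)
  show "bump a R y = 0" if "y \<notin> ball a R"
  proof -
    have "R\<^sup>2 \<le> (dist a y)\<^sup>2" using that assms by (intro power_mono) auto
    then show ?thesis unfolding bump_def pos_square_def n by simp
  qed
  show "(R\<^sup>2 - r\<^sup>2)\<^sup>2 \<le> bump a R y" if "y \<in> ball a r"
  proof -
    have "(dist a y)\<^sup>2 \<le> r\<^sup>2" using that by (intro power_mono) auto
    moreover have "r\<^sup>2 \<le> R\<^sup>2" using assms by (intro power_mono) auto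
    ultimately show ?thesis unfolding bump_def pos_square_def n by (intro power_mono) auto
  qed
qed

text \<open>On \<open>ball a r\<close> the bump is bounded away from \<open>0\<close>, so \<open>\<phi> / bump a R\<close> is bounded; the approximant is the
  bump times a polynomial close to that quotient.\<close>

lemma C1_approx_bounded_measurable:
  fixes \<phi> h :: "'v::euclidean_space \<Rightarrow> real"
  assumes r: "0 < r" "r < R" and \<epsilon>: "0 < \<epsilon>"
    and \<phi>: "\<phi> \<in> borel_measurable lebesgue" "\<And>y. \<bar>\<phi> y\<bar> \<le> B" "\<And>y. y \<notin> ball a r \<Longrightarrow> \<phi> y = 0"
    and h: "integrable lebesgue h" "\<And>y. 0 \<le> h y"
  obtains f C where "C1_on UNIV f" "\<And>y. y \<notin> ball a R \<Longrightarrow> f y = 0" "\<And>y. \<bar>f y\<bar> \<le> C"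
    "(\<integral>y. \<bar>\<phi> y - f y\<bar> * h y \<partial>lebesgue) < \<epsilon>"
proof -
  let ?b = "bump a R"
  note bb = bump_bounds[OF r, where a=a]
  have cb: "continuous_on UNIV ?b"
    using bump_C1 by (meson C1_on_has_derivative UNIV_I continuous_at_imp_continuous_on
        has_derivative_continuous)
  have R4: "0 \<le> R ^ 4" by simp
  define \<beta> where "\<beta> = (R\<^sup>2 - r\<^sup>2)\<^sup>2"
  have "r\<^sup>2 < R\<^sup>2" using r by (intro power_strict_mono) auto
  then have \<beta>: "0 < \<beta>" by (simp add: \<beta>_def)
  have B0: "0 \<le> B" using \<phi>(2)[of a] by simp
  define \<psi> where "\<psi> y = \<phi> y / ?b y" for y
  define K where "K = B / \<beta>"
  have K0: "0 \<le> K" using B0 \<beta> by (simp add: K_def)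
  have \<psi>K: "\<bar>\<psi> y\<bar> \<le> K" for y
  proof (cases "y \<in> ball a r")
    case True
    have "\<beta> \<le> ?b y" using bb(4)[OF True] by (simp add: \<beta>_def)
    then show ?thesis unfolding \<psi>_def K_def abs_divide
      using \<phi>(2)[of y] \<beta> B0 by (intro frac_le) auto
  qed (use \<phi>(3) K0 in \<open>simp add: \<psi>_def\<close>)
  have \<phi>\<psi>: "\<phi> y = ?b y * \<psi> y" for y
  proof (cases "y \<in> ball a r")
    case True
    have "\<beta> \<le> ?b y" unfolding \<beta>_def by (rule bb(4)[OF True])
    then have "?b y \<noteq> 0" using \<beta> by linarith
    then show ?thesis by (simp add: \<psi>_def)
  qed (use \<phi>(3) in \<open>simp add: \<psi>_def\<close>)
  have mb: "?b \<in> borel_measurable lebesgue"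
    using borel_measurable_continuous_onI[OF cb] by (simp add: measurable_completion)
  have m\<psi>: "\<psi> \<in> borel_measurable lebesgue" unfolding \<psi>_def using \<phi>(1) mb by measurable
  then have "\<psi> measurable_on UNIV" by (simp add: measurable_on_iff_borel_measurable)
  \<comment> \<open>A measurable function is almost everywhere the limit of continuous ones.
    Clipping these to the interval from -K to K does not disturb the limit, whose absolute value is
    at most \<open>K\<close>, and provides the majorant for dominated convergence.\<close>
  then obtain Z g where Z: "negligible Z" "\<And>n::nat. continuous_on UNIV (g n)"
    "\<And>y. y \<notin> Z \<Longrightarrow> (\<lambda>n. g n y) \<longlonglongrightarrow> \<psi> y"
    unfolding measurable_on_def by auto
  define G where "G n y = max (- K) (min K (g n y))" for n y
  have Gc: "continuous_on UNIV (G n)" for n unfolding G_def by (intro continuous_intros Z(2))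
  have GK: "\<bar>G n y\<bar> \<le> K" for n y using K0 by (auto simp: G_def)
  have Gm: "G n \<in> borel_measurable lebesgue" for n
    using borel_measurable_continuous_onI[OF Gc] by (simp add: measurable_completion)
  have hm: "h \<in> borel_measurable lebesgue" using h by auto
  have hI: "integrable lebesgue (\<lambda>y. R ^ 4 * (2 * K) * h y)" using h(1) by auto
  have m1: "(\<lambda>y. ?b y * \<bar>\<psi> y - G n y\<bar> * h y) \<in> borel_measurable lebesgue" for n
    using mb m\<psi> Gm hm by measurable
  have lim: "(\<lambda>n. \<integral>y. ?b y * \<bar>\<psi> y - G n y\<bar> * h y \<partial>lebesgue) \<longlonglongrightarrow> (\<integral>(y::'v). 0 \<partial>lebesgue)"
  proof (rule integral_dominated_convergence[where w="\<lambda>y. R ^ 4 * (2 * K) * h y"])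
    have "AE y in lebesgue. y \<notin> Z"
      using Z(1) by (simp add: AE_not_in negligible_iff_null_sets)
    then show "AE y in lebesgue. (\<lambda>n. ?b y * \<bar>\<psi> y - G n y\<bar> * h y) \<longlonglongrightarrow> 0"
    proof eventually_elim
      case (elim y)
      have "(\<lambda>n. G n y) \<longlonglongrightarrow> max (- K) (min K (\<psi> y))"
        unfolding G_def by (intro tendsto_intros Z(3) elim)
      also have "max (- K) (min K (\<psi> y)) = \<psi> y" using \<psi>K[of y] by auto
      finally have "(\<lambda>n. ?b y * \<bar>\<psi> y - G n y\<bar> * h y) \<longlonglongrightarrow> ?b y * \<bar>\<psi> y - \<psi> y\<bar> * h y"
        by (intro tendsto_intros)
      then show ?case by simp
    qed
    show "AE y in lebesgue. norm (?b y * \<bar>\<psi> y - G n y\<bar> * h y) \<le> R ^ 4 * (2 * K) * h y" for n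
    proof (rule AE_I2)
      fix y
      have "\<bar>\<psi> y - G n y\<bar> \<le> 2 * K" using \<psi>K[of y] GK[of n y] by linarith
      then show "norm (?b y * \<bar>\<psi> y - G n y\<bar> * h y) \<le> R ^ 4 * (2 * K) * h y"
        using bb(1,2)[of y] h(2)[of y] K0 R4 by (auto simp: abs_mult intro!: mult_mono)
    qed
  qed (use hI m1 in auto)
  then obtain n where n: "(\<integral>y. ?b y * \<bar>\<psi> y - G n y\<bar> * h y \<partial>lebesgue) < \<epsilon> / 2"
    using order_tendstoD(2)[OF lim, of "\<epsilon> / 2"] \<epsilon> by (auto simp: eventually_sequentially)
  define I where "I = (\<integral>y. h y \<partial>lebesgue)"
  have I0: "0 \<le> I" unfolding I_def using h(2) by (intro integral_nonneg_AE) auto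
  \<comment> \<open>Sized so that the polynomial error, at most \<open>\<delta> * R ^ 4\<close>
    against the weight \<open>h\<close>, contributes less than \<open>\<epsilon> / 2\<close>; the
    summand 1 covers the case that \<open>h\<close> has integral 0.\<close>
  define \<delta> where "\<delta> = \<epsilon> / (2 * (R ^ 4 * I + 1))"
  have \<delta>: "0 < \<delta>" using \<epsilon> I0 R4 by (auto simp: \<delta>_def add_nonneg_pos intro!: divide_pos_pos)
  have \<delta>I: "\<delta> * (R ^ 4 * I) < \<epsilon> / 2"
  proof -
    have "\<delta> * (R ^ 4 * I) < \<delta> * (R ^ 4 * I + 1)" using \<delta> by simp
    also have "\<dots> = \<epsilon> / 2"
      using I0 R4 by (auto simp: \<delta>_def field_simps add_nonneg_eq_0_iff)
    finally show ?thesis .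
  qed
  obtain p where p: "real_polynomial_function p" "\<And>y. y \<in> cball a R \<Longrightarrow> \<bar>G n y - p y\<bar> < \<delta>"
    using Stone_Weierstrass_real_polynomial_function[OF compact_cball continuous_on_subset[OF Gc] \<delta>] by blast
  define f where "f y = ?b y * p y" for y
  have pC: "C1_on UNIV p" by (rule C1_on_real_polynomial_function[OF p(1)])
  have fC1: "C1_on UNIV f" unfolding f_def by (intro C1_on_mult bump_C1 pC)
  have f0: "f y = 0" if "y \<notin> ball a R" for y using bb(3)[OF that] by (simp add: f_def)
  \<comment> \<open>A polynomial may be unbounded, but the factor \<open>?b\<close> vanishes outside
    the ball on which \<open>p\<close> is close to \<open>G n\<close>.\<close>
  have fb: "\<bar>f y\<bar> \<le> R ^ 4 * (K + \<delta>)" for y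
  proof (cases "y \<in> ball a R")
    case True
    then have "\<bar>p y\<bar> \<le> K + \<delta>" using p(2)[of y] GK[of n y] by (simp add: less_imp_le)
    then show ?thesis unfolding f_def abs_mult using bb(1,2)[of y] R4 by (intro mult_mono) auto
  qed (use f0 K0 \<delta> R4 in simp)
  have fm: "f \<in> borel_measurable lebesgue"
  proof -
    have "continuous_on UNIV f"
      using fC1 by (meson C1_on_has_derivative UNIV_I continuous_at_imp_continuous_on
          has_derivative_continuous)
    then show ?thesis using borel_measurable_continuous_onI[of f] by (simp add: measurable_completion)
  qed
  have i1: "integrable lebesgue (\<lambda>y. ?b y * \<bar>\<psi> y - G n y\<bar> * h y)"
  proof (rule Bochner_Integration.integrable_bound[of _ "\<lambda>y. R ^ 4 * (2 * K) * h y"])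
    show "AE y in lebesgue. norm (?b y * \<bar>\<psi> y - G n y\<bar> * h y) \<le> norm (R ^ 4 * (2 * K) * h y)"
    proof (rule AE_I2)
      fix y
      have "\<bar>\<psi> y - G n y\<bar> \<le> 2 * K" using \<psi>K[of y] GK[of n y] by linarith
      then show "norm (?b y * \<bar>\<psi> y - G n y\<bar> * h y) \<le> norm (R ^ 4 * (2 * K) * h y)"
        using bb(1,2)[of y] h(2)[of y] K0 R4 by (auto simp: abs_mult intro!: mult_mono)
    qed
  qed (use hI m1 in auto)
  have le: "\<bar>\<phi> y - f y\<bar> * h y \<le> ?b y * \<bar>\<psi> y - G n y\<bar> * h y + \<delta> * R ^ 4 * h y" for y
  proof -
    have "\<bar>\<phi> y - f y\<bar> = ?b y * \<bar>\<psi> y - p y\<bar>"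
      unfolding \<phi>\<psi> f_def using bb(1)[of y] by (simp add: abs_mult flip: right_diff_distrib)
    also have "\<dots> \<le> ?b y * \<bar>\<psi> y - G n y\<bar> + \<delta> * R ^ 4"
    proof (cases "y \<in> ball a R")
      case True
      then have "\<bar>\<psi> y - p y\<bar> \<le> \<bar>\<psi> y - G n y\<bar> + \<delta>" using p(2)[of y] by (simp add: less_imp_le)
      then have "?b y * \<bar>\<psi> y - p y\<bar> \<le> ?b y * (\<bar>\<psi> y - G n y\<bar> + \<delta>)" using bb(1) by (rule mult_left_mono)
      also have "\<dots> = ?b y * \<bar>\<psi> y - G n y\<bar> + ?b y * \<delta>" by (simp add: algebra_simps)
      also have "?b y * \<delta> \<le> R ^ 4 * \<delta>" using bb(2)[of y] \<delta> by (intro mult_right_mono) auto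
      finally show ?thesis by (simp add: mult.commute)
    qed (use bb(3) \<delta> R4 in simp)
    finally have "\<bar>\<phi> y - f y\<bar> * h y \<le> (?b y * \<bar>\<psi> y - G n y\<bar> + \<delta> * R ^ 4) * h y"
      using h(2) by (intro mult_right_mono)
    then show ?thesis by (simp add: algebra_simps)
  qed
  have "(\<integral>y. \<bar>\<phi> y - f y\<bar> * h y \<partial>lebesgue) \<le> (\<integral>y. ?b y * \<bar>\<psi> y - G n y\<bar> * h y + \<delta> * R ^ 4 * h y \<partial>lebesgue)"
  proof (rule integral_mono)
    show "integrable lebesgue (\<lambda>y. \<bar>\<phi> y - f y\<bar> * h y)"
    proof (rule Bochner_Integration.integrable_bound)
      show "integrable lebesgue (\<lambda>y. ?b y * \<bar>\<psi> y - G n y\<bar> * h y + \<delta> * R ^ 4 * h y)" using i1 h(1) by auto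
      show "AE y in lebesgue. norm (\<bar>\<phi> y - f y\<bar> * h y) \<le> norm (?b y * \<bar>\<psi> y - G n y\<bar> * h y + \<delta> * R ^ 4 * h y)"
        using le h(2) by (intro AE_I2) (smt (verit, best) abs_ge_zero mult_nonneg_nonneg real_norm_def)
    qed (use \<phi>(1) fm hm in measurable)
  qed (use i1 h(1) le in auto)
  also have "\<dots> = (\<integral>y. ?b y * \<bar>\<psi> y - G n y\<bar> * h y \<partial>lebesgue) + \<delta> * (R ^ 4 * I)"
    using i1 h(1) by (simp add: I_def)
  also have "\<dots> < \<epsilon>" using n \<delta>I by linarith
  finally show ?thesis using that[of f] fC1 f0 fb by blast
qed

lemma integrable_mult_bounded:
  fixes f g :: "'x \<Rightarrow> real"
  assumes "integrable L f" "g \<in> borel_measurable L" "\<And>x. \<bar>g x\<bar> \<le> C"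
  shows "integrable L (\<lambda>x. g x * f x)"
proof (rule Bochner_Integration.integrable_bound[of _ "\<lambda>x. C * f x"])
  show "AE x in L. norm (g x * f x) \<le> norm (C * f x)"
  proof (rule AE_I2)
    fix x have "\<bar>g x\<bar> \<le> \<bar>C\<bar>" using assms(3)[of x] by linarith
    then show "norm (g x * f x) \<le> norm (C * f x)" by (simp add: abs_mult mult_right_mono)
  qed
qed (use assms in auto)

text \<open>Replace \<open>\<phi>\<close> by a C1 function \<open>f\<close> close to it in L^1 with
  weight \<open>h\<close>. The error for \<open>Fs l\<close> is controlled by \<open>hs l\<close>,
  and since \<phi> - f is bounded, \<open>hs l\<close> may be exchanged for \<open>h\<close> at a
  cost tending to 0. Convergence of the majorants thus does the work of uniform
  integrability.\<close>

lemma weak_convergence_bounded_measurable: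
  fixes F h :: "'v::euclidean_space \<Rightarrow> real"
  assumes r: "0 < r" "r < R"
    and F: "F \<in> borel_measurable lebesgue" "\<And>l. Fs l \<in> borel_measurable lebesgue"
    and h: "integrable lebesgue h" "\<And>l. integrable lebesgue (hs l)"
    and dom: "AE y in lebesgue. \<bar>F y\<bar> \<le> h y" "\<And>l. AE y in lebesgue. \<bar>Fs l y\<bar> \<le> hs l y"
    and h_nonneg: "\<And>y. 0 \<le> h y"
    and hlim: "(\<lambda>l. \<integral>y. \<bar>hs l y - h y\<bar> \<partial>lebesgue) \<longlonglongrightarrow> 0"
    and test: "\<And>f. C1_on UNIV f \<Longrightarrow> (\<And>y. y \<notin> ball a R \<Longrightarrow> f y = 0) \<Longrightarrow>
       (\<lambda>l. \<integral>y. f y * Fs l y \<partial>lebesgue) \<longlonglongrightarrow> (\<integral>y. f y * F y \<partial>lebesgue)"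
    and \<phi>: "\<phi> \<in> borel_measurable lebesgue" "\<And>y. \<bar>\<phi> y\<bar> \<le> B" "\<And>y. y \<notin> ball a r \<Longrightarrow> \<phi> y = 0"
  shows "(\<lambda>l. \<integral>y. \<phi> y * Fs l y \<partial>lebesgue) \<longlonglongrightarrow> (\<integral>y. \<phi> y * F y \<partial>lebesgue)"
proof (rule LIMSEQ_I)
  fix \<epsilon> :: real assume \<epsilon>: "0 < \<epsilon>"
  \<comment> \<open>A quarter, since this error enters twice in \<open>split\<close> and the
    remaining terms take the other half.\<close>
  obtain f C where f: "C1_on UNIV f" "\<And>y. y \<notin> ball a R \<Longrightarrow> f y = 0" "\<And>y. \<bar>f y\<bar> \<le> C"
    and fe: "(\<integral>y. \<bar>\<phi> y - f y\<bar> * h y \<partial>lebesgue) < \<epsilon> / 4"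
    using C1_approx_bounded_measurable[OF r _ \<phi> h(1) h_nonneg, of "\<epsilon> / 4"] \<epsilon> by auto
  have fm: "f \<in> borel_measurable lebesgue"
  proof -
    have "continuous_on UNIV f"
      using f(1) by (meson C1_on_has_derivative UNIV_I continuous_at_imp_continuous_on
          has_derivative_continuous)
    then show ?thesis using borel_measurable_continuous_onI[of f] by (simp add: measurable_completion)
  qed
  define D where "D y = \<phi> y - f y" for y
  have Dm: "D \<in> borel_measurable lebesgue" unfolding D_def using \<phi>(1) fm by measurable
  have Db: "\<bar>D y\<bar> \<le> B + C" for y using \<phi>(2)[of y] f(3)[of y] by (simp add: D_def)
  have iF: "integrable lebesgue F" "integrable lebesgue (Fs l)" for l
  proof -
    show "integrable lebesgue F"
      by (rule Bochner_Integration.integrable_bound[OF h(1) F(1)])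
          (use dom(1) in \<open>auto elim!: eventually_mono\<close>)
    show "integrable lebesgue (Fs l)"
      by (rule Bochner_Integration.integrable_bound[OF h(2)[of l] F(2)])
          (use dom(2)[of l] in \<open>auto elim!: eventually_mono\<close>)
  qed
  note im = integrable_mult_bounded
  have absD: "(\<lambda>y. \<bar>D y\<bar>) \<in> borel_measurable lebesgue" using Dm by measurable
  have split: "\<bar>(\<integral>y. \<phi> y * Fs l y \<partial>lebesgue) - (\<integral>y. \<phi> y * F y \<partial>lebesgue)\<bar>
     \<le> \<bar>(\<integral>y. f y * Fs l y \<partial>lebesgue) - (\<integral>y. f y * F y \<partial>lebesgue)\<bar>
        + 2 * (\<integral>y. \<bar>D y\<bar> * h y \<partial>lebesgue) + (B + C) * (\<integral>y. \<bar>hs l y - h y\<bar> \<partial>lebesgue)" for l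
  proof -
    have e1: "(\<integral>y. \<phi> y * G y \<partial>lebesgue) = (\<integral>y. f y * G y \<partial>lebesgue) + (\<integral>y. D y * G y \<partial>lebesgue)"
      if "integrable lebesgue G" for G
      using im[OF that fm f(3)] im[OF that Dm Db]
      by (subst Bochner_Integration.integral_add[symmetric]) (auto simp: D_def algebra_simps)
    have a1: "\<bar>\<integral>y. D y * F y \<partial>lebesgue\<bar> \<le> (\<integral>y. \<bar>D y\<bar> * h y \<partial>lebesgue)"
    proof -
      have "\<bar>\<integral>y. D y * F y \<partial>lebesgue\<bar> \<le> (\<integral>y. \<bar>D y * F y\<bar> \<partial>lebesgue)" by (rule integral_abs_bound)
      also have "\<dots> \<le> (\<integral>y. \<bar>D y\<bar> * h y \<partial>lebesgue)"
      proof (rule integral_mono_AE)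
        show "integrable lebesgue (\<lambda>y. \<bar>D y * F y\<bar>)" using im[OF iF(1) Dm Db] by auto
        show "integrable lebesgue (\<lambda>y. \<bar>D y\<bar> * h y)" using im[OF h(1) absD, of "B + C"] Db by auto
        show "AE y in lebesgue. \<bar>D y * F y\<bar> \<le> \<bar>D y\<bar> * h y"
          using dom(1) by (auto simp: abs_mult elim!: eventually_mono intro: mult_left_mono)
      qed
      finally show ?thesis .
    qed
    have a2: "\<bar>\<integral>y. D y * Fs l y \<partial>lebesgue\<bar>
        \<le> (\<integral>y. \<bar>D y\<bar> * h y \<partial>lebesgue) + (B + C) * (\<integral>y. \<bar>hs l y - h y\<bar> \<partial>lebesgue)"
    proof -
      have "\<bar>\<integral>y. D y * Fs l y \<partial>lebesgue\<bar> \<le> (\<integral>y. \<bar>D y * Fs l y\<bar> \<partial>lebesgue)" by (rule integral_abs_bound)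
      also have "\<dots> \<le> (\<integral>y. \<bar>D y\<bar> * h y + (B + C) * \<bar>hs l y - h y\<bar> \<partial>lebesgue)"
      proof (rule integral_mono_AE)
        show "integrable lebesgue (\<lambda>y. \<bar>D y * Fs l y\<bar>)" using im[OF iF(2) Dm Db] by auto
        show "integrable lebesgue (\<lambda>y. \<bar>D y\<bar> * h y + (B + C) * \<bar>hs l y - h y\<bar>)"
          using im[OF h(1) absD, of "B + C"] Db h by auto
        show "AE y in lebesgue. \<bar>D y * Fs l y\<bar> \<le> \<bar>D y\<bar> * h y + (B + C) * \<bar>hs l y - h y\<bar>"
          using dom(2)[of l]
        proof eventually_elim
          case (elim y)
          have "\<bar>D y * Fs l y\<bar> \<le> \<bar>D y\<bar> * hs l y" using elim by (simp add: abs_mult mult_left_mono)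
          also have "\<dots> \<le> \<bar>D y\<bar> * (h y + \<bar>hs l y - h y\<bar>)" by (intro mult_left_mono) auto
          also have "\<dots> = \<bar>D y\<bar> * h y + \<bar>D y\<bar> * \<bar>hs l y - h y\<bar>" by (simp add: algebra_simps)
          also have "\<bar>D y\<bar> * \<bar>hs l y - h y\<bar> \<le> (B + C) * \<bar>hs l y - h y\<bar>" using Db
              by (intro mult_right_mono) auto
          finally show ?case by simp
        qed
      qed
      also have "\<dots> = (\<integral>y. \<bar>D y\<bar> * h y \<partial>lebesgue) + (B + C) * (\<integral>y. \<bar>hs l y - h y\<bar> \<partial>lebesgue)"
        using im[OF h(1) absD, of "B + C"] Db h by (subst Bochner_Integration.integral_add) auto
      finally show ?thesis .
    qed
    show ?thesis using e1[OF iF(1)] e1[OF iF(2)[of l]] a1 a2 by linarith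
  qed
  have l1: "(\<lambda>l. (\<integral>y. f y * Fs l y \<partial>lebesgue) - (\<integral>y. f y * F y \<partial>lebesgue)) \<longlonglongrightarrow> 0"
    using test[OF f(1,2)] by (simp add: LIM_zero)
  have "(\<lambda>l. \<bar>(\<integral>y. f y * Fs l y \<partial>lebesgue) - (\<integral>y. f y * F y \<partial>lebesgue)\<bar> + (B + C) * (\<integral>y. \<bar>hs l y
      - h y\<bar> \<partial>lebesgue)) \<longlonglongrightarrow> 0"
    using tendsto_add[OF tendsto_rabs_zero[OF l1] tendsto_mult_right_zero[OF hlim, of "B + C"]] by simp
  then have "eventually (\<lambda>l. \<bar>(\<integral>y. f y * Fs l y \<partial>lebesgue) - (\<integral>y. f y * F y \<partial>lebesgue)\<bar> + (B
      + C) * (\<integral>y. \<bar>hs l y - h y\<bar> \<partial>lebesgue) < \<epsilon> / 2) sequentially"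
    using \<epsilon> by (intro order_tendstoD(2)) auto
  then obtain n0 where n0: "\<And>l. l \<ge> n0 \<Longrightarrow>
      \<bar>(\<integral>y. f y * Fs l y \<partial>lebesgue) - (\<integral>y. f y * F y \<partial>lebesgue)\<bar> + (B + C) * (\<integral>y. \<bar>hs l y
      - h y\<bar> \<partial>lebesgue) < \<epsilon> / 2"
    by (auto simp: eventually_sequentially)
  have "\<bar>(\<integral>y. \<phi> y * Fs l y \<partial>lebesgue) - (\<integral>y. \<phi> y * F y \<partial>lebesgue)\<bar> < \<epsilon>" if "l \<ge> n0" for l
    using split[of l] n0[OF that] fe unfolding D_def[symmetric] by linarith
  then show "\<exists>no. \<forall>n\<ge>no. norm ((\<integral>y. \<phi> y * Fs n y \<partial>lebesgue) - (\<integral>y. \<phi> y * F y \<partial>lebesgue)) < \<epsilon>" by auto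
qed

section \<open>Cut-off coordinate functions\<close>

lemma C1_on_continuous: "C1_on S f \<Longrightarrow> continuous_on S f"
  by (meson C1_on_has_derivative continuous_at_imp_continuous_on has_derivative_continuous)

text \<open>The argument of the inner square exceeds 1 on the ball of radius R / 2 and is at most 0
  outside the ball of radius \<open>R\<close>. The outer map, sending t to 1 - pos_square (1 - t),
  flattens all t \<ge> 1 to the value 1 and fixes 0.\<close>

definition plateau :: "'v::euclidean_space \<Rightarrow> real \<Rightarrow> 'v \<Rightarrow> real" where
  "plateau a R y = 1 - pos_square (1 - pos_square (2 - 2 / R\<^sup>2 * ((y - a) \<bullet> (y - a))))"

lemma plateau_C1: "C1_on UNIV (plateau a R)"
proof -
  have "C1_on UNIV (\<lambda>y. 2 + (- (2 / R\<^sup>2)) * ((y - a) \<bullet> (y - a)))"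
    by (intro C1_on_add C1_on_const C1_on_mult norm_square_C1)
  from C1_on_comp[OF this pos_square_C1] have "C1_on UNIV (\<lambda>y. pos_square (2 - 2 / R\<^sup>2 * ((y - a) \<bullet> (y
      - a))))"
    by (simp add: o_def)
  then have "C1_on UNIV (\<lambda>y. 1 + (- 1) * pos_square (2 - 2 / R\<^sup>2 * ((y - a) \<bullet> (y - a))))"
    by (intro C1_on_add C1_on_const C1_on_mult)
  from C1_on_comp[OF this pos_square_C1] have "C1_on UNIV (\<lambda>y. pos_square (1 - pos_square (2
      - 2 / R\<^sup>2 * ((y - a) \<bullet> (y - a)))))"
    by (simp add: o_def)
  then have "C1_on UNIV (\<lambda>y. 1 + (- 1) * pos_square (1 - pos_square (2 - 2 / R\<^sup>2 * ((y - a) \<bullet> (y - a)))))"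
    by (intro C1_on_add C1_on_const C1_on_mult)
  then show ?thesis by (simp add: plateau_def[abs_def])
qed

lemma plateau_values:
  assumes R: "0 < R"
  shows "y \<in> ball a (R / 2) \<Longrightarrow> plateau a R y = 1" "y \<notin> ball a R \<Longrightarrow> plateau a R y = 0"
proof -
  have n: "(y - a) \<bullet> (y - a) = (dist a y)\<^sup>2"
      by (simp add: dist_norm norm_minus_commute[of a] power2_norm_eq_inner)
  show "plateau a R y = 1" if "y \<in> ball a (R / 2)"
  proof -
    have "(dist a y)\<^sup>2 \<le> (R / 2)\<^sup>2" using that by (intro power_mono) auto
    then have "2 / R\<^sup>2 * (dist a y)\<^sup>2 \<le> 2 / R\<^sup>2 * (R / 2)\<^sup>2" by (intro mult_left_mono) auto
    also have "\<dots> \<le> 1" using R by (simp add: power_divide)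
    finally have "1 \<le> (2 - 2 / R\<^sup>2 * (dist a y)\<^sup>2)\<^sup>2 \<and> 1 \<le> 2 - 2 / R\<^sup>2 * (dist a y)\<^sup>2"
        by (simp add: one_le_power)
    then show ?thesis unfolding plateau_def pos_square_def n by (simp add: max_def)
  qed
  show "plateau a R y = 0" if "y \<notin> ball a R"
  proof -
    have "R\<^sup>2 \<le> (dist a y)\<^sup>2" using that R by (intro power_mono) auto
    then have "2 / R\<^sup>2 * R\<^sup>2 \<le> 2 / R\<^sup>2 * (dist a y)\<^sup>2" by (intro mult_left_mono) auto
    then show ?thesis unfolding plateau_def pos_square_def n using R by (simp add: max_def)
  qed
qed

section \<open>Extension by zero of functions supported in a chart\<close>

context C1_manifold
begin

lemma C1c_C1_on: "f \<in> C1c_functions M \<Longrightarrow> c \<in> M \<Longrightarrow> C1_on (chart_image c) (f \<circ> chart_inv c)"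
  by (simp add: C1c_functions_def)

lemma C1c_continuous:
  assumes f: "f \<in> C1c_functions M" shows "continuous_on UNIV f"
proof (rule continuous_at_imp_continuous_on, rule ballI)
  fix y
  let ?c = "ref_chart M y"
  have "continuous_on (fst ?c) ((f \<circ> chart_inv ?c) \<circ> snd ?c)"
    by (rule continuous_on_compose[OF chart_cont[OF ref_chart(1)]])
       (use C1_on_continuous[OF C1c_C1_on[OF f ref_chart(1)]] in \<open>simp add: chart_image_def\<close>)
  then have "continuous_on (fst ?c) f"
    by (rule continuous_on_eq) (use ref_chart(1) in simp)
  then show "isCont f y"
    using chart_open[OF ref_chart(1)] ref_chart(2) continuous_on_eq_continuous_at by blast
qed

lemma mdiff_linear:
  assumes f: "f \<in> C1c_functions M" shows "linear (mdiff M f y)"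
  unfolding mdiff_def
  by (rule has_derivative_linear[OF C1_on_has_derivative[OF C1c_C1_on[OF f ref_chart(1)] chart_into[OF
      ref_chart]]])

definition chart_pullback :: "('a, 'm) chart \<Rightarrow> (real ^ 'm \<Rightarrow> real) \<Rightarrow> 'a \<Rightarrow> real" where
  "chart_pullback e G y = (if y \<in> fst e then G (snd e y) else 0)"

text \<open>Here the Hausdorff property enters: the compact image is closed in the manifold and not
  only in the chart domain, so an extension by zero causes no trouble at the boundary of that
  domain.\<close>

lemma chart_compact:
  assumes "e \<in> M" "K \<subseteq> chart_image e" "compact K"
  shows "compact (chart_inv e ` K)" "closed (chart_inv e ` K)" "chart_inv e ` K \<subseteq> fst e"
proof -
  show "compact (chart_inv e ` K)"
    by (rule compact_continuous_image[OF continuous_on_subset[OF inv_cont[OF assms(1)] assms(2)] assms(3)])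
  then show "closed (chart_inv e ` K)" by (rule compact_imp_closed)
  show "chart_inv e ` K \<subseteq> fst e" using assms inv_into_dom by blast
qed

context
  fixes e and G :: "real ^ 'm \<Rightarrow> real" and K
  assumes e: "e \<in> M" and G: "C1_on UNIV G"
    and K: "compact K" "K \<subseteq> chart_image e" and G0: "\<And>z. z \<notin> K \<Longrightarrow> G z = 0"
begin

lemma chart_pullback_zero: "y \<notin> chart_inv e ` K \<Longrightarrow> chart_pullback e G y = 0"
  using G0[of "snd e y"] e by (force simp: chart_pullback_def)

lemma chart_pullback_locally_zero:
  assumes "c \<in> M" "x \<in> fst c" "x \<notin> chart_inv e ` K"
  obtains T where "open T" "snd c x \<in> T" "\<And>z. z \<in> T \<Longrightarrow> (chart_pullback e G \<circ> chart_inv c) z = 0"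
proof
  show "open (chart_image c \<inter> chart_inv c -` (- chart_inv e ` K))"
    by (rule open_chart_preimage[OF top_chart[OF assms(1)]]) (use chart_compact(2)[OF e K(2,1)] in auto)
  show "snd c x \<in> chart_image c \<inter> chart_inv c -` (- chart_inv e ` K)"
    using assms chart_into by auto
qed (use chart_pullback_zero in auto)

text \<open>The domain of \<open>e\<close> and the complement of the compact image are open and
  cover the manifold. On the first the function is \<open>G\<close> composed with a transition map,
  on the second it is 0.\<close>

lemma chart_pullback_C1c: "chart_pullback e G \<in> C1c_functions M"
proof -
  have "closure {y. chart_pullback e G y \<noteq> 0} \<subseteq> chart_inv e ` K"
    by (rule closure_minimal[OF _ chart_compact(2)[OF e K(2,1)]]) (use chart_pullback_zero in blast)
  then have "closure {y. chart_pullback e G y \<noteq> 0} = chart_inv e ` K \<inter> closure {y. chart_pullback e G y \<noteq> 0}"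
    by blast
  moreover have "compact (chart_inv e ` K \<inter> closure {y. chart_pullback e G y \<noteq> 0})"
    by (rule compact_Int_closed[OF chart_compact(1)[OF e K(2,1)] closed_closure])
  ultimately have comp: "compact (closure {y. chart_pullback e G y \<noteq> 0})" by simp
  have "C1_on (chart_image c) (chart_pullback e G \<circ> chart_inv c)" if c: "c \<in> M" for c
  proof (rule C1_on_locally)
    fix z assume z: "z \<in> chart_image c"
    let ?x = "chart_inv c z"
    have x: "?x \<in> fst c" "snd c ?x = z" using z c inv_into_dom by auto
    show "\<exists>T. open T \<and> z \<in> T \<and> C1_on T (chart_pullback e G \<circ> chart_inv c)"
    proof (cases "?x \<in> fst e")
      case True
      let ?T = "snd c ` (fst c \<inter> fst e)"
      have "C1_on ?T (chart_pullback e G \<circ> chart_inv c)"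
      proof (rule C1_on_cong)
        show "C1_on ?T (G \<circ> transition c e)"
          by (rule C1_on_comp[OF transition_C1[OF c e] G]) auto
        show "(G \<circ> transition c e) w = (chart_pullback e G \<circ> chart_inv c) w" if "w \<in> ?T" for w
          using that c by (auto simp: chart_pullback_def)
      qed (rule overlap_open[OF c e])
      then show ?thesis using overlap_open[OF c e] x True
          by (intro exI[of _ ?T]) (auto intro!: image_eqI[of _ _ ?x])
    next
      case False
      then have "?x \<notin> chart_inv e ` K" using chart_compact(3)[OF e K(2,1)] by blast
      from chart_pullback_locally_zero[OF c x(1) this] x obtain T where
        T: "open T" "z \<in> T" "\<And>w. w \<in> T \<Longrightarrow> (chart_pullback e G \<circ> chart_inv c) w = 0" by metis
      have "C1_on T (chart_pullback e G \<circ> chart_inv c)"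
        by (rule C1_on_cong[OF C1_on_const[of T 0] T(1)]) (use T(3) in simp)
      then show ?thesis using T by blast
    qed
  qed
  then show ?thesis using comp by (simp add: C1c_functions_def)
qed

lemma mdiff_chart_pullback:
  assumes "y \<in> fst e"
  shows "mdiff M (chart_pullback e G) y = frechet_derivative G (at (snd e y)) \<circ> chart_diff M e y"
proof (rule mdiff_eq[OF e assms])
  show "(chart_pullback e G \<circ> chart_inv e has_derivative frechet_derivative G (at (snd e y))) (at (snd e y))"
    by (rule has_derivative_transform_within_open[OF C1_on_has_derivative[OF G] image_open[OF e]])
       (use assms e chart_into inv_into_dom in \<open>auto simp: chart_pullback_def\<close>)
qed

lemma mdiff_chart_pullback_zero:
  assumes "y \<notin> chart_inv e ` K"
  shows "mdiff M (chart_pullback e G) y v = 0"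
proof -
  let ?c = "ref_chart M y"
  obtain T where T: "open T" "snd ?c y \<in> T" "\<And>z. z \<in> T \<Longrightarrow> (chart_pullback e G \<circ> chart_inv ?c) z = 0"
    using chart_pullback_locally_zero[OF ref_chart assms] by blast
  have "(chart_pullback e G \<circ> chart_inv ?c has_derivative (\<lambda>_. 0)) (at (snd ?c y))"
    by (rule has_derivative_transform_within_open[OF has_derivative_const T(1,2)]) (use T(3) in simp)
  from mdiff_eq[OF ref_chart this] show ?thesis by simp
qed

end
end

context riemannian_atlas
begin

text \<open>The quadratic form of the metric attains a positive minimum over the compact set of
  pairs of a point of \<open>K\<close> and a unit vector; homogeneity extends the bound to all
  vectors.\<close>

lemma gram_ge_norm:
  assumes c: "c \<in> M" and K: "compact K" "K \<subseteq> chart_image c"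
  obtains m where "0 < m" "\<And>x v. x \<in> chart_inv c ` K \<Longrightarrow> m * (norm (chart_diff M c x v))\<^sup>2 \<le> g x v v"
proof (cases "K = {}")
  case True then show ?thesis using that[of 1] by simp
next
  case False
  let ?S = "sphere (0 :: real ^ 'm) 1"
  let ?q = "\<lambda>p. \<Sum>j\<in>UNIV. \<Sum>k\<in>UNIV. snd p $ j * snd p $ k * gram c (chart_inv c (fst p)) $ j $ k"
  have q: "?q (z, chart_diff M c x v) = g x v v" if "z \<in> chart_image c" "x = chart_inv c z" for z x v
    using gram_form[OF c, of x v v] that inv_into_dom[OF c] by simp
  have "axis undefined 1 \<in> ?S" by simp
  then have ne: "K \<times> ?S \<noteq> {}" using False by blast
  have gc: "continuous_on (K \<times> ?S) (\<lambda>p. gram c (chart_inv c (fst p)))"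
    by (rule continuous_on_compose2[OF gram_coord_cont[OF c] continuous_on_fst[OF continuous_on_id]])
        (use K in auto)
  have "continuous_on (K \<times> ?S) ?q" by (intro continuous_intros gc)
  then obtain p where p: "p \<in> K \<times> ?S" "\<And>p'. p' \<in> K \<times> ?S \<Longrightarrow> ?q p \<le> ?q p'"
    using continuous_attains_inf[OF compact_Times[OF K(1) compact_sphere] ne] by blast
  have pos: "0 < ?q p"
  proof -
    obtain z w where zw: "p = (z, w)" "z \<in> K" "norm w = 1" using p(1) by (auto simp: dist_norm)
    let ?x = "chart_inv c z"
    have x: "?x \<in> fst c" using zw K inv_into_dom[OF c] by blast
    let ?v = "inv (chart_diff M c ?x) w"
    have cv: "chart_diff M c ?x ?v = w" using c x by simp
    then have "?v \<noteq> 0" using zw(3) linear_0[OF chart_diff_linear[OF c x]] by auto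
    then have "0 < g ?x ?v ?v" by (rule inner_formD(3)[OF form])
    then show ?thesis using q[of z ?x ?v] zw K unfolding cv by auto
  qed
  show ?thesis
  proof (rule that[OF pos])
    fix x v assume "x \<in> chart_inv c ` K"
    then obtain z where z: "z \<in> K" "x = chart_inv c z" by blast
    have x: "x \<in> fst c" using z K inv_into_dom[OF c] by blast
    let ?w = "chart_diff M c x v"
    show "?q p * (norm ?w)\<^sup>2 \<le> g x v v"
    proof (cases "?w = 0")
      case True then show ?thesis using inner_formD(4)[OF form] by simp
    next
      case False
      let ?u = "(1 / norm ?w) *\<^sub>R v"
      have cu: "chart_diff M c x ?u = (1 / norm ?w) *\<^sub>R ?w"
          by (rule linear_scale[OF chart_diff_linear[OF c x]])
      have "?q p \<le> ?q (z, chart_diff M c x ?u)"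
      proof (rule p(2))
        have "norm (chart_diff M c x ?u) = 1" unfolding cu using False by simp
        then show "(z, chart_diff M c x ?u) \<in> K \<times> ?S" using z(1) by simp
      qed
      also have "\<dots> = g x ?u ?u" using q[of z x ?u] z K by blast
      also have "\<dots> = g x v v / (norm ?w)\<^sup>2"
        by (simp add: bilinear_lmul[OF inner_formD(1)[OF form]] bilinear_rmul[OF inner_formD(1)[OF form]]
            power2_eq_square)
      finally show ?thesis using False by (simp add: field_simps)
    qed
  qed
qed

text \<open>The derivative of \<open>G\<close> is bounded on \<open>K\<close>, coordinate vectors
  are bounded by the metric there, and off \<open>K\<close> the differential is 0. That
  \<open>L\<close> works at every \<open>y\<close> is essential: the maps of the sequence may take
  their values anywhere.\<close>

lemma chart_pullback_bound:
  assumes e: "e \<in> M" and G: "C1_on UNIV G" and K: "compact K" "K \<subseteq> chart_image e" and G0: "\<And>z. z \<notin> K \<Longrightarrow>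
      G z = 0"
  obtains L where "0 \<le> L" "\<And>y v. \<bar>mdiff M (chart_pullback e G) y v\<bar> \<le> L * sqrt (g y v v)"
proof -
  obtain m where m: "0 < m" "\<And>x v. x \<in> chart_inv e ` K \<Longrightarrow> m * (norm (chart_diff M e x v))\<^sup>2 \<le> g x v v"
    using gram_ge_norm[OF e K] by blast
  have "continuous_on K (\<lambda>z. Blinfun (frechet_derivative G (at z)))"
    using continuous_on_subset[OF C1_on_continuous_derivative[OF G]] by blast
  then have "compact ((\<lambda>z. Blinfun (frechet_derivative G (at z))) ` K)"
    using K(1) by (rule compact_continuous_image)
  from compact_imp_bounded[OF this] obtain L0
    where L0: "0 < L0" "\<And>z. z \<in> K \<Longrightarrow> norm (Blinfun (frechet_derivative G (at z))) \<le> L0"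
    unfolding bounded_pos by blast
  have D: "\<bar>frechet_derivative G (at z) w\<bar> \<le> L0 * norm w" if "z \<in> K" for z w
  proof -
    have "bounded_linear (frechet_derivative G (at z))"
      by (rule has_derivative_bounded_linear[OF C1_on_has_derivative[OF G]]) simp
    then have "\<bar>frechet_derivative G (at z) w\<bar> \<le> norm (Blinfun (frechet_derivative G (at z))) * norm w"
      using norm_blinfun[of "Blinfun (frechet_derivative G (at z))" w]
          by (simp add: bounded_linear_Blinfun_apply)
    also have "\<dots> \<le> L0 * norm w" using L0(2)[OF that] by (intro mult_right_mono) auto
    finally show ?thesis .
  qed
  show ?thesis
  proof (rule that[of "L0 / sqrt m"])
    show "0 \<le> L0 / sqrt m" using L0 m by simp
    fix y v
    show "\<bar>mdiff M (chart_pullback e G) y v\<bar> \<le> L0 / sqrt m * sqrt (g y v v)"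
    proof (cases "y \<in> chart_inv e ` K")
      case True
      then obtain z where z: "z \<in> K" "y = chart_inv e z" by blast
      have "z \<in> chart_image e" using z K by blast
      then have y: "y \<in> fst e" "snd e y = z" using z(2) inv_into_dom[OF e] inv_right[OF e] by simp_all
      have "sqrt (m * (norm (chart_diff M e y v))\<^sup>2) \<le> sqrt (g y v v)"
          by (rule real_sqrt_le_mono[OF m(2)[OF True]])
      then have "norm (chart_diff M e y v) \<le> sqrt (g y v v) / sqrt m"
        using m(1) by (simp add: real_sqrt_mult field_simps)
      then have "L0 * norm (chart_diff M e y v) \<le> L0 * (sqrt (g y v v) / sqrt m)"
        using L0 by (intro mult_left_mono) auto
      moreover have "\<bar>mdiff M (chart_pullback e G) y v\<bar> \<le> L0 * norm (chart_diff M e y v)"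
        unfolding mdiff_chart_pullback[OF e G K G0 y(1), simplified] using D[OF z(1)] y by simp
      ultimately show ?thesis by simp
    next
      case False
      show ?thesis using mdiff_chart_pullback_zero[OF e G K G0 False] L0 m inner_formD(4)[OF form, of y v]
          by simp
    qed
  qed
qed

text \<open>On \<open>W\<close> the differentials of the \<open>f i\<close> are the coordinates
  themselves and determine a tangent vector completely. Elsewhere only the bound by \<open>L\<close>
  remains, and it suffices for majorants.\<close>

lemma coordinate_functions:
  assumes e: "e \<in> M" and y0: "y0 \<in> fst e"
  obtains W f L where "open W" "y0 \<in> W" "W \<subseteq> fst e" "0 \<le> L"
    "\<And>i :: 'm. f i \<in> C1c_functions M" "\<And>i. bounded (range (f i))"
    "\<And>i y v. \<bar>mdiff M (f i) y v\<bar> \<le> L * sqrt (g y v v)"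
    "\<And>i y v. y \<in> W \<Longrightarrow> mdiff M (f i) y v = chart_diff M e y v $ i"
proof -
  let ?a = "snd e y0"
  have "?a \<in> chart_image e" by (rule chart_into[OF e y0])
  then obtain R where R: "0 < R" "cball ?a R \<subseteq> chart_image e"
    using image_open[OF e] open_contains_cball by blast
  let ?K = "cball ?a R"
  \<comment> \<open>The i-th coordinate times a plateau that equals 1 on the ball of half the
    radius, whose preimage will be \<open>W\<close>.\<close>
  define G where "G i z = plateau ?a R z * z $ i" for i :: 'm and z
  define f where "f i = chart_pullback e (G i)" for i
  have "C1_on UNIV (\<lambda>z :: real ^ 'm. z $ i)" for i by (rule C1_on_bounded_linear[OF bounded_linear_vec_nth])
  then have GC: "C1_on UNIV (G i)" for i unfolding G_def by (intro C1_on_mult plateau_C1)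
  have G0: "G i z = 0" if "z \<notin> ?K" for i z using that plateau_values(2)[OF R(1), of z ?a] by (simp add: G_def)
  define W where "W = fst e \<inter> snd e -` ball ?a (R / 2)"
  have "\<exists>L\<ge>0. \<forall>y v. \<bar>mdiff M (f i) y v\<bar> \<le> L * sqrt (g y v v)" for i
    unfolding f_def by (rule chart_pullback_bound[OF e GC compact_cball R(2) G0]) auto
  then obtain L where L: "\<And>i. 0 \<le> L i" "\<And>i y v. \<bar>mdiff M (f i) y v\<bar> \<le> L i * sqrt (g y v v)" by metis
  show ?thesis
  proof (rule that[of W "\<Sum>i\<in>UNIV. L i" f])
    show "open W" unfolding W_def by (rule open_chart_preimage'[OF top_chart[OF e] open_ball])
    show "y0 \<in> W" using y0 R by (simp add: W_def)
    show "W \<subseteq> fst e" by (auto simp: W_def)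
    show "0 \<le> (\<Sum>i\<in>UNIV. L i)" using L(1) by (simp add: sum_nonneg)
    show "f i \<in> C1c_functions M" for i
      unfolding f_def by (rule chart_pullback_C1c[OF e GC compact_cball R(2) G0])
    show "bounded (range (f i))" for i
    proof -
      have "compact (G i ` ?K)" by
          (rule compact_continuous_image[OF continuous_on_subset[OF C1_on_continuous[OF GC]]
          compact_cball]) simp
      then have "bounded (insert 0 (G i ` ?K))" by (simp add: compact_imp_bounded)
      moreover have "range (f i) \<subseteq> insert 0 (G i ` ?K)" using G0
          by (auto simp: f_def chart_pullback_def simp del: mem_cball)
      ultimately show ?thesis by (rule bounded_subset)
    qed
    show "\<bar>mdiff M (f i) y v\<bar> \<le> (\<Sum>i\<in>UNIV. L i) * sqrt (g y v v)" for i y v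
    proof -
      have "L i \<le> (\<Sum>i\<in>UNIV. L i)" using L(1) by (intro member_le_sum) auto
      then show ?thesis using L(2)[of i y v] inner_formD(4)[OF form, of y v]
          by (meson mult_right_mono order_trans real_sqrt_ge_zero)
    qed
    show "mdiff M (f i) y v = chart_diff M e y v $ i" if y: "y \<in> W" for i y v
    proof -
      have ye: "y \<in> fst e" "snd e y \<in> ball ?a (R / 2)" using y by (auto simp: W_def)
      have "(G i has_derivative (\<lambda>w. w $ i)) (at (snd e y))"
        by (rule has_derivative_transform_within_open[OF bounded_linear_imp_has_derivative[OF
            bounded_linear_vec_nth] open_ball ye(2)])
           (simp add: G_def plateau_values(1)[OF R(1)])
      then have "frechet_derivative (G i) (at (snd e y)) = (\<lambda>w. w $ i)"
          by (rule frechet_derivative_at[symmetric])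
      moreover have "mdiff M (f i) y = frechet_derivative (G i) (at (snd e y)) \<circ> chart_diff M e y"
        unfolding f_def by (rule mdiff_chart_pullback[OF e GC compact_cball R(2) _ ye(1)]) (rule G0)
      ultimately show ?thesis by simp
    qed
  qed
qed

end

section \<open>Absolutely continuous measures and convergence almost everywhere\<close>

text \<open>Almost everywhere statements are reached only along subsequences; this leads back to the
  full sequence.\<close>

lemma tendsto_if_subsequences:
  fixes x :: "nat \<Rightarrow> 'x::topological_space"
  assumes "\<And>r :: nat \<Rightarrow> nat. strict_mono r \<Longrightarrow> \<exists>r' :: nat \<Rightarrow> nat. strict_mono r' \<and> (\<lambda>n. x (r (r' n))) \<longlonglongrightarrow> L"
  shows "x \<longlonglongrightarrow> L"
proof (rule topological_tendstoI, rule ccontr)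
  fix S assume S: "open S" "L \<in> S" "\<not> eventually (\<lambda>n. x n \<in> S) sequentially"
  then have "infinite {n. x n \<notin> S}"
    unfolding eventually_sequentially infinite_nat_iff_unbounded_le by auto
  then obtain r :: "nat \<Rightarrow> nat" where r: "strict_mono r" "\<And>n. x (r n) \<notin> S"
    using infinite_enumerate by blast
  obtain r' where "strict_mono r'" "(\<lambda>n. x (r (r' n))) \<longlonglongrightarrow> L" using assms[OF r(1)] by blast
  then have "eventually (\<lambda>n. x (r (r' n)) \<in> S) sequentially" using S topological_tendstoD by blast
  then show False using r(2) by (simp add: eventually_sequentially)
qed

text \<open>The index \<open>r k\<close> makes the integrals number 0 to k smaller than (1/2)^k at
  once. Each resulting series has a finite integral, so it converges almost everywhere and its terms
  tend to 0.\<close>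

lemma countable_AE_subsequence:
  fixes q :: "nat \<Rightarrow> nat \<Rightarrow> 'x \<Rightarrow> real"
  assumes m: "\<And>i n. q i n \<in> borel_measurable M" and nn: "\<And>i n x. 0 \<le> q i n x"
    and lim: "\<And>i. (\<lambda>n. \<integral>\<^sup>+x. ennreal (q i n x) \<partial>M) \<longlonglongrightarrow> 0"
  obtains r :: "nat \<Rightarrow> nat" where "strict_mono r" "AE x in M. \<forall>i. (\<lambda>n. q i (r n) x) \<longlonglongrightarrow> 0"
proof -
  have ev: "eventually (\<lambda>n. \<forall>i\<le>k. (\<integral>\<^sup>+x. ennreal (q i n x) \<partial>M) < ennreal ((1/2)^k)) sequentially" for k :: nat
  proof -
    have "eventually (\<lambda>n. \<forall>i\<in>{..k}. (\<integral>\<^sup>+x. ennreal (q i n x) \<partial>M) < ennreal ((1/2)^k)) sequentially"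
      by (intro eventually_ball_finite ballI order_tendstoD(2)[OF lim]) auto
    then show ?thesis by (auto elim!: eventually_mono)
  qed
  have "\<exists>r::nat \<Rightarrow> nat. \<forall>k. (\<forall>i\<le>k. (\<integral>\<^sup>+x. ennreal (q i (r k) x) \<partial>M) < ennreal ((1/2)^k)) \<and> r k < r (Suc k)"
  proof (rule dependent_nat_choice)
    show "\<exists>n. \<forall>i\<le>0. (\<integral>\<^sup>+x. ennreal (q i n x) \<partial>M) < ennreal ((1/2)^0)"
      using ev[of 0] by (auto simp: eventually_sequentially)
    fix n k
    show "\<exists>n'. (\<forall>i\<le>Suc k. (\<integral>\<^sup>+x. ennreal (q i n' x) \<partial>M) < ennreal ((1/2)^Suc k)) \<and> n < n'"
      using eventually_happens'[OF sequentially_bot eventually_conj[OF ev[of "Suc k"]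
          eventually_gt_at_top[of n]]] .
  qed
  then obtain r :: "nat \<Rightarrow> nat" where r: "\<And>k i. i \<le> k \<Longrightarrow> (\<integral>\<^sup>+x. ennreal (q i (r k) x) \<partial>M) < ennreal ((1/2)^k)"
    "\<And>k. r k < r (Suc k)" by blast
  \<comment> \<open>The series starts at index \<open>i\<close>, because the bound on the i-th
    integrals is available only along \<open>r k\<close> with k \<ge> i.\<close>
  have "AE x in M. (\<lambda>n. q i (r n) x) \<longlonglongrightarrow> 0" for i
  proof -
    have "(\<integral>\<^sup>+x. (\<Sum>n. ennreal (q i (r (n + i)) x)) \<partial>M) = (\<Sum>n. \<integral>\<^sup>+x. ennreal (q i (r (n + i)) x) \<partial>M)"
      using m by (intro nn_integral_suminf) auto
    also have "\<dots> \<le> (\<Sum>n. ennreal ((1/2)^n))"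
    proof (intro suminf_le)
      fix n
      have "(\<integral>\<^sup>+x. ennreal (q i (r (n + i)) x) \<partial>M) \<le> ennreal ((1/2)^(n + i))" using r(1)[of i "n + i"] by auto
      also have "\<dots> \<le> ennreal ((1/2)^n)" by (intro ennreal_leI power_decreasing) auto
      finally show "(\<integral>\<^sup>+x. ennreal (q i (r (n + i)) x) \<partial>M) \<le> ennreal ((1/2)^n)" .
    qed auto
    also have "\<dots> < \<infinity>"
    proof -
      have s: "summable (\<lambda>n. (1/2 :: real)^n)" by (rule summable_geometric) simp
      have "(\<Sum>n. ennreal ((1/2)^n)) \<noteq> top" by (rule ennreal_suminf_neq_top[OF s]) simp
      then show ?thesis unfolding infinity_ennreal_def less_top .
    qed
    finally have "AE x in M. (\<Sum>n. ennreal (q i (r (n + i)) x)) \<noteq> \<infinity>"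
      using m by (intro nn_integral_PInf_AE) auto
    then show ?thesis
    proof eventually_elim
      case (elim x)
      then have "summable (\<lambda>n. q i (r (n + i)) x)" using nn by (intro summable_suminf_not_top) auto
      then have "(\<lambda>n. q i (r (n + i)) x) \<longlonglongrightarrow> 0" by (rule summable_LIMSEQ_zero)
      then show ?case by (rule LIMSEQ_offset)
    qed
  qed
  then show ?thesis using that[of r] r(2) by (auto simp: AE_all_countable strict_mono_Suc_iff)
qed

text \<open>Dominated convergence for indicators, with the indicator of \<open>B\<close> as
  integrable majorant.\<close>

lemma emeasure_tendsto_zero:
  assumes A: "\<And>n. A n \<in> sets M" "\<And>n. A n \<subseteq> B" and B: "B \<in> sets M" "emeasure M B < \<infinity>"
    and ae: "AE x in M. eventually (\<lambda>n. x \<notin> A n) sequentially"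
  shows "(\<lambda>n. emeasure M (A n)) \<longlonglongrightarrow> 0"
proof -
  have "(\<lambda>n. \<integral>\<^sup>+x. indicator (A n) x \<partial>M) \<longlonglongrightarrow> (\<integral>\<^sup>+x. 0 \<partial>M)"
  proof (rule nn_integral_dominated_convergence[where w="indicator B"])
    show "AE x in M. (\<lambda>n. indicator (A n) x :: ennreal) \<longlonglongrightarrow> 0"
      using ae
    proof eventually_elim
      case (elim x)
      then have "eventually (\<lambda>n. indicator (A n) x = (0 :: ennreal)) sequentially" by eventually_elim simp
      then show ?case by (rule tendsto_eventually)
    qed
    show "(\<integral>\<^sup>+x. indicator B x \<partial>M) < \<infinity>" using B by simp
    show "AE x in M. indicator (A n) x \<le> (indicator B x :: ennreal)" for n
      using A(2)[of n] by (intro AE_I2) (auto simp: indicator_def)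
  qed (use A B in auto)
  then show ?thesis using A(1) by simp
qed

text \<open>Translates from a metric on a carrier set, with its own topology, to the topology of the
  type. Joint continuity is what makes the distance of two measurable maps a measurable
  function.\<close>

lemma
  assumes d: "Metric_space UNIV d" "Metric_space.mtopology UNIV d = euclidean"
  shows metric_continuous: "continuous_on UNIV (\<lambda>p :: 'b::topological_space \<times> 'b. d (fst p) (snd p))"
    and metric_tendsto_iff: "(X \<longlonglongrightarrow> x) \<longleftrightarrow> (\<lambda>n. d (X n) x) \<longlonglongrightarrow> 0"
proof -
  interpret Metric_space UNIV d by fact
  define m where "m = metric (UNIV, d)"
  have m: "mdist m = d" "mtopology_of m = euclidean"
    using d(2) by (simp_all add: m_def mtopology_of)
  have "continuous_map euclidean euclidean (\<lambda>p :: 'b \<times> 'b. mdist m (fst p) (snd p))"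
    by (rule continuous_map_mdist) (auto simp: m intro: continuous_intros)
  then show c: "continuous_on UNIV (\<lambda>p :: 'b \<times> 'b. d (fst p) (snd p))" by (simp add: m)
  show "(X \<longlonglongrightarrow> x) \<longleftrightarrow> (\<lambda>n. d (X n) x) \<longlonglongrightarrow> 0"
  proof
    assume "X \<longlonglongrightarrow> x"
    then have "(\<lambda>n. (X n, x)) \<longlonglongrightarrow> (x, x)" by (intro tendsto_intros)
    then have "(\<lambda>n. d (fst (X n, x)) (snd (X n, x))) \<longlonglongrightarrow> d (fst (x, x)) (snd (x, x))"
      by (rule continuous_on_tendsto_compose[OF c]) auto
    then show "(\<lambda>n. d (X n) x) \<longlonglongrightarrow> 0" by simp
  next
    assume l: "(\<lambda>n. d (X n) x) \<longlonglongrightarrow> 0"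
    show "X \<longlonglongrightarrow> x"
    proof (rule topological_tendstoI)
      fix S assume S: "open S" "x \<in> S"
      then obtain r where r: "0 < r" "mball x r \<subseteq> S"
        using d(2) openin_mtopology[of S] by auto
      show "eventually (\<lambda>n. X n \<in> S) sequentially"
        using order_tendstoD(2)[OF l r(1)]
      proof eventually_elim
        case (elim n)
        then have "X n \<in> mball x r" by (simp add: commute)
        then show ?case using r(2) by blast
      qed
    qed
  qed
qed

section \<open>Null sets and convergence for the measure \<open>\<mu>\<close>\<close>

locale ac_measure = C1_manifold M
  for M :: "('a::{t2_space, second_countable_topology}, 'm::finite) chart set" +
  fixes \<mu> :: "'a measure"
  assumes sets_mu: "sets \<mu> = sets borel" and fin: "finite_measure \<mu>"
    and pac: "positive_absolutely_continuous M \<mu>"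
begin

lemma space_mu: "space \<mu> = UNIV" using sets_eq_imp_space_eq[OF sets_mu] by simp

lemma fin_completion: "finite_measure (completion \<mu>)"
  using finite_measure.emeasure_finite[OF fin, of "space \<mu>"] by (intro finite_measureI) simp

lemma borel_chart_preimage:
  assumes "c \<in> M" "S \<in> sets borel" shows "fst c \<inter> snd c -` S \<in> sets borel"
proof -
  have "snd c \<in> borel_measurable (restrict_space borel (fst c))"
    by (rule borel_measurable_continuous_on_restrict[OF chart_cont[OF assms(1)]])
  from measurable_sets[OF this assms(2)] show ?thesis
    using chart_open[OF assms(1)] by (simp add: sets_restrict_space_iff space_restrict_space Int_commute)
qed

lemma pac_null:
  assumes "c \<in> M" "B \<in> sets borel" "B \<subseteq> fst c"
  shows "B \<in> null_sets \<mu> \<longleftrightarrow> snd c ` B \<in> null_sets lborel"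
  using pac assms unfolding positive_absolutely_continuous_def by blast

lemma borel_chart_preimage_null:
  assumes "c \<in> M" "S \<in> null_sets lborel" shows "fst c \<inter> snd c -` S \<in> null_sets \<mu>"
proof -
  have S: "S \<in> sets borel" using assms(2) by auto
  have B: "fst c \<inter> snd c -` S \<in> sets borel" by (rule borel_chart_preimage[OF assms(1) S])
  have eq: "snd c ` (fst c \<inter> snd c -` S) = S \<inter> chart_image c" by (auto simp: chart_image_def)
  have "S \<inter> chart_image c \<in> null_sets lborel"
    using assms(2) image_open[OF assms(1)] by (intro null_set_Int2) auto
  then show ?thesis using pac_null[OF assms(1) B] by (simp add: eq)
qed

text \<open>Absolute continuity is given for Borel sets. On both sides the null sets of the
  completion are the subsets of Borel null sets, so enclosing \<open>Z\<close> in such a set extends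
  it to arbitrary sets.\<close>

lemma null_transfer:
  assumes c: "c \<in> M" and Z: "Z \<subseteq> fst c"
  shows "negligible (snd c ` Z) \<longleftrightarrow> Z \<in> null_sets (completion \<mu>)"
proof
  assume "negligible (snd c ` Z)"
  then obtain S where S: "S \<in> null_sets lborel" "snd c ` Z \<subseteq> S"
    by (auto simp: negligible_iff_null_sets null_sets_completion_iff2)
  then have "Z \<subseteq> fst c \<inter> snd c -` S" using Z by auto
  then show "Z \<in> null_sets (completion \<mu>)"
    unfolding null_sets_completion_iff2 using borel_chart_preimage_null[OF c S(1)] by blast
next
  assume "Z \<in> null_sets (completion \<mu>)"
  then obtain S where S: "S \<in> null_sets \<mu>" "Z \<subseteq> S" unfolding null_sets_completion_iff2 by blast
  have "fst c \<in> sets \<mu>" using chart_open[OF c] sets_mu by simp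
  then have S': "S \<inter> fst c \<in> null_sets \<mu>" using S(1) by (intro null_set_Int2)
  then have "S \<inter> fst c \<in> sets borel" using sets_mu by auto
  then have "snd c ` (S \<inter> fst c) \<in> null_sets lborel" using pac_null[OF c, of "S \<inter> fst c"] S' by simp
  moreover have "snd c ` Z \<subseteq> snd c ` (S \<inter> fst c)" using S(2) Z by blast
  ultimately show "negligible (snd c ` Z)"
    unfolding negligible_iff_null_sets null_sets_completion_iff2 by blast
qed

text \<open>In a chart a Lebesgue set is a Borel set together with part of a null set, and both
  pieces pull back to sets of the same kind for \<open>\<mu>\<close>.\<close>

lemma lebesgue_sets_completion:
  assumes B: "B \<in> lebesgue_sets M" shows "B \<in> sets (completion \<mu>)"
proof -
  obtain cs where cs: "\<And>k::nat. cs k \<in> M" "(\<Union>k. fst (cs k)) = UNIV" using countable_atlas by blast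
  have "B \<inter> fst c \<in> sets (completion \<mu>)" if c: "c \<in> M" for c
  proof -
    obtain S N' N where A: "snd c ` (B \<inter> fst c) = S \<union> N'" "N' \<subseteq> N" "N \<in> null_sets lborel" "S \<in> sets lborel"
      using sets_completionE[OF lebesgue_sets_image[OF B c]] by blast
    have "B \<inter> fst c = (fst c \<inter> snd c -` S) \<union> (fst c \<inter> snd c -` N')"
    proof -
      have "B \<inter> fst c = fst c \<inter> snd c -` (snd c ` (B \<inter> fst c))"
        using inj_onD[OF chart_inj[OF c]] by auto
      then show ?thesis unfolding A(1) by auto
    qed
    moreover have "fst c \<inter> snd c -` S \<in> sets \<mu>" using borel_chart_preimage[OF c] A(4) sets_mu by simp
    ultimately show ?thesis
      using borel_chart_preimage_null[OF c A(3)] A(2) by (intro sets_completionI) auto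
  qed
  then have "(\<Union>k. B \<inter> fst (cs k)) \<in> sets (completion \<mu>)" using cs(1) by (intro sets.countable_UN) blast
  also have "(\<Union>k. B \<inter> fst (cs k)) = B" using cs(2) by auto
  finally show ?thesis .
qed

lemma AE_completion_iff_almost_everywhere:
  "(AE x in completion \<mu>. P x) \<longleftrightarrow> almost_everywhere M P"
proof -
  have ae: "(AE x in completion \<mu>. P x) \<longleftrightarrow> {x. \<not> P x} \<in> null_sets (completion \<mu>)"
    using completion.AE_iff_null_sets[of P \<mu>] by (simp add: space_mu)
  show ?thesis
  proof
    assume "AE x in completion \<mu>. P x"
    then have "{x. \<not> P x} \<in> null_sets (completion \<mu>)" by (simp add: ae)
    then have Z: "{x. \<not> P x} \<inter> fst c \<in> null_sets (completion \<mu>)" for c :: "('a, 'm) chart"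
      by (rule completion.complete2[OF Int_lower1])
    show "almost_everywhere M P"
      unfolding almost_everywhere_def
    proof
      fix c assume "c \<in> M"
      from null_transfer[OF this Int_lower2] Z[of c] show "negligible (snd c ` ({x. \<not> P x} \<inter> fst c))" by blast
    qed
  next
    assume l: "almost_everywhere M P"
    obtain cs where cs: "\<And>k::nat. cs k \<in> M" "(\<Union>k. fst (cs k)) = UNIV" using countable_atlas by blast
    have "{x. \<not> P x} \<inter> fst (cs k) \<in> null_sets (completion \<mu>)" for k
    proof -
      have "negligible (snd (cs k) ` ({x. \<not> P x} \<inter> fst (cs k)))"
        using l cs(1)[of k] unfolding almost_everywhere_def by blast
      then show ?thesis using null_transfer[OF cs(1)[of k] Int_lower2] by blast
    qed
    then have "(\<Union>k. {x. \<not> P x} \<inter> fst (cs k)) \<in> null_sets (completion \<mu>)" by (intro null_sets_UN)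
    also have "(\<Union>k. {x. \<not> P x} \<inter> fst (cs k)) = {x. \<not> P x}" using cs(2) by auto
    finally show "AE x in completion \<mu>. P x" by (simp add: ae)
  qed
qed

lemma measurable_map_completion:
  assumes "measurable_map M euclidean u" shows "u \<in> borel_measurable (completion \<mu>)"
  using assms by (intro borel_measurableI) (auto simp: measurable_map_def space_mu lebesgue_sets_completion)

text \<open>Mutual absolute continuity gives no inequality between the measures. But along
  subsequences the indicators tend to 0 almost everywhere, which depends on null sets only, and
  finiteness of \<open>\<mu>\<close> turns this back into convergence of measures.\<close>

lemma emeasure_tendsto_zero_transfer:
  assumes c: "c \<in> M" and A: "\<And>l. A l \<in> lebesgue_sets M" "\<And>l. A l \<subseteq> fst c"
    and lim: "(\<lambda>l. emeasure lebesgue (snd c ` A l)) \<longlonglongrightarrow> 0"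
  shows "(\<lambda>l. emeasure (completion \<mu>) (A l)) \<longlonglongrightarrow> 0"
proof (rule tendsto_if_subsequences)
  fix r :: "nat \<Rightarrow> nat" assume r: "strict_mono r"
  have S: "snd c ` A l \<in> sets lebesgue" for l by (rule lebesgue_sets_image_sub[OF A(1) c A(2)])
  obtain r' where r': "strict_mono r'"
    "AE y in lebesgue. \<forall>i::nat. (\<lambda>n. indicator (snd c ` A (r (r' n))) y :: real) \<longlonglongrightarrow> 0"
  proof (rule countable_AE_subsequence[of "\<lambda>i n. indicator (snd c ` A (r n))" lebesgue])
    have "(\<lambda>n. emeasure lebesgue (snd c ` A (r n))) \<longlonglongrightarrow> 0"
      using LIMSEQ_subseq_LIMSEQ[OF lim r] by (simp add: o_def)
    then show "(\<lambda>n. \<integral>\<^sup>+y. ennreal (indicator (snd c ` A (r n)) y) \<partial>lebesgue) \<longlonglongrightarrow> 0" for i :: nat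
      using S by (simp add: ennreal_indicator)
  qed (use S in auto)
  let ?Z = "{x. \<not> eventually (\<lambda>n. x \<notin> A (r (r' n))) sequentially}"
  have "AE y in lebesgue. eventually (\<lambda>n. y \<notin> snd c ` A (r (r' n))) sequentially"
    using r'(2)
  proof eventually_elim
    case (elim y)
    then have "eventually (\<lambda>n. indicator (snd c ` A (r (r' n))) y < (1 :: real)) sequentially"
      by (intro order_tendstoD(2)) auto
    then show ?case by eventually_elim (auto simp: indicator_def split: if_splits)
  qed
  then have N: "{y. \<not> eventually (\<lambda>n. y \<notin> snd c ` A (r (r' n))) sequentially} \<in> null_sets lebesgue"
    using completion.AE_iff_null_sets[of "\<lambda>y. eventually (\<lambda>n. y \<notin> snd c ` A (r
        (r' n))) sequentially" lborel] by simp
  have Zsub: "?Z \<subseteq> fst c"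
  proof
    fix x assume "x \<in> ?Z"
    then obtain n where "x \<in> A (r (r' n))" by (auto simp: eventually_sequentially)
    then show "x \<in> fst c" using A(2) by blast
  qed
  have "snd c ` ?Z \<subseteq> {y. \<not> eventually (\<lambda>n. y \<notin> snd c ` A (r (r' n))) sequentially}"
  proof safe
    fix x assume x: "\<not> eventually (\<lambda>n. x \<notin> A (r (r' n))) sequentially"
      "eventually (\<lambda>n. snd c x \<notin> snd c ` A (r (r' n))) sequentially"
    from x(2) have "eventually (\<lambda>n. x \<notin> A (r (r' n))) sequentially" by eventually_elim blast
    then show False using x(1) by blast
  qed
  then have "negligible (snd c ` ?Z)" unfolding negligible_iff_null_sets
      by (rule completion.complete2[OF _ N])
  then have "?Z \<in> null_sets (completion \<mu>)" using null_transfer[OF c Zsub] by blast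
  from AE_not_in[OF this] have "AE x in completion \<mu>. eventually (\<lambda>n. x \<notin> A (r (r' n))) sequentially"
    by simp
  then have "(\<lambda>n. emeasure (completion \<mu>) (A (r (r' n)))) \<longlonglongrightarrow> 0"
    by (intro emeasure_tendsto_zero[where B=UNIV])
       (use A lebesgue_sets_completion finite_measure.emeasure_finite[OF fin_completion, of UNIV]
           sets.top[of "completion \<mu>"]
        in \<open>auto simp: space_mu less_top\<close>)
  then show "\<exists>r'. strict_mono r' \<and> (\<lambda>n. emeasure (completion \<mu>) (A (r (r' n)))) \<longlonglongrightarrow> 0" using r'(1) by blast
qed

text \<open>Test convergence on a countable basis of the target. For each pair of a basic set and a
  chart, the set where \<open>u\<close> is in the basic set but \<open>us l\<close> is not becomes
  small; along a diagonal subsequence almost every point eventually leaves all of these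
  sets.\<close>

lemma AE_subsequence_of_local_measure_convergence:
  fixes us :: "nat \<Rightarrow> 'a \<Rightarrow> 'b::second_countable_topology"
  assumes u: "measurable_map M euclidean u" "\<And>l. measurable_map M euclidean (us l)"
    and conv: "converges_locally_in_measure M euclidean us u"
    and r: "strict_mono r"
  obtains r' :: "nat \<Rightarrow> nat" where "strict_mono r'" "AE x in completion \<mu>. (\<lambda>n. us (r (r' n)) x) \<longlonglongrightarrow> u x"
proof -
  \<comment> \<open>Convergence is granted in one chart around each point and not in every chart, so
    the countable cover must be taken from these.\<close>
  define good where "good c \<longleftrightarrow> c \<in> M \<and> (\<forall>U. open U \<longrightarrow>
     (\<lambda>l. emeasure lebesgue (snd c ` ((u -` U \<inter> fst c) - us l -` U))) \<longlonglongrightarrow> 0)" for c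
  have ex: "\<exists>c. good c \<and> x \<in> fst c" for x
  proof -
    obtain c where "c \<in> M" "x \<in> fst c" "\<forall>U. openin euclidean U \<longrightarrow>
     (\<lambda>l. emeasure lebesgue (snd c ` ((u -` U \<inter> fst c) - us l -` U))) \<longlonglongrightarrow> 0"
      using conv unfolding converges_locally_in_measure_def by blast
    then have "good c \<and> x \<in> fst c" by (simp add: good_def)
    then show ?thesis ..
  qed
  have op: "open S" if "S \<in> fst ` Collect good" for S
    using that chart_open unfolding good_def by blast
  obtain F where F: "F \<subseteq> fst ` Collect good" "countable F" "\<Union>F = \<Union>(fst ` Collect good)"
    using Lindelof[of "fst ` Collect good"] op by blast
  then obtain C where C: "countable C" "C \<subseteq> Collect good" "F = fst ` C"
    using countable_subset_image[of F fst "Collect good"] by metis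
  have CU: "\<exists>c\<in>C. x \<in> fst c" for x using ex[of x] F(3) C(3) by blast
  then have "C \<noteq> {}" by blast
  then have rC: "range (from_nat_into C) = C" using C(1) by (rule range_from_nat_into)
  obtain \<B> :: "'b set set" where \<B>: "countable \<B>" "topological_basis \<B>" using ex_countable_basis by blast
  have "\<B> \<noteq> {}"
  proof
    assume "\<B> = {}"
    then show False using topological_basisE[OF \<B>(2) open_UNIV UNIV_I] by blast
  qed
  then have rB: "range (from_nat_into \<B>) = \<B>" using \<B>(1) by (rule range_from_nat_into)
  let ?U = "\<lambda>i. from_nat_into \<B> (fst (prod_decode i))" and ?c = "\<lambda>i. from_nat_into C (snd (prod_decode i))"
  define A where "A i l = (u -` ?U i \<inter> fst (?c i)) - us l -` ?U i" for i l
  have c: "good (?c i)" for i using C(2) rC by blast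
  have U: "open (?U i)" for i using topological_basis_open[OF \<B>(2)] rB by blast
  have AL: "A i l \<in> lebesgue_sets M" for i l
    unfolding A_def using u U[of i] c[of i] open_lebesgue_sets[OF chart_open]
    by (intro leb.Diff leb.Int) (auto simp: measurable_map_def good_def)
  have "(\<lambda>l. emeasure (completion \<mu>) (A i l)) \<longlonglongrightarrow> 0" for i
  proof (rule emeasure_tendsto_zero_transfer[of "?c i"])
    show "?c i \<in> M" using c by (simp add: good_def)
    show "(\<lambda>l. emeasure lebesgue (snd (?c i) ` A i l)) \<longlonglongrightarrow> 0" using c[of i] U[of i]
        by (simp add: A_def good_def)
  qed (use AL in \<open>auto simp: A_def\<close>)
  then have lim: "(\<lambda>l. emeasure (completion \<mu>) (A i (r l))) \<longlonglongrightarrow> 0" for i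
    using LIMSEQ_subseq_LIMSEQ[OF _ r] by (fastforce simp: o_def)
  obtain r' where r': "strict_mono r'"
    "AE x in completion \<mu>. \<forall>i. (\<lambda>n. indicator (A i (r (r' n))) x :: real) \<longlonglongrightarrow> 0"
  proof (rule countable_AE_subsequence[of "\<lambda>i n. indicator (A i (r n))" "completion \<mu>"])
    show "(\<lambda>n. \<integral>\<^sup>+y. ennreal (indicator (A i (r n)) y) \<partial>completion \<mu>) \<longlonglongrightarrow> 0" for i
      using lim[of i] lebesgue_sets_completion[OF AL] by (simp add: ennreal_indicator)
  qed (use lebesgue_sets_completion[OF AL] in auto)
  have "AE x in completion \<mu>. (\<lambda>n. us (r (r' n)) x) \<longlonglongrightarrow> u x"
    using r'(2)
  proof eventually_elim
    case (elim x)
    show ?case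
    proof (rule topological_tendstoI)
      fix S assume S: "open S" "u x \<in> S"
      obtain B where B: "B \<in> \<B>" "u x \<in> B" "B \<subseteq> S" using topological_basisE[OF \<B>(2) S] by blast
      obtain c where cc: "c \<in> C" "x \<in> fst c" using CU by blast
      obtain j k where "B = from_nat_into \<B> j" "c = from_nat_into C k" using B(1) cc(1) rB rC by blast
      then have i: "?U (prod_encode (j, k)) = B" "?c (prod_encode (j, k)) = c" by simp_all
      have "eventually (\<lambda>n. indicator (A (prod_encode (j, k)) (r (r' n))) x < (1 :: real)) sequentially"
        using elim by (intro order_tendstoD(2)) auto
      then show "eventually (\<lambda>n. us (r (r' n)) x \<in> S) sequentially"
      proof eventually_elim
        case (elim n)
        then have "x \<notin> A (prod_encode (j, k)) (r (r' n))" by (auto simp: indicator_def split: if_splits)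
        then show ?case using B cc unfolding A_def i by blast
      qed
    qed
  qed
  then show ?thesis using that r'(1) by blast
qed

text \<open>The integrand is at most 1 on a finite measure space, so its integral tends to 0 exactly
  if every subsequence has a further one along which it tends to 0 almost everywhere. This replaces
  the integral by a condition free of \<open>d\<close>.\<close>

lemma metric_integral_tendsto_iff_AE_subsequences:
  fixes us :: "nat \<Rightarrow> 'a \<Rightarrow> 'b::second_countable_topology"
  assumes u: "measurable_map M euclidean u" "\<And>l. measurable_map M euclidean (us l)"
    and d: "Metric_space UNIV d" "Metric_space.mtopology UNIV d = euclidean"
  shows "(\<lambda>l. \<integral>x. d (us l x) (u x) / (1 + d (us l x) (u x)) \<partial>completion \<mu>) \<longlonglongrightarrow> 0 \<longleftrightarrow>
    (\<forall>r :: nat \<Rightarrow> nat. strict_mono r \<longrightarrow>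
        (\<exists>r' :: nat \<Rightarrow> nat. strict_mono r' \<and> (AE x in completion \<mu>. (\<lambda>n. us (r (r' n)) x) \<longlonglongrightarrow> u x)))"
proof -
  interpret Metric_space UNIV d by fact
  interpret fm: finite_measure "completion \<mu>" by (rule fin_completion)
  define f where "f l x = d (us l x) (u x) / (1 + d (us l x) (u x))" for l x
  have f01: "0 \<le> f l x" "f l x \<le> 1" for l x
  proof -
    have pos: "0 < 1 + d (us l x) (u x)" using nonneg[of "us l x" "u x"] by linarith
    show "0 \<le> f l x" using nonneg[of "us l x" "u x"] pos by (simp add: f_def)
    show "f l x \<le> 1" unfolding f_def divide_le_eq_1_pos[OF pos] by simp
  qed
  have dm: "(\<lambda>x. d (us l x) (u x)) \<in> borel_measurable (completion \<mu>)" for l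
    by (rule borel_measurable_continuous_Pair[OF measurable_map_completion[OF u(2)]
        measurable_map_completion[OF u(1)] metric_continuous[OF d]])
  then have fm: "f l \<in> borel_measurable (completion \<mu>)" for l unfolding f_def by measurable
  have fi: "integrable (completion \<mu>) (f l)" for l
    by (rule fm.integrable_const_bound[where B=1]) (use f01 fm in auto)
  have fd: "(\<lambda>n. f (s n) x) \<longlonglongrightarrow> 0 \<longleftrightarrow> (\<lambda>n. us (s n) x) \<longlonglongrightarrow> u x" for s :: "nat \<Rightarrow> nat" and x
  proof -
    \<comment> \<open>The inverse of the map sending t to t / (1 + t); it is continuous at 0, so a
      small quotient means a small distance.\<close>
    have inv: "d (us l x) (u x) = f l x / (1 - f l x)" for l
    proof -
      have "0 < 1 + d (us l x) (u x)" using nonneg[of "us l x" "u x"] by linarith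
      then show ?thesis by (simp add: f_def field_simps)
    qed
    show ?thesis
    proof
      assume "(\<lambda>n. f (s n) x) \<longlonglongrightarrow> 0"
      then have "(\<lambda>n. f (s n) x / (1 - f (s n) x)) \<longlonglongrightarrow> 0 / (1 - 0)" by (intro tendsto_intros) auto
      then show "(\<lambda>n. us (s n) x) \<longlonglongrightarrow> u x" unfolding metric_tendsto_iff[OF d] by (simp add: inv)
    next
      assume "(\<lambda>n. us (s n) x) \<longlonglongrightarrow> u x"
      then have "(\<lambda>n. d (us (s n) x) (u x)) \<longlonglongrightarrow> 0" unfolding metric_tendsto_iff[OF d] .
      then have "(\<lambda>n. d (us (s n) x) (u x) / (1 + d (us (s n) x) (u x))) \<longlonglongrightarrow> 0 / (1 + 0)"
          by (intro tendsto_intros) auto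
      then show "(\<lambda>n. f (s n) x) \<longlonglongrightarrow> 0" by (simp add: f_def)
    qed
  qed
  have nn: "(\<integral>\<^sup>+x. ennreal (f l x) \<partial>completion \<mu>) = ennreal (\<integral>x. f l x \<partial>completion \<mu>)" for l
    by (rule nn_integral_eq_integral[OF fi]) (use f01 in auto)
  show ?thesis
    unfolding f_def[symmetric]
  proof (intro iffI allI impI)
    assume lim: "(\<lambda>l. \<integral>x. f l x \<partial>completion \<mu>) \<longlonglongrightarrow> 0"
    fix r :: "nat \<Rightarrow> nat" assume r: "strict_mono r"
    have "(\<lambda>n. \<integral>x. f (r n) x \<partial>completion \<mu>) \<longlonglongrightarrow> 0"
      using LIMSEQ_subseq_LIMSEQ[OF lim r] by (simp add: o_def)
    then have l2: "(\<lambda>n. \<integral>\<^sup>+x. ennreal (f (r n) x) \<partial>completion \<mu>) \<longlonglongrightarrow> 0"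
      unfolding nn using tendsto_ennrealI by fastforce
    obtain r' where r': "strict_mono r'" "AE x in completion \<mu>. \<forall>i::nat. (\<lambda>n. f (r (r' n)) x) \<longlonglongrightarrow> 0"
      by (rule countable_AE_subsequence[of "\<lambda>i n. f (r n)" "completion \<mu>"]) (use fm f01 l2 in auto)
    then show "\<exists>r'. strict_mono r' \<and> (AE x in completion \<mu>. (\<lambda>n. us (r (r' n)) x) \<longlonglongrightarrow> u x)"
      using fd[of "\<lambda>n. r (r' n)"] by auto
  next
    assume sub: "\<forall>r :: nat \<Rightarrow> nat. strict_mono r \<longrightarrow>
        (\<exists>r' :: nat \<Rightarrow> nat. strict_mono r' \<and> (AE x in completion \<mu>. (\<lambda>n. us (r (r' n)) x) \<longlonglongrightarrow> u x))"
    show "(\<lambda>l. \<integral>x. f l x \<partial>completion \<mu>) \<longlonglongrightarrow> 0"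
    proof (rule tendsto_if_subsequences)
      fix r :: "nat \<Rightarrow> nat" assume "strict_mono r"
      then obtain r' where r': "strict_mono r'" "AE x in completion \<mu>. (\<lambda>n. us (r (r' n)) x) \<longlonglongrightarrow> u x"
          using sub by blast
      have "(\<lambda>n. \<integral>x. f (r (r' n)) x \<partial>completion \<mu>) \<longlonglongrightarrow> (\<integral>x. 0 \<partial>completion \<mu>)"
        by (rule integral_dominated_convergence[where w="\<lambda>_. 1"])
           (use r'(2) fd[of "\<lambda>n. r (r' n)"] fm f01 in auto)
      then show "\<exists>r'. strict_mono r' \<and> (\<lambda>n. \<integral>x. f (r (r' n)) x \<partial>completion \<mu>) \<longlonglongrightarrow> 0" using r'(1) by auto
    qed
  qed
qed

end

section \<open>Integration in charts\<close>

context riemannian_atlas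
begin

lemma chart_inv_measurable:
  assumes c: "c \<in> M" shows "chart_inv c \<in> lebesgue_on (chart_image c) \<rightarrow>\<^sub>M riemannian_measure M g"
proof (rule measurableI)
  fix B assume "B \<in> sets (riemannian_measure M g)"
  then have "chart_image c \<inter> chart_inv c -` B \<in> sets lebesgue"
    using c by (simp add: riemannian_measure lebesgue_sets_iff)
  then show "chart_inv c -` B \<inter> space (lebesgue_on (chart_image c)) \<in> sets (lebesgue_on (chart_image c))"
    using image_open[OF c] by (simp add: sets_restrict_space_iff Int_commute)
qed (simp add: riemannian_measure)

text \<open>The measure with density \<open>vol c\<close>, pushed forward by
  \<open>chart_inv c\<close>, is the Riemannian measure restricted to the chart domain. This is
  compared on sets; the integral formula follows.\<close>

lemma nn_integral_chart:
  assumes c: "c \<in> M" and f: "f \<in> borel_measurable (riemannian_measure M g)"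
  shows "(\<integral>\<^sup>+x. indicator (fst c) x * f x \<partial>riemannian_measure M g) =
         (\<integral>\<^sup>+y. ennreal (vol c y) * f (chart_inv c y) \<partial>lebesgue_on (chart_image c))"
proof -
  let ?\<nu> = "riemannian_measure M g" and ?L = "lebesgue_on (chart_image c)"
  have fc: "fst c \<in> sets ?\<nu>" using open_lebesgue_sets[OF chart_open[OF c]] by (simp add: riemannian_measure)
  have im: "chart_image c \<in> sets lebesgue" using image_open[OF c] by simp
  have vm: "vol c \<in> borel_measurable ?L"
    by (rule continuous_imp_measurable_on_sets_lebesgue[OF vol_cont[OF c] im])
  then have vm': "(\<lambda>y. ennreal (vol c y)) \<in> borel_measurable ?L" by simp
  have km: "chart_inv c \<in> density ?L (\<lambda>y. ennreal (vol c y)) \<rightarrow>\<^sub>M ?\<nu>"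
    using chart_inv_measurable[OF c] by simp
  have eq: "distr (density ?L (\<lambda>y. ennreal (vol c y))) ?\<nu> (chart_inv c) = density ?\<nu> (indicator (fst c))"
  proof (rule measure_eqI)
    fix A assume "A \<in> sets (distr (density ?L (\<lambda>y. ennreal (vol c y))) ?\<nu> (chart_inv c))"
    then have A: "A \<in> sets ?\<nu>" by simp
    then have AL: "A \<in> lebesgue_sets M" by (simp add: riemannian_measure)
    have S: "chart_inv c -` A \<inter> chart_image c \<in> sets ?L"
      using measurable_sets[OF chart_inv_measurable[OF c] A] by (simp add: space_restrict_space)
    have "emeasure (distr (density ?L (\<lambda>y. ennreal (vol c y))) ?\<nu> (chart_inv c)) A
      = emeasure (density ?L (\<lambda>y. ennreal (vol c y))) (chart_inv c -` A \<inter> chart_image c)"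
      using emeasure_distr[OF km A] by (simp add: space_restrict_space)
    also have "\<dots> = (\<integral>\<^sup>+y. ennreal (vol c y) * indicator (chart_inv c -` A \<inter> chart_image c) y \<partial>?L)"
      by (rule emeasure_density[OF vm' S])
    also have "\<dots> = (\<integral>\<^sup>+y. ennreal (vol c y) * indicator (chart_inv c -` A \<inter> chart_image c) y * indicator
        (chart_image c) y \<partial>lebesgue)"
      by (rule nn_integral_restrict_space) (use im in simp)
    also have "\<dots> = chart_vol c (A \<inter> fst c)"
      unfolding chart_vol_def image_Int[OF c]
      by (intro nn_integral_cong) (auto simp: indicator_def)
    also have "\<dots> = emeasure ?\<nu> (A \<inter> fst c)"
      by (rule riemannian_measure(3)[OF c, symmetric])
          (use AL open_lebesgue_sets[OF chart_open[OF c]] in auto)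
    also have "\<dots> = (\<integral>\<^sup>+x. indicator (A \<inter> fst c) x \<partial>?\<nu>)"
      using A fc by (intro nn_integral_indicator[symmetric]) auto
    also have "\<dots> = (\<integral>\<^sup>+x. indicator (fst c) x * indicator A x \<partial>?\<nu>)"
      by (rule nn_integral_cong) (auto simp: indicator_def)
    also have "\<dots> = emeasure (density ?\<nu> (indicator (fst c))) A"
      by (rule emeasure_density[symmetric]) (use A fc in auto)
    finally show "emeasure (distr (density ?L (\<lambda>y. ennreal (vol c y))) ?\<nu> (chart_inv c)) A
        = emeasure (density ?\<nu> (indicator (fst c))) A" .
  qed simp
  have "(\<integral>\<^sup>+x. indicator (fst c) x * f x \<partial>?\<nu>) = (\<integral>\<^sup>+x. f x \<partial>density ?\<nu> (indicator (fst c)))"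
    by (rule nn_integral_density[symmetric]) (use f fc in auto)
  also have "\<dots> = (\<integral>\<^sup>+y. f (chart_inv c y) \<partial>density ?L (\<lambda>y. ennreal (vol c y)))"
    unfolding eq[symmetric] by (rule nn_integral_distr[OF km]) (use f in simp)
  also have "\<dots> = (\<integral>\<^sup>+y. ennreal (vol c y) * f (chart_inv c y) \<partial>?L)"
    by (rule nn_integral_density[OF vm']) (rule measurable_compose[OF chart_inv_measurable[OF c] f])
  finally show ?thesis .
qed

lemma almost_everywhere_coord:
  assumes "almost_everywhere M P" "c \<in> M"
  shows "AE y in lebesgue. y \<in> chart_image c \<longrightarrow> P (chart_inv c y)"
proof -
  have "negligible (snd c ` ({x. \<not> P x} \<inter> fst c))" using assms by (simp add: almost_everywhere_def)
  then have "snd c ` ({x. \<not> P x} \<inter> fst c) \<in> null_sets lebesgue" by (simp add: negligible_iff_null_sets)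
  from AE_not_in[OF this] show ?thesis unfolding image_Int[OF assms(2)] by eventually_elim auto
qed

text \<open>The indicator is there because \<open>chart_inv c\<close> is arbitrary outside the chart
  image.\<close>

lemma coord_measurable:
  fixes f :: "'a \<Rightarrow> real"
  assumes c: "c \<in> M" and f: "f \<in> borel_measurable (riemannian_measure M g)"
      and S: "S \<in> sets lebesgue" "S \<subseteq> chart_image c"
  shows "(\<lambda>y. indicator S y * f (chart_inv c y)) \<in> borel_measurable lebesgue"
proof -
  have im: "chart_image c \<inter> space lebesgue \<in> sets lebesgue" using image_open[OF c] by simp
  have "(\<lambda>y. f (chart_inv c y)) \<in> borel_measurable (lebesgue_on (chart_image c))"
    by (rule measurable_compose[OF chart_inv_measurable[OF c] f])
  then have "(\<lambda>y. indicator (chart_image c) y *\<^sub>R f (chart_inv c y)) \<in> borel_measurable lebesgue"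
    by (rule borel_measurable_restrict_space_iff[OF im, THEN iffD1])
  then have "(\<lambda>y. indicator S y * (indicator (chart_image c) y *\<^sub>R f (chart_inv c y)))
      \<in> borel_measurable lebesgue"
    using S(1) by (intro borel_measurable_times) auto
  also have "(\<lambda>y. indicator S y * (indicator (chart_image c) y *\<^sub>R f (chart_inv c y)))
      = (\<lambda>y. indicator S y * f (chart_inv c y))"
    using S(2) by (auto simp: fun_eq_iff indicator_def)
  finally show ?thesis .
qed

text \<open>On the compact ball \<open>vol c\<close> has a positive minimum \<open>m\<close>, so
  Lebesgue integrals there are at most 1/m times Riemannian ones. The elementary inequality
  \<open>key\<close>, in the role of Hoelder's, then passes from p-th powers to first
  powers.\<close>

lemma Lp_imp_L1_coord:
  assumes c: "c \<in> M" and K: "cball a R \<subseteq> chart_image c" "0 < R" and p: "1 \<le> p"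
    and h: "in_Lp (riemannian_measure M g) p h" "\<And>l. in_Lp (riemannian_measure M g) p (hs l)"
    and lim: "(\<lambda>l. (\<integral>x. \<bar>hs l x - h x\<bar> powr p \<partial>riemannian_measure M g) powr (1 / p)) \<longlonglongrightarrow> 0"
  shows "\<And>l. integrable lebesgue (\<lambda>y. indicator (cball a R) y * hs l (chart_inv c y))"
    and "integrable lebesgue (\<lambda>y. indicator (cball a R) y * h (chart_inv c y))"
    and "(\<lambda>l. \<integral>y. \<bar>indicator (cball a R) y * hs l (chart_inv c y)
        - indicator (cball a R) y * h (chart_inv c y)\<bar> \<partial>lebesgue) \<longlonglongrightarrow> 0"
proof -
  let ?\<nu> = "riemannian_measure M g" and ?B = "cball a R"
  have "?B \<noteq> {}" using K by simp
  with continuous_attains_inf[OF compact_cball this continuous_on_subset[OF vol_cont[OF c] K(1)]]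
  obtain y0 where y0: "y0 \<in> ?B" "\<And>y. y \<in> ?B \<Longrightarrow> vol c y0 \<le> vol c y" by blast
  define m where "m = vol c y0"
  have m: "0 < m" using vol_pos[OF c] y0(1) K(1) by (auto simp: m_def)
  have Bs: "?B \<in> sets lebesgue" by simp
  have le: "(\<integral>\<^sup>+y. indicator ?B y * f (chart_inv c y) \<partial>lebesgue) \<le> ennreal (1 / m) * (\<integral>\<^sup>+x. f x \<partial>?\<nu>)"
    if f: "f \<in> borel_measurable ?\<nu>" for f :: "'a \<Rightarrow> ennreal"
  proof -
    have im: "chart_image c \<inter> space lebesgue \<in> sets lebesgue" using image_open[OF c] by simp
    have "(\<integral>\<^sup>+y. indicator ?B y * f (chart_inv c y) \<partial>lebesgue)
      \<le> (\<integral>\<^sup>+y. ennreal (1 / m) * (ennreal (vol c y) * f (chart_inv c y)) * indicator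
          (chart_image c) y \<partial>lebesgue)"
    proof (rule nn_integral_mono)
      fix y
      show "indicator ?B y * f (chart_inv c y)
          \<le> ennreal (1 / m) * (ennreal (vol c y) * f (chart_inv c y)) * indicator (chart_image c) y"
      proof (cases "y \<in> ?B")
        case True
        then have "1 \<le> ennreal (1 / m) * ennreal (vol c y)"
        proof -
          have "1 \<le> 1 / m * vol c y" using y0(2)[OF True] m by (simp add: m_def[symmetric])
          then have "ennreal 1 \<le> ennreal (1 / m * vol c y)" by (rule ennreal_leI)
          also have "\<dots> = ennreal (1 / m) * ennreal (vol c y)" using m
              by (intro ennreal_mult'') (use y0(2)[OF True] in \<open>simp add: m_def\<close>)
          finally show ?thesis by simp
        qed
        then have "1 * f (chart_inv c y) \<le> ennreal (1 / m) * ennreal (vol c y) * f (chart_inv c y)"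
            by (rule mult_right_mono) simp
        then show ?thesis using True K(1) by (auto simp: mult.assoc)
      qed simp
    qed
    also have "\<dots> = (\<integral>\<^sup>+y. ennreal (1 / m) * (ennreal (vol c y) * f (chart_inv c y)) \<partial>lebesgue_on
        (chart_image c))"
      by (rule nn_integral_restrict_space[OF im, symmetric])
    also have "\<dots> = ennreal (1 / m) * (\<integral>\<^sup>+x. indicator (fst c) x * f x \<partial>?\<nu>)"
    proof -
      have "vol c \<in> borel_measurable (lebesgue_on (chart_image c))"
        by (rule continuous_imp_measurable_on_sets_lebesgue[OF vol_cont[OF c]]) (use im in simp)
      then show ?thesis
        unfolding nn_integral_chart[OF c f]
        by (intro nn_integral_cmult borel_measurable_times_ennreal measurable_compose[OF
            chart_inv_measurable[OF c] f]) simp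
    qed
    also have "\<dots> \<le> ennreal (1 / m) * (\<integral>\<^sup>+x. f x \<partial>?\<nu>)"
      by (intro mult_left_mono nn_integral_mono) (auto simp: indicator_def)
    finally show ?thesis .
  qed
  have hm: "h \<in> borel_measurable ?\<nu>" "hs l \<in> borel_measurable ?\<nu>" for l using h by (auto simp: in_Lp_def)
  \<comment> \<open>If t > \<epsilon>, then t = t^(1-p) t^p, and the first factor is at most
    \<epsilon>^(1-p) since 1 - p \<le> 0. The case p = 1 is included without a conjugate
    exponent.\<close>
  have key: "t \<le> \<epsilon> + \<epsilon> powr (1 - p) * t powr p" if "0 < \<epsilon>" "0 \<le> t" for t \<epsilon> :: real
  proof (cases "t \<le> \<epsilon>")
    case True
    have "0 \<le> \<epsilon> powr (1 - p) * t powr p" by simp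
    then show ?thesis using True by linarith
  next
    case False
    then have t: "\<epsilon> < t" "0 < t" using that by auto
    have "t = t powr (1 - p) * t powr p" using t by (simp add: powr_add[symmetric])
    also have "\<dots> \<le> \<epsilon> powr (1 - p) * t powr p"
      using t that p by (intro mult_right_mono powr_mono2') auto
    finally show ?thesis using that by linarith
  qed
  have bound: "(\<integral>\<^sup>+y. ennreal \<bar>indicator ?B y * f (chart_inv c y)\<bar> \<partial>lebesgue)
      \<le> ennreal \<epsilon> * emeasure lebesgue ?B + ennreal (\<epsilon> powr (1 - p) / m) * (\<integral>\<^sup>+x. ennreal (\<bar>f x\<bar> powr p) \<partial>?\<nu>)"
    if f: "f \<in> borel_measurable ?\<nu>" and \<epsilon>: "0 < \<epsilon>" for f :: "'a \<Rightarrow> real" and \<epsilon>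
  proof -
    let ?g = "\<lambda>x. ennreal (\<epsilon> powr (1 - p) * \<bar>f x\<bar> powr p)"
    have gm: "?g \<in> borel_measurable ?\<nu>" using f by measurable
    have gm': "(\<lambda>y. indicator ?B y * ?g (chart_inv c y)) \<in> borel_measurable lebesgue"
    proof -
      have "(\<lambda>y. indicator ?B y * (\<epsilon> powr (1 - p) * \<bar>f (chart_inv c y)\<bar> powr p)) \<in> borel_measurable lebesgue"
        by (rule coord_measurable[OF c _ Bs K(1), of "\<lambda>x. \<epsilon> powr (1
            - p) * \<bar>f x\<bar> powr p"]) (use f in measurable)
      then have "(\<lambda>y. ennreal (indicator ?B y * (\<epsilon> powr (1
          - p) * \<bar>f (chart_inv c y)\<bar> powr p))) \<in> borel_measurable lebesgue" by simp
      also have "(\<lambda>y. ennreal (indicator ?B y * (\<epsilon> powr (1 - p) * \<bar>f (chart_inv c y)\<bar> powr p)))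
          = (\<lambda>y. indicator ?B y * ?g (chart_inv c y))"
        by (auto simp: fun_eq_iff indicator_def)
      finally show ?thesis .
    qed
    have "(\<integral>\<^sup>+y. ennreal \<bar>indicator ?B y * f (chart_inv c y)\<bar> \<partial>lebesgue)
      \<le> (\<integral>\<^sup>+y. ennreal \<epsilon> * indicator ?B y + indicator ?B y * ?g (chart_inv c y) \<partial>lebesgue)"
    proof (rule nn_integral_mono)
      fix y
      have "\<bar>f (chart_inv c y)\<bar> \<le> \<epsilon> + \<epsilon> powr (1 - p) * \<bar>f (chart_inv c y)\<bar> powr p" by (rule key[OF \<epsilon>]) simp
      then have "ennreal \<bar>f (chart_inv c y)\<bar> \<le> ennreal (\<epsilon> + \<epsilon> powr (1 - p) * \<bar>f (chart_inv c y)\<bar> powr p)"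
          by (rule ennreal_leI)
      also have "\<dots> = ennreal \<epsilon> + ?g (chart_inv c y)" using \<epsilon> by (intro ennreal_plus) auto
      finally show "ennreal \<bar>indicator ?B y * f (chart_inv c y)\<bar>
          \<le> ennreal \<epsilon> * indicator ?B y + indicator ?B y * ?g (chart_inv c y)"
        by (auto simp: indicator_def)
    qed
    also have "\<dots> = ennreal \<epsilon> * emeasure lebesgue ?B + (\<integral>\<^sup>+y. indicator ?B y * ?g (chart_inv c y) \<partial>lebesgue)"
    proof -
      have cm: "(\<lambda>y. ennreal \<epsilon> * indicator ?B y) \<in> borel_measurable lebesgue"
        by (intro borel_measurable_times_ennreal borel_measurable_const borel_measurable_indicator Bs)
      show ?thesis by (simp add: nn_integral_add[OF cm gm'] nn_integral_cmult_indicator[OF Bs])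
    qed
    also have "(\<integral>\<^sup>+y. indicator ?B y * ?g (chart_inv c y) \<partial>lebesgue) \<le> ennreal (1 / m) * (\<integral>\<^sup>+x. ?g x \<partial>?\<nu>)"
        by (rule le[OF gm])
    also have "(\<integral>\<^sup>+x. ?g x \<partial>?\<nu>) = ennreal (\<epsilon> powr (1 - p)) * (\<integral>\<^sup>+x. ennreal (\<bar>f x\<bar> powr p) \<partial>?\<nu>)"
      using f by (subst nn_integral_cmult[symmetric]) (auto simp: ennreal_mult)
    also have "ennreal (1 / m) * (ennreal (\<epsilon> powr (1 - p)) * (\<integral>\<^sup>+x. ennreal (\<bar>f x\<bar> powr p) \<partial>?\<nu>))
       = ennreal (\<epsilon> powr (1 - p) / m) * (\<integral>\<^sup>+x. ennreal (\<bar>f x\<bar> powr p) \<partial>?\<nu>)"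
      using m by (simp add: mult.assoc[symmetric] ennreal_mult[symmetric])
    finally show ?thesis by (simp add: add_left_mono)
  qed
  have finB: "emeasure lebesgue ?B < \<infinity>" using emeasure_compact_finite[OF compact_cball, of a R] by simp
  have int: "integrable lebesgue (\<lambda>y. indicator ?B y * f (chart_inv c y))"
    if f: "f \<in> borel_measurable ?\<nu>" "integrable ?\<nu> (\<lambda>x. \<bar>f x\<bar> powr p)" for f
  proof (rule integrableI_bounded[OF coord_measurable[OF c f(1) Bs K(1)]])
    have "(\<integral>\<^sup>+x. ennreal (\<bar>f x\<bar> powr p) \<partial>?\<nu>) < \<infinity>"
      using f(2) by (simp add: integrable_iff_bounded)
    then show "(\<integral>\<^sup>+y. ennreal (norm (indicator ?B y * f (chart_inv c y))) \<partial>lebesgue) < \<infinity>"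
      unfolding real_norm_def
      by (intro le_less_trans[OF bound[OF f(1), of 1]]) (use finB in \<open>auto simp: ennreal_mult_less_top\<close>)
  qed
  show i1: "integrable lebesgue (\<lambda>y. indicator ?B y * hs l (chart_inv c y))" for l
    by (rule int) (use h(2)[of l] in \<open>auto simp: in_Lp_def\<close>)
  show i2: "integrable lebesgue (\<lambda>y. indicator ?B y * h (chart_inv c y))"
    by (rule int) (use h(1) in \<open>auto simp: in_Lp_def\<close>)
  have dm: "(\<lambda>x. hs l x - h x) \<in> borel_measurable ?\<nu>" for l using hm by measurable
  have di: "integrable ?\<nu> (\<lambda>x. \<bar>hs l x - h x\<bar> powr p)" for l
  proof (rule Bochner_Integration.integrable_bound[of _ "\<lambda>x. 2 powr p * (\<bar>hs l x\<bar> powr p + \<bar>h x\<bar> powr p)"])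
    show "integrable ?\<nu> (\<lambda>x. 2 powr p * (\<bar>hs l x\<bar> powr p + \<bar>h x\<bar> powr p))" using h by (auto simp: in_Lp_def)
    show "(\<lambda>x. \<bar>hs l x - h x\<bar> powr p) \<in> borel_measurable ?\<nu>" using hm by measurable
    show "AE x in ?\<nu>. norm (\<bar>hs l x - h x\<bar> powr p) \<le> norm (2 powr p * (\<bar>hs l x\<bar> powr p + \<bar>h x\<bar> powr p))"
    proof (rule AE_I2)
      fix x
      let ?M = "max \<bar>hs l x\<bar> \<bar>h x\<bar>"
      have "\<bar>hs l x - h x\<bar> powr p \<le> (2 * ?M) powr p" using p by (intro powr_mono2) auto
      also have "\<dots> = 2 powr p * ?M powr p" by (simp add: powr_mult)
      also have "?M powr p \<le> \<bar>hs l x\<bar> powr p + \<bar>h x\<bar> powr p" by (auto simp: max_def)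
      finally show "norm (\<bar>hs l x - h x\<bar> powr p) \<le> norm (2 powr p * (\<bar>hs l x\<bar> powr p + \<bar>h x\<bar> powr p))" by simp
    qed
  qed
  define J where "J l = (\<integral>x. \<bar>hs l x - h x\<bar> powr p \<partial>?\<nu>)" for l
  have J0: "0 \<le> J l" for l unfolding J_def by (rule integral_nonneg_AE) simp
  have Jlim: "J \<longlonglongrightarrow> 0"
  proof -
    have "(\<lambda>l. (J l powr (1 / p)) powr p) \<longlonglongrightarrow> 0 powr p"
      using lim p unfolding J_def[symmetric] by (intro tendsto_powr') auto
    moreover have "(J l powr (1 / p)) powr p = J l" for l using J0[of l] p by (simp add: powr_powr)
    ultimately show ?thesis using p by simp
  qed
  have nJ: "(\<integral>\<^sup>+x. ennreal (\<bar>hs l x - h x\<bar> powr p) \<partial>?\<nu>) = ennreal (J l)" for l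
    unfolding J_def by (rule nn_integral_eq_integral[OF di]) simp
  define b where "b = measure lebesgue ?B"
  have b: "emeasure lebesgue ?B = ennreal b" unfolding b_def using finB
      by (intro emeasure_eq_ennreal_measure) auto
  have b0: "0 \<le> b" by (simp add: b_def)
  define I where "I l = (\<integral>y. \<bar>indicator ?B y * hs l (chart_inv c y)
      - indicator ?B y * h (chart_inv c y)\<bar> \<partial>lebesgue)" for l
  have I0: "0 \<le> I l" for l unfolding I_def by (rule integral_nonneg_AE) simp
  have I: "I l \<le> \<epsilon> * b + \<epsilon> powr (1 - p) / m * J l" if "0 < \<epsilon>" for \<epsilon> l
  proof -
    have "ennreal (I l) = (\<integral>\<^sup>+y. ennreal \<bar>indicator ?B y * hs l (chart_inv c y)
        - indicator ?B y * h (chart_inv c y)\<bar> \<partial>lebesgue)"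
      unfolding I_def by (rule nn_integral_eq_integral[symmetric]) (use i1 i2 in auto)
    also have "\<dots> = (\<integral>\<^sup>+y. ennreal \<bar>indicator ?B y * (hs l (chart_inv c y) - h (chart_inv c y))\<bar> \<partial>lebesgue)"
      by (simp add: right_diff_distrib)
    also have "\<dots> \<le> ennreal \<epsilon> * ennreal b + ennreal (\<epsilon> powr (1 - p) / m) * ennreal (J l)"
      using bound[OF dm that] unfolding b nJ .
    also have "\<dots> = ennreal (\<epsilon> * b + \<epsilon> powr (1 - p) / m * J l)"
    proof -
      have e: "0 \<le> \<epsilon>" "0 \<le> \<epsilon> powr (1 - p) / m" using that m by simp_all
      then show ?thesis
        unfolding ennreal_mult[OF e(1) b0, symmetric] ennreal_mult[OF e(2) J0, symmetric]
        using b0 J0[of l] by (intro ennreal_plus[symmetric] mult_nonneg_nonneg)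
    qed
    finally show ?thesis using that b0 J0[of l] m by (subst (asm) ennreal_le_iff) auto
  qed
  have "I \<longlonglongrightarrow> 0"
  proof (rule order_tendstoI)
    fix x :: real assume "x < 0" then show "eventually (\<lambda>l. x < I l) sequentially" using I0 less_le_trans
        by (blast intro: always_eventually)
  next
    fix x :: real assume x: "0 < x"
    \<comment> \<open>Makes the first term in the bound \<open>I\<close> smaller than x / 2; with
      \<open>\<epsilon>\<close> fixed, the second tends to 0 with \<open>J\<close>.\<close>
    define \<epsilon> where "\<epsilon> = x / (2 * (b + 1))"
    have \<epsilon>: "0 < \<epsilon>" using x b0 by (simp add: \<epsilon>_def)
    have "\<epsilon> * b < \<epsilon> * (b + 1)" using \<epsilon> by simp
    also have "\<dots> = x / 2" using b0 by (simp add: \<epsilon>_def field_simps add_nonneg_eq_0_iff)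
    finally have eb: "\<epsilon> * b < x / 2" .
    have "(\<lambda>l. \<epsilon> powr (1 - p) / m * J l) \<longlonglongrightarrow> 0" by (rule tendsto_mult_right_zero[OF Jlim])
    then have "eventually (\<lambda>l. \<epsilon> powr (1 - p) / m * J l < x / 2) sequentially" using x
        by (intro order_tendstoD(2)) auto
    then show "eventually (\<lambda>l. I l < x) sequentially"
    proof eventually_elim
      case (elim l) then show ?case using I[OF \<epsilon>, of l] eb by linarith
    qed
  qed
  then show "(\<lambda>l. \<integral>y. \<bar>indicator ?B y * hs l (chart_inv c y)
      - indicator ?B y * h (chart_inv c y)\<bar> \<partial>lebesgue) \<longlonglongrightarrow> 0"
    by (simp add: I_def[abs_def])
qed

text \<open>Cramer's rule writes each entry of the inverse as a quotient of determinants of matrices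
  with continuous entries.\<close>

lemma matrix_inv_gram_cont:
  assumes c: "c \<in> M"
  shows "continuous_on (chart_image c) (\<lambda>y. matrix_inv (gram c (chart_inv c y)) $ k $ l)"
proof -
  let ?G = "\<lambda>y. gram c (chart_inv c y)"
  let ?A = "\<lambda>y. (\<chi> i j. if j = k then axis l 1 $ i else ?G y $ i $ j)"
  have d0: "det (?G y) \<noteq> 0" if "y \<in> chart_image c" for y
    using gram_det_pos[OF c inv_into_dom[OF c that]] by simp
  have eq: "matrix_inv (?G y) $ k $ l = det (?A y) / det (?G y)" if y: "y \<in> chart_image c" for y
  proof -
    have "?G y ** matrix_inv (?G y) = mat 1"
    proof -
      obtain B where "?G y ** B = mat 1" "B ** ?G y = mat 1"
        using d0[OF y] invertible_det_nz[of "?G y"] by (auto simp: invertible_def)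
      then show ?thesis using matrix_left_inverse_unique by metis
    qed
    then have "?G y *v (matrix_inv (?G y) *v axis l 1) = axis l 1" by (simp add: matrix_vector_mul_assoc)
    then have "matrix_inv (?G y) *v axis l 1 = (\<chi> k. det (\<chi> i j. if j
        = k then axis l 1 $ i else ?G y $ i $ j) / det (?G y))"
      using cramer[OF d0[OF y]] by blast
    moreover have "(matrix_inv (?G y) *v axis l 1) $ k = matrix_inv (?G y) $ k $ l"
      by (simp add: matrix_vector_mul_component inner_axis)
    ultimately show ?thesis by simp
  qed
  have cont: "continuous_on (chart_image c) (\<lambda>y. ?G y $ i $ j)" for i j
      by (intro continuous_intros gram_coord_cont[OF c])
  have "continuous_on (chart_image c) (\<lambda>y. if j = k then axis l 1 $ i else ?G y $ i $ j)" for i j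
    using cont by (cases "j = k") auto
  then have "continuous_on (chart_image c) ?A" by (intro continuous_intros)
  then have "continuous_on (chart_image c) (\<lambda>y. det (?A y) / det (?G y))"
    using d0 by (intro continuous_on_divide continuous_on_det gram_coord_cont[OF c]) auto
  then show ?thesis using eq by (simp cong: continuous_on_cong)
qed

end

section \<open>Colocal weak derivatives in charts\<close>

lemma indicator_mult_measurable:
  fixes f :: "'v::euclidean_space \<Rightarrow> real"
  assumes "f \<in> borel_measurable (lebesgue_on T)" "T \<in> sets lebesgue" "P \<in> sets lebesgue" "P \<subseteq> T"
  shows "(\<lambda>y. indicator P y * f y) \<in> borel_measurable lebesgue"
proof -
  have T: "T \<inter> space lebesgue \<in> sets lebesgue" using assms(2) by simp
  have "(\<lambda>y. indicator T y *\<^sub>R f y) \<in> borel_measurable lebesgue"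
    by (rule borel_measurable_restrict_space_iff[OF T, THEN iffD1, OF assms(1)])
  then have "(\<lambda>y. indicator P y * (indicator T y *\<^sub>R f y)) \<in> borel_measurable lebesgue"
    using assms(3) by (intro borel_measurable_times) auto
  also have "(\<lambda>y. indicator P y * (indicator T y *\<^sub>R f y)) = (\<lambda>y. indicator P y * f y)"
    using assms(4) by (auto simp: fun_eq_iff indicator_def)
  finally show ?thesis .
qed

lemma hs_product_bound:
  fixes H :: "real ^ 'n::finite ^ 'n" and K :: "real ^ 'm::finite ^ 'm"
  assumes "\<And>p q. \<bar>H $ p $ q\<bar> \<le> \<alpha>" "\<And>k l. \<bar>K $ k $ l\<bar> \<le> \<beta>" "\<And>p k. \<bar>A $ p $ k\<bar> \<le> \<gamma>" "\<And>p k. \<bar>B $ p $ k\<bar> \<le> \<gamma>"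
  shows "\<bar>hs_product H K A B\<bar> \<le> (real CARD('n))\<^sup>2 * (real CARD('m))\<^sup>2 * (\<alpha> * \<beta> * \<gamma> * \<gamma>)"
proof -
  have nn: "0 \<le> \<alpha>" "0 \<le> \<beta>" "0 \<le> \<gamma>"
    using assms(1)[of undefined undefined] assms(2)[of undefined undefined] assms(3)[of undefined
        undefined] by linarith+
  have "\<bar>hs_product H K A B\<bar>
      \<le> (\<Sum>p\<in>(UNIV::'n set). \<Sum>q\<in>(UNIV::'n set). \<Sum>k\<in>(UNIV::'m set). \<Sum>l\<in>(UNIV::'m set). \<alpha> * \<beta> * \<gamma> * \<gamma>)"
    unfolding hs_product_def
    by (intro order_trans[OF sum_abs] sum_mono)
        (auto simp: abs_mult intro!: mult_mono assms nn mult_nonneg_nonneg)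
  also have "\<dots> = (real CARD('n))\<^sup>2 * (real CARD('m))\<^sup>2 * (\<alpha> * \<beta> * \<gamma> * \<gamma>)" by (simp add: power2_eq_square)
  finally show ?thesis .
qed

text \<open>The output of \<open>coordinate_functions\<close> as one predicate, so that countably
  many such systems can be selected later.\<close>

definition coord_functions ::
  "('b::topological_space, 'n::finite) chart set \<Rightarrow> ('b \<Rightarrow> real ^ 'n \<Rightarrow> real ^ 'n \<Rightarrow> real) \<Rightarrow> ('b, 'n) chart
    \<Rightarrow> 'b set \<Rightarrow> ('n \<Rightarrow> 'b \<Rightarrow> real) \<Rightarrow> real \<Rightarrow> bool" where
  "coord_functions N g e W f L \<longleftrightarrow> e \<in> N \<and> open W \<and> W \<subseteq> fst e \<and> 0 \<le> L \<and>
     (\<forall>i. f i \<in> C1c_functions N \<and> bounded (range (f i))) \<and>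
     (\<forall>i y v. \<bar>mdiff N (f i) y v\<bar> \<le> L * sqrt (g y v v)) \<and>
     (\<forall>i v. \<forall>y\<in>W. mdiff N (f i) y v = chart_diff N e y v $ i)"

text \<open>The differential, in the chart \<open>c\<close>, of the tuple of functions f p \<circ>
  v. Unlike \<open>coord_matrix\<close> it involves no chart of the target and makes sense wherever
  \<open>v\<close> takes its values; where \<open>v\<close> lies in \<open>W\<close> the two
  agree.\<close>

definition test_matrix ::
  "('a, 'm::finite) chart set \<Rightarrow> ('b, 'n::finite) chart set \<Rightarrow> ('a, 'm) chart \<Rightarrow> ('n \<Rightarrow> 'b \<Rightarrow> real)
    \<Rightarrow> ('a \<Rightarrow> 'b) \<Rightarrow> ('a \<Rightarrow> (real ^ 'm) \<Rightarrow>\<^sub>L (real ^ 'n)) \<Rightarrow> real ^ 'm \<Rightarrow> real ^ 'm ^ 'n" where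
  "test_matrix M N c f v D y = (\<chi> p j. mdiff N (f p) (v (chart_inv c y))
     (D (chart_inv c y) (inv (chart_diff M c (chart_inv c y)) (axis j 1))))"

context riemannian_pair
begin

text \<open>Transfers statements about norms of linear maps to arbitrary matrices, in particular to
  differences of matrices that come from different target points.\<close>

lemma coord_matrix_surj:
  assumes c: "c \<in> M" "x \<in> fst c" and e: "e \<in> N" "y \<in> fst e"
  shows "\<exists>\<xi>. coord_matrix M N c e x y \<xi> = A"
proof
  let ?f = "\<lambda>v. inv (chart_diff N e y) (A *v chart_diff M c x v)"
  have "linear ?f"
    using linear_compose[OF linear_compose[OF M.chart_diff_linear[OF c] matrix_vector_mul_linear[of A]]
        N.inv_chart_diff_linear[OF e]]
    by (simp add: o_def)
  then have "blinfun_apply (Blinfun ?f) = ?f"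
    by (simp add: bounded_linear_Blinfun_apply linear_conv_bounded_linear)
  then show "coord_matrix M N c e x y (Blinfun ?f) = A"
    using c e by (simp add: coord_matrix_def matrix_of_matrix_vector_mul)
qed

lemma hs_product_gram_nonneg:
  assumes "c \<in> M" "x \<in> fst c" "e \<in> N" "y \<in> fst e"
  shows "0 \<le> hs_product (N.gram e y) (matrix_inv (M.gram c x)) A A"
proof -
  obtain \<xi> where "coord_matrix M N c e x y \<xi> = A" using coord_matrix_surj[OF assms] by blast
  then show ?thesis using hs_norm_coord[OF assms, of \<xi>] by (metis zero_le_power2)
qed

text \<open>Positive definiteness in quantitative form: small energy forces small entries. The
  constant depends on the two points, which is harmless because it is applied pointwise.\<close>

lemma hs_product_gram_bounds:
  assumes "c \<in> M" "x \<in> fst c" "e \<in> N" "y \<in> fst e"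
  obtains C where "\<And>A p j. \<bar>A $ p $ j\<bar> \<le> C * sqrt (hs_product (N.gram e y) (matrix_inv (M.gram c x)) A A)"
proof -
  have "\<exists>C. \<forall>A. \<bar>A $ p $ j\<bar> \<le> C * sqrt (hs_product (N.gram e y) (matrix_inv (M.gram c x)) A A)" for p j
  proof -
    let ?\<phi> = "\<lambda>v. chart_diff N e y v $ p"
    have lin: "linear ?\<phi>"
      using linear_compose[OF N.chart_diff_linear[OF assms(3,4)] bounded_linear.linear[OF
          bounded_linear_vec_nth]] by (simp add: o_def)
    obtain L where L: "0 \<le> L" "\<And>v. \<bar>?\<phi> v\<bar> \<le> L * sqrt (gN y v v)"
      using inner_form_bounds_functional[OF N.form lin] by metis
    let ?b = "inv (chart_diff M c x) (axis j 1)"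
    have "\<bar>A $ p $ j\<bar>
        \<le> CARD('m) * sqrt (gM x ?b ?b) * L * sqrt (hs_product (N.gram e y) (matrix_inv (M.gram c x)) A A)"
        for A
    proof -
      obtain \<xi> where \<xi>: "coord_matrix M N c e x y \<xi> = A" using coord_matrix_surj[OF assms] by blast
      have "hs_norm (gM x) (gN y) \<xi> = sqrt (hs_product (N.gram e y) (matrix_inv (M.gram c x)) A A)"
        unfolding \<xi>[symmetric] hs_norm_coord[OF assms, symmetric]
        using hs_norm_nonneg[OF M.form N.form, of x y \<xi>] by simp
      moreover have "A $ p $ j = ?\<phi> (\<xi> ?b)" unfolding \<xi>[symmetric] by (simp add: coord_matrix_def matrix_def)
      ultimately show ?thesis using functional_le_hs_norm[OF M.form N.form lin L, of \<xi> ?b x] by simp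
    qed
    then show ?thesis by blast
  qed
  then obtain C where C: "\<And>p j A. \<bar>A $ p $ j\<bar>
      \<le> C p j * sqrt (hs_product (N.gram e y) (matrix_inv (M.gram c x)) A A)" by metis
  show ?thesis
  proof (rule that[of "\<Sum>p\<in>UNIV. \<Sum>j\<in>UNIV. \<bar>C p j\<bar>"])
    fix A :: "real ^ 'm ^ 'n" and p j
    have "C p j \<le> (\<Sum>p\<in>UNIV. \<Sum>j\<in>UNIV. \<bar>C p j\<bar>)"
      by (rule order_trans[OF abs_ge_self order_trans[OF member_le_sum[of j UNIV "\<lambda>j. \<bar>C p j\<bar>"]
          member_le_sum[of p UNIV "\<lambda>p. \<Sum>j\<in>UNIV. \<bar>C p j\<bar>"]]])
         (auto intro: sum_nonneg)
    then show "\<bar>A $ p $ j\<bar>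
        \<le> (\<Sum>p\<in>UNIV. \<Sum>j\<in>UNIV. \<bar>C p j\<bar>) * sqrt (hs_product (N.gram e y) (matrix_inv (M.gram c x)) A A)"
      by (intro order_trans[OF C] mult_right_mono real_sqrt_ge_zero hs_product_gram_nonneg[OF assms])
  qed
qed

lemma test_matrix_eq_coord:
  assumes "coord_functions N gN e W f L" "v (chart_inv c y) \<in> W"
  shows "test_matrix M N c f v D y
      = coord_matrix M N c e (chart_inv c y) (v (chart_inv c y)) (D (chart_inv c y))"
  using assms by (simp add: test_matrix_def coord_matrix_def matrix_def coord_functions_def vec_eq_iff)

lemma test_matrix_hs:
  assumes f: "coord_functions N gN e W f L" "v (chart_inv c y) \<in> W" and c: "c \<in> M" "y \<in> chart_image c"
  shows "hs_product (N.gram e (v (chart_inv c y))) (matrix_inv (M.gram c (chart_inv c y)))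
      (test_matrix M N c f v D y) (test_matrix M N c f v D y)
    = (hs_norm (gM (chart_inv c y)) (gN (v (chart_inv c y))) (D (chart_inv c y)))\<^sup>2"
  unfolding test_matrix_eq_coord[where v=v and c=c and y=y and D=D, OF f]
  by (rule hs_norm_coord[symmetric]) (use f c M.inv_into_dom[OF c(1)] in \<open>auto simp: coord_functions_def\<close>)

text \<open>The cut-off coordinates have differentials bounded on all of \<open>N\<close>, so the
  constant depends neither on the map nor on its derivative; compactness of the ball bounds the
  lengths of the coordinate vectors.\<close>

lemma test_matrix_bound:
  assumes f: "coord_functions N gN e W f L" and c: "c \<in> M" and K: "cball a R \<subseteq> chart_image c"
  obtains C where "0 \<le> C"
    "\<And>v D y p j. y \<in> cball a R \<Longrightarrow> \<bar>test_matrix M N c f v D y $ p $ j\<bar>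
       \<le> C * hs_norm (gM (chart_inv c y)) (gN (v (chart_inv c y))) (D (chart_inv c y))"
proof -
  have "bounded ((\<lambda>y. M.gram c (chart_inv c y)) ` cball a R)"
    by (intro compact_imp_bounded compact_continuous_image continuous_on_subset[OF M.gram_coord_cont[OF c]
        K] compact_cball)
  then obtain G where G: "0 < G" "\<And>y. y \<in> cball a R \<Longrightarrow> norm (M.gram c (chart_inv c y)) \<le> G"
    unfolding bounded_pos by blast
  have L: "0 \<le> L" "\<And>i y v. \<bar>mdiff N (f i) y v\<bar> \<le> L * sqrt (gN y v v)" "\<And>i. f i \<in> C1c_functions N"
    using f by (auto simp: coord_functions_def)
  show ?thesis
  proof (rule that[of "CARD('m) * sqrt G * L"])
    show "0 \<le> CARD('m) * sqrt G * L" using G L by simp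
    fix v D y p j assume y: "y \<in> cball a R"
    let ?x = "chart_inv c y" let ?b = "inv (chart_diff M c ?x) (axis j 1)"
    have "gM ?x ?b ?b = M.gram c ?x $ j $ j" by (simp add: gram_matrix_def)
    also have "\<dots> \<le> norm (M.gram c ?x)"
      by (rule order_trans[OF abs_ge_self order_trans[OF component_le_norm_cart
          Finite_Cartesian_Product.norm_nth_le]])
    finally have "sqrt (gM ?x ?b ?b) \<le> sqrt G" using G(2)[OF y] by simp
    moreover have "0 \<le> hs_norm (gM ?x) (gN (v ?x)) (D ?x)" by (rule hs_norm_nonneg[OF M.form N.form])
    ultimately have le: "CARD('m) * sqrt (gM ?x ?b ?b) * L * hs_norm (gM ?x) (gN (v ?x)) (D ?x)
        \<le> CARD('m) * sqrt G * L * hs_norm (gM ?x) (gN (v ?x)) (D ?x)"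
      using L(1) by (intro mult_right_mono mult_left_mono) auto
    have "test_matrix M N c f v D y $ p $ j = mdiff N (f p) (v ?x) (D ?x ?b)" by (simp add: test_matrix_def)
    also have "\<bar>\<dots>\<bar> \<le> CARD('m) * sqrt (gM ?x ?b ?b) * L * hs_norm (gM ?x) (gN (v ?x)) (D ?x)"
      by (rule functional_le_hs_norm[OF M.form N.form N.mdiff_linear[OF L(3)] L(1,2)])
    also note le
    finally show "\<bar>test_matrix M N c f v D y $ p $ j\<bar>
        \<le> CARD('m) * sqrt G * L * hs_norm (gM ?x) (gN (v ?x)) (D ?x)" .
  qed
qed

text \<open>A weak derivative of f p \<circ> v agrees almost everywhere with a row of the test
  matrix, which therefore inherits integrability and integration by parts. Cutting off at the closed
  ball makes all integrals global and is invisible to test functions supported there.\<close>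

lemma test_matrix_weak:
  assumes v: "has_colocal_weak_derivative M N v D" and f: "f p \<in> C1c_functions N"
    and c: "c \<in> M" and K: "cball a R \<subseteq> chart_image c"
  shows "integrable lebesgue (\<lambda>y. indicator (cball a R) y * test_matrix M N c f v D y $ p $ j)"
    and "(\<lambda>y. indicator (cball a R) y * f p (v (chart_inv c y))) \<in> borel_measurable lebesgue"
    and "\<And>\<phi>. C1_on UNIV \<phi> \<Longrightarrow> (\<And>y. y \<notin> ball a R \<Longrightarrow> \<phi> y = 0) \<Longrightarrow>
      (\<integral>y. \<phi> y * (indicator (cball a R) y * test_matrix M N c f v D y $ p $ j) \<partial>lebesgue) =
      - (\<integral>y. indicator (cball a R) y * f p (v (chart_inv c y)) * frechet_derivative \<phi> (at y)
          (axis j 1) \<partial>lebesgue)"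
proof -
  let ?B = "cball a R" and ?T = "\<lambda>y. test_matrix M N c f v D y $ p $ j"
  obtain \<omega> where \<omega>: "has_weak_derivative M (f p \<circ> v) \<omega>"
    and \<omega>eq: "almost_everywhere M (\<lambda>x. \<forall>w. \<omega> x w = mdiff N (f p) (v x) (D x w))"
    using v f unfolding has_colocal_weak_derivative_def by blast
  let ?F = "\<lambda>y. \<omega> (chart_inv c y) (inv (chart_diff M c (chart_inv c y)) (axis j 1))"
  have w: "has_weak_derivative_on (f p \<circ> v \<circ> chart_inv c)
        (\<lambda>y v. \<omega> (chart_inv c y) (inv (chart_diff M c (chart_inv c y)) v)) (chart_image c)"
    using \<omega> c by (simp add: has_weak_derivative_def)
  have l1: "(f p \<circ> v \<circ> chart_inv c) absolutely_integrable_on ?B"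
    using w K unfolding has_weak_derivative_on_def locally_integrable_on_def by (meson compact_cball)
  have l2: "?F absolutely_integrable_on ?B"
    using w K unfolding has_weak_derivative_on_def locally_integrable_on_def by (meson compact_cball)
  have i2: "integrable lebesgue (\<lambda>y. indicator ?B y * ?F y)" using l2 by (simp add: set_integrable_def)
  have i1: "integrable lebesgue (\<lambda>y. indicator ?B y * f p (v (chart_inv c y)))" using l1
      by (simp add: set_integrable_def)
  show "(\<lambda>y. indicator ?B y * f p (v (chart_inv c y))) \<in> borel_measurable lebesgue" using i1 by simp
  have ae: "AE y in lebesgue. indicator ?B y * ?F y = indicator ?B y * ?T y"
    using M.almost_everywhere_coord[OF \<omega>eq c]
    by eventually_elim (use K in \<open>auto simp: indicator_def test_matrix_def\<close>)
  have Tm: "(\<lambda>y. indicator ?B y * ?T y) \<in> borel_measurable lebesgue"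
    by (rule borel_measurable_AE[OF borel_measurable_integrable[OF i2] ae])
  show "integrable lebesgue (\<lambda>y. indicator ?B y * ?T y)"
    by (rule integrable_cong_AE_imp[OF i2 Tm]) (use ae in \<open>auto elim: eventually_mono\<close>)
  fix \<phi> :: "real ^ 'm \<Rightarrow> real" assume \<phi>: "C1_on UNIV \<phi>" "\<And>y. y \<notin> ball a R \<Longrightarrow> \<phi> y = 0"
  have cl: "closure {y. \<phi> y \<noteq> 0} \<subseteq> ?B" 
  proof (rule closure_minimal)
    show "{y. \<phi> y \<noteq> 0} \<subseteq> ?B" using \<phi>(2) ball_subset_cball by blast
  qed simp
  then have comp: "compact (closure {y. \<phi> y \<noteq> 0})"
    by (metis closed_closure compact_Int_closed compact_cball inf.absorb_iff2)
  have eq: "(LINT y:chart_image c|lebesgue. (f p \<circ> v \<circ> chart_inv c) y * frechet_derivative \<phi> (at y)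
      (axis j 1)) =
        - (LINT y:chart_image c|lebesgue. \<phi> y * ?F y)"
    using w \<phi>(1) comp cl K unfolding has_weak_derivative_on_def by blast
  \<comment> \<open>The test function vanishes on the open complement of the closed ball, hence so
    does its derivative; this keeps the cut-off out of the integration by parts.\<close>
  have d0: "frechet_derivative \<phi> (at y) (axis j 1) = 0" if "y \<notin> ?B" for y
  proof -
    have "(\<phi> has_derivative (\<lambda>_. 0)) (at y)"
    proof (rule has_derivative_transform_within_open)
      show "((\<lambda>_. 0 :: real) has_derivative (\<lambda>_. 0)) (at y)" by simp
      show "open (- ?B)" by (rule open_Compl[OF closed_cball])
      show "0 = \<phi> z" if "z \<in> - ?B" for z using \<phi>(2)[of z] that by simp
    qed (use that in simp)
    from frechet_derivative_at[OF this] show ?thesis by metis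
  qed
  have \<phi>m: "\<phi> \<in> borel_measurable lebesgue"
    using borel_measurable_continuous_onI[OF C1_on_continuous[OF \<phi>(1)]] by (simp add: measurable_completion)
  have "(\<integral>y. \<phi> y * (indicator ?B y * ?T y) \<partial>lebesgue) = (\<integral>y. \<phi> y * (indicator ?B y * ?F y) \<partial>lebesgue)"
  proof (rule integral_cong_AE)
    show "(\<lambda>y. \<phi> y * (indicator ?B y * ?T y)) \<in> borel_measurable lebesgue"
        by (rule borel_measurable_times[OF \<phi>m Tm])
    show "(\<lambda>y. \<phi> y * (indicator ?B y * ?F y)) \<in> borel_measurable lebesgue"
      by (rule borel_measurable_times[OF \<phi>m borel_measurable_integrable[OF i2]])
    show "AE y in lebesgue. \<phi> y * (indicator ?B y * ?T y) = \<phi> y * (indicator ?B y * ?F y)" using ae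
        by eventually_elim (simp only:)
  qed
  also have "\<dots> = (LINT y:chart_image c|lebesgue. \<phi> y * ?F y)"
    unfolding set_lebesgue_integral_def
  proof (rule Bochner_Integration.integral_cong[OF refl])
    fix y show "\<phi> y * (indicator ?B y * ?F y) = indicator (chart_image c) y *\<^sub>R (\<phi> y * ?F y)"
      using \<phi>(2)[of y] subsetD[OF K, of y] by (cases "y \<in> ball a R") (simp_all add: less_imp_le)
  qed
  also have "\<dots> = - (LINT y:chart_image c|lebesgue. (f p \<circ> v \<circ> chart_inv c) y * frechet_derivative \<phi> (at y)
      (axis j 1))"
    using eq by simp
  also have "(LINT y:chart_image c|lebesgue. (f p \<circ> v \<circ> chart_inv c) y * frechet_derivative \<phi> (at y)
      (axis j 1))
     = (\<integral>y. indicator ?B y * f p (v (chart_inv c y)) * frechet_derivative \<phi> (at y) (axis j 1) \<partial>lebesgue)"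
    unfolding set_lebesgue_integral_def
  proof (rule Bochner_Integration.integral_cong[OF refl])
    fix y show "indicator (chart_image c) y *\<^sub>R ((f p \<circ> v \<circ> chart_inv c) y * frechet_derivative \<phi> (at y)
        (axis j 1))
      = indicator ?B y * f p (v (chart_inv c y)) * frechet_derivative \<phi> (at y) (axis j 1)"
      using d0[of y] subsetD[OF K, of y] by (cases "y \<in> ?B") simp_all
  qed
  finally show "(\<integral>y. \<phi> y * (indicator ?B y * ?T y) \<partial>lebesgue) =
      - (\<integral>y. indicator ?B y * f p (v (chart_inv c y)) * frechet_derivative \<phi> (at y) (axis j 1) \<partial>lebesgue)" .
qed

end

section \<open>Convergence of the energy on sets of boundedness\<close>

context riemannian_pair
begin

text \<open>Since \<open>u\<close> is only Lebesgue measurable, it is followed by a Borel function: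
  the Gram entry, continuous on the open set \<open>W\<close>, extended by 0.\<close>

lemma gram_along_map_measurable:
  assumes u: "measurable_map M euclidean u" and c: "c \<in> M" and e: "e \<in> N" and W: "open W" "W \<subseteq> fst e"
    and P: "P \<in> sets lebesgue" "P \<subseteq> chart_image c" and PW: "\<And>y. y \<in> P \<Longrightarrow> u (chart_inv c y) \<in> W"
  shows "(\<lambda>y. indicator P y * N.gram e (u (chart_inv c y)) $ p $ q) \<in> borel_measurable lebesgue"
proof -
  have im: "chart_image c \<in> sets lebesgue" using M.image_open[OF c] by simp
  have "continuous_on W (\<lambda>z. N.gram e z $ p $ q)"
    by (intro continuous_intros continuous_on_subset[OF N.gram_cont[OF e] W(2)])
  then have g: "(\<lambda>z. indicator W z *\<^sub>R N.gram e z $ p $ q) \<in> borel_measurable borel"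
    using W(1) by (intro borel_measurable_continuous_on_indicator) auto
  have uk: "(\<lambda>y. u (chart_inv c y)) \<in> borel_measurable (lebesgue_on (chart_image c))"
  proof (rule borel_measurableI)
    fix U :: "'b set" assume "open U"
    then have "u -` U \<in> lebesgue_sets M" using u by (simp add: measurable_map_def)
    then have "chart_image c \<inter> chart_inv c -` (u -` U) \<in> sets lebesgue" using c
        by (simp add: M.lebesgue_sets_iff)
    then show "(\<lambda>y. u (chart_inv c y)) -` U \<inter> space (lebesgue_on (chart_image c)) \<in> sets (lebesgue_on
        (chart_image c))"
      using im by (simp add: sets_restrict_space_iff Int_commute vimage_def)
  qed
  have "(\<lambda>y. indicator P y * (indicator W (u (chart_inv c y)) *\<^sub>R N.gram e (u (chart_inv c y)) $ p $ q))
      \<in> borel_measurable lebesgue"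
    by (rule indicator_mult_measurable[OF measurable_compose[OF uk g] im P])
  also have "(\<lambda>y. indicator P y * (indicator W (u (chart_inv c y)) *\<^sub>R N.gram e (u
      (chart_inv c y)) $ p $ q)) =
      (\<lambda>y. indicator P y * N.gram e (u (chart_inv c y)) $ p $ q)"
    using PW by (auto simp: fun_eq_iff indicator_def)
  finally show ?thesis .
qed

text \<open>Freeze the metric of the target at \<open>u\<close> and expand the square. The mixed
  terms converge weakly, tested with bounded measurable weights made of the metric and the limit;
  the pure term converges because the norms do. All limits equal the energy of the limit, so the sum
  tends to 0. The bounds on \<open>P\<close> make the weights bounded and supply the dominating
  functions.\<close>

lemma energy_convergence:
  assumes c: "c \<in> M" and r: "0 < r" "r < R" and K: "cball a R \<subseteq> chart_image c"
    and f: "coord_functions N gN e W f L"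
    and vs: "\<And>n. has_colocal_weak_derivative M N (vs n) (Ds n)"
    and u: "has_colocal_weak_derivative M N u D" "measurable_map M euclidean u"
    and hs: "\<And>n y. hs n y = hs_norm (gM (chart_inv c y)) (gN (vs n (chart_inv c y))) (Ds n (chart_inv c y))"
    and h: "\<And>y. h y = hs_norm (gM (chart_inv c y)) (gN (u (chart_inv c y))) (D (chart_inv c y))"
    and hs_int: "\<And>n. integrable lebesgue (\<lambda>y. indicator (cball a R) y * hs n y)"
    and h_int: "integrable lebesgue (\<lambda>y. indicator (cball a R) y * h y)"
    and hs_lim: "(\<lambda>n. \<integral>y. \<bar>indicator (cball a R) y * hs n y - indicator (cball a R) y * h y\<bar> \<partial>lebesgue) \<longlonglongrightarrow> 0"
    and ae_v: "AE y in lebesgue. y \<in> chart_image c \<longrightarrow> (\<lambda>n. vs n (chart_inv c y)) \<longlonglongrightarrow> u (chart_inv c y)"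
    and ae_h: "AE y in lebesgue. y \<in> cball a R \<longrightarrow> (\<lambda>n. hs n y) \<longlonglongrightarrow> h y"
    and P: "P \<in> sets lebesgue" "P \<subseteq> ball a r"
    and PW: "\<And>y. y \<in> P \<Longrightarrow> u (chart_inv c y) \<in> W"
    and Ph: "\<And>n y. y \<in> P \<Longrightarrow> hs n y \<le> m" "\<And>y. y \<in> P \<Longrightarrow> h y \<le> m"
    and PG: "\<And>y p q. y \<in> P \<Longrightarrow> \<bar>N.gram e (u (chart_inv c y)) $ p $ q\<bar> \<le> m"
    and PV: "\<And>y k l. y \<in> P \<Longrightarrow> \<bar>matrix_inv (M.gram c (chart_inv c y)) $ k $ l\<bar> \<le> m"
    and m: "0 \<le> m"
  defines "Q \<equiv> \<lambda>n y. indicator P y * hs_product (N.gram e (u (chart_inv c y))) (matrix_inv (M.gram c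
      (chart_inv c y)))
     (test_matrix M N c f (vs n) (Ds n) y
         - test_matrix M N c f u D y) (test_matrix M N c f (vs n) (Ds n) y - test_matrix M N c f u D y)"
  shows "\<And>n. Q n \<in> borel_measurable lebesgue" "\<And>n y. 0 \<le> Q n y" "(\<lambda>n. \<integral>\<^sup>+y. ennreal (Q n y) \<partial>lebesgue) \<longlonglongrightarrow> 0"
proof -
  let ?B = "cball a R"
  define T where "T n = test_matrix M N c f (vs n) (Ds n)" for n
  define S where "S = test_matrix M N c f u D"
  define G where "G y = N.gram e (u (chart_inv c y))" for y
  define V where "V y = matrix_inv (M.gram c (chart_inv c y))" for y
  have fD: "e \<in> N" "open W" "W \<subseteq> fst e" "\<And>p. f p \<in> C1c_functions N" "\<And>p. bounded (range (f p))"
    using f by (auto simp: coord_functions_def)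
  have PB: "P \<subseteq> ?B" and PI: "P \<subseteq> chart_image c" using P(2) r K by (auto simp: subset_iff)
  obtain C where C: "0 \<le> C" "\<And>v D y p j. y \<in> ?B \<Longrightarrow> \<bar>test_matrix M N c f v D y $ p $ j\<bar>
       \<le> C * hs_norm (gM (chart_inv c y)) (gN (v (chart_inv c y))) (D (chart_inv c y))"
    using test_matrix_bound[OF f c K] by metis
  have TC: "\<bar>T n y $ p $ j\<bar> \<le> C * hs n y" if "y \<in> ?B" for n y p j unfolding T_def hs by (rule C(2)[OF that])
  have SC: "\<bar>S y $ p $ j\<bar> \<le> C * h y" if "y \<in> ?B" for y p j unfolding S_def h by (rule C(2)[OF that])
  have h0: "0 \<le> h y" for y unfolding h by (rule hs_norm_nonneg[OF M.form N.form])
  have Tb: "\<bar>T n y $ p $ j\<bar> \<le> C * m" if "y \<in> P" for n y p j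
    using order_trans[OF TC mult_left_mono[OF Ph(1)[OF that] C(1)]] that PB by blast
  have Sb: "\<bar>S y $ p $ j\<bar> \<le> C * m" if "y \<in> P" for y p j
    using order_trans[OF SC mult_left_mono[OF Ph(2)[OF that] C(1)]] that PB by blast
  define X where "X A p j y = indicator ?B y * (A y :: real ^ 'm ^ 'n) $ p $ j" for A p j y
  have Xi: "integrable lebesgue (X (T n) p j)" for n p j
    unfolding X_def T_def by (rule test_matrix_weak(1)[OF vs fD(4) c K])
  have XiS: "integrable lebesgue (X S p j)" for p j
    unfolding X_def S_def by (rule test_matrix_weak(1)[OF u(1) fD(4) c K])
  \<comment> \<open>Indicator and metric coefficients are collected into one bounded weight, so that
    \<open>E\<close> becomes a finite sum of products to which weak convergence applies entry by
    entry.\<close>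
  define w where "w p q k l y = indicator P y * (G y $ p $ q * V y $ k $ l)" for p q k l y
  have Gm: "(\<lambda>y. indicator P y * G y $ p $ q) \<in> borel_measurable lebesgue" for p q
    unfolding G_def by (rule gram_along_map_measurable[OF u(2) c fD(1-3) P(1) PI PW])
  have Vm: "(\<lambda>y. indicator P y * V y $ k $ l) \<in> borel_measurable lebesgue" for k l
    unfolding V_def by (rule indicator_mult_measurable_lebesgue[OF M.matrix_inv_gram_cont[OF c] PI P(1)])
  have wm: "w p q k l \<in> borel_measurable lebesgue" for p q k l
  proof -
    have "(\<lambda>y. (indicator P y * G y $ p $ q) * (indicator P y * V y $ k $ l)) \<in> borel_measurable lebesgue"
      by (rule borel_measurable_times[OF Gm Vm])
    also have "(\<lambda>y. (indicator P y * G y $ p $ q) * (indicator P y * V y $ k $ l)) = w p q k l"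
      by (auto simp: fun_eq_iff w_def indicator_def)
    finally show ?thesis .
  qed
  have wb: "\<bar>w p q k l y\<bar> \<le> m * m" for p q k l y
    using PG[of y p q] PV[of y k l] m
    by (auto simp: w_def indicator_def G_def V_def abs_mult intro!: mult_mono)
  have w0: "w p q k l y = 0" if "y \<notin> P" for p q k l y using that by (simp add: w_def)
  define E where "E A B y = indicator P y * hs_product (G y) (V y) (A y) (B y)" for A B and y
  have EX: "E A B y = (\<Sum>p\<in>UNIV. \<Sum>q\<in>UNIV. \<Sum>k\<in>UNIV. \<Sum>l\<in>UNIV. w p q k l y * X A p k y * X B q l y)" for A B y
  proof (cases "y \<in> P")
    case True
    then have "y \<in> ?B" using PB by blast
    then show ?thesis using True by (simp add: E_def hs_product_def w_def X_def)
  qed (simp add: E_def w_def)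
  have iP: "integrable lebesgue (indicator P :: _ \<Rightarrow> real)"
  proof -
    have "emeasure lebesgue P \<le> emeasure lebesgue ?B" by (rule emeasure_mono[OF PB]) simp
    also have "\<dots> < \<infinity>" using emeasure_compact_finite[OF compact_cball, of a R] by simp
    finally show ?thesis using P(1) by (intro integrable_real_indicator) auto
  qed
  define Z where "Z = (real CARD('n))\<^sup>2 * (real CARD('m))\<^sup>2 * (m * m * (C * m) * (C * m))"
  have EZ: "\<bar>E A B y\<bar> \<le> Z * indicator P y"
    if "\<And>p j. y \<in> P \<Longrightarrow> \<bar>A y $ p $ j\<bar> \<le> C * m" "\<And>p j. y \<in> P \<Longrightarrow> \<bar>B y $ p $ j\<bar> \<le> C * m" for A B y
  proof (cases "y \<in> P")
    case True
    have "\<bar>hs_product (G y) (V y) (A y) (B y)\<bar> \<le> Z"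
      unfolding Z_def by (rule hs_product_bound) (use True PG PV that in \<open>auto simp: G_def V_def\<close>)
    then show ?thesis using True by (simp add: E_def)
  qed (simp add: E_def)
  have Em: "E A B \<in> borel_measurable lebesgue"
    if "\<And>p j. X A p j \<in> borel_measurable lebesgue" "\<And>p j. X B p j \<in> borel_measurable lebesgue" for A B
  proof -
    have "(\<lambda>y. \<Sum>p\<in>UNIV. \<Sum>q\<in>UNIV. \<Sum>k\<in>UNIV. \<Sum>l\<in>UNIV. w p q k l y * X A p k y * X B q l y)
        \<in> borel_measurable lebesgue"
      by (intro borel_measurable_sum borel_measurable_times wm that)
    then show ?thesis unfolding EX[abs_def] .
  qed
  have XmT: "X (T n) p j \<in> borel_measurable lebesgue" for n p j using Xi by (rule borel_measurable_integrable)
  have XmS: "X S p j \<in> borel_measurable lebesgue" for p j using XiS by (rule borel_measurable_integrable)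
  have Ei: "integrable lebesgue (E A B)"
    if "E A B \<in> borel_measurable lebesgue" "\<And>y. \<bar>E A B y\<bar> \<le> Z * indicator P y" for A B
  proof (rule Bochner_Integration.integrable_bound[OF _ that(1)])
    show "integrable lebesgue (\<lambda>y. Z * indicator P y)" using iP by auto
    show "AE y in lebesgue. norm (E A B y) \<le> norm (Z * indicator P y)"
      using that(2) order_trans[OF _ abs_ge_self] by (intro AE_I2) (auto simp only: real_norm_def)
  qed
  have E1: "integrable lebesgue (E (T n) (T n))" "integrable lebesgue (E (T n) S)" "integrable lebesgue
      (E S (T n))" "integrable lebesgue (E S S)" for n
    by (intro Ei Em XmT XmS EZ Tb Sb; assumption)+
  \<comment> \<open>For a C1 test function the derivative is moved onto it, and then the functions f
    p \<circ> vs n converge boundedly almost everywhere. Passing to bounded measurable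
    \<open>\<phi>\<close> uses the convergent majorants, \<open>C\<close> times the norms.\<close>
  have weak: "(\<lambda>n. \<integral>y. \<phi> y * X (T n) p k y \<partial>lebesgue) \<longlonglongrightarrow> (\<integral>y. \<phi> y * X S p k y \<partial>lebesgue)"
    if \<phi>: "\<phi> \<in> borel_measurable lebesgue" "\<And>y. \<bar>\<phi> y\<bar> \<le> b" "\<And>y. y \<notin> ball a r \<Longrightarrow> \<phi> y = 0" for \<phi> b p k
  proof (rule weak_convergence_bounded_measurable[OF r XmS XmT])
    show "integrable lebesgue (\<lambda>y. C * (indicator ?B y * h y))" "integrable lebesgue (\<lambda>y. C *
        (indicator ?B y * hs n y))" for n
      using h_int hs_int by auto
    show "AE y in lebesgue. \<bar>X S p k y\<bar> \<le> C * (indicator ?B y * h y)"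
      using SC by (intro AE_I2) (auto simp: X_def indicator_def)
    show "AE y in lebesgue. \<bar>X (T n) p k y\<bar> \<le> C * (indicator ?B y * hs n y)" for n
      using TC by (intro AE_I2) (auto simp: X_def indicator_def)
    show "0 \<le> C * (indicator ?B y * h y)" for y using C(1) h0 by simp
    have "(\<lambda>n. C * (\<integral>y. \<bar>indicator ?B y * hs n y - indicator ?B y * h y\<bar> \<partial>lebesgue)) \<longlonglongrightarrow> 0"
      by (rule tendsto_mult_right_zero[OF hs_lim])
    moreover have "(\<integral>y. \<bar>C * (indicator ?B y * hs n y) - C * (indicator ?B y * h y)\<bar> \<partial>lebesgue) =
      C * (\<integral>y. \<bar>indicator ?B y * hs n y - indicator ?B y * h y\<bar> \<partial>lebesgue)" for n
      using C(1) by (simp add: right_diff_distrib[symmetric] abs_mult)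
    ultimately show "(\<lambda>n. \<integral>y. \<bar>C * (indicator ?B y * hs n y) - C * (indicator ?B y * h y)\<bar> \<partial>lebesgue) \<longlonglongrightarrow> 0"
        by simp
  next
    fix \<psi> :: "real ^ 'm \<Rightarrow> real" assume \<psi>: "C1_on UNIV \<psi>" "\<And>y. y \<notin> ball a R \<Longrightarrow> \<psi> y = 0"
    define \<delta> where "\<delta> y = frechet_derivative \<psi> (at y) (axis k 1)" for y
    have bl: "bounded_linear (frechet_derivative \<psi> (at y))" for y
      by (rule has_derivative_bounded_linear[OF C1_on_has_derivative[OF \<psi>(1)]]) simp
    have "\<delta> = (\<lambda>y. blinfun_apply (Blinfun (frechet_derivative \<psi> (at y))) (axis k 1))"
      by (rule ext) (simp add: \<delta>_def bounded_linear_Blinfun_apply[OF bl])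
    then have \<delta>c: "continuous_on UNIV \<delta>"
      using C1_on_continuous_derivative[OF \<psi>(1)] by (auto intro!: continuous_intros)
    have \<delta>m: "\<delta> \<in> borel_measurable lebesgue"
      using borel_measurable_continuous_onI[OF \<delta>c] by (simp add: measurable_completion)
    have "bounded (\<delta> ` ?B)"
      by (intro compact_imp_bounded compact_continuous_image continuous_on_subset[OF \<delta>c] compact_cball) auto
    then obtain d where d: "0 < d" "\<And>y. y \<in> ?B \<Longrightarrow> \<bar>\<delta> y\<bar> \<le> d" unfolding bounded_pos by auto
    obtain F where F: "0 < F" "\<And>z. \<bar>f p z\<bar> \<le> F" using fD(5)[of p] unfolding bounded_pos by auto
    have fu: "(\<lambda>y. indicator ?B y * f p (u (chart_inv c y))) \<in> borel_measurable lebesgue"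
      by (rule test_matrix_weak(2)[where f=f and p=p, OF u(1) fD(4) c K])
    have fv: "(\<lambda>y. indicator ?B y * f p (vs n (chart_inv c y))) \<in> borel_measurable lebesgue" for n
      by (rule test_matrix_weak(2)[where f=f and p=p, OF vs fD(4) c K])
    have iB: "integrable lebesgue (indicator ?B :: _ \<Rightarrow> real)"
      using emeasure_compact_finite[OF compact_cball, of a R] by (intro integrable_real_indicator) auto
    have "(\<lambda>n. \<integral>y. indicator ?B y * f p (vs n (chart_inv c y)) * \<delta> y \<partial>lebesgue)
      \<longlonglongrightarrow> (\<integral>y. indicator ?B y * f p (u (chart_inv c y)) * \<delta> y \<partial>lebesgue)"
    proof (rule integral_dominated_convergence[where w="\<lambda>y. F * d * indicator ?B y"])
      show "(\<lambda>y. indicator ?B y * f p (u (chart_inv c y)) * \<delta> y) \<in> borel_measurable lebesgue"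
        by (rule borel_measurable_times[OF fu \<delta>m])
      show "(\<lambda>y. indicator ?B y * f p (vs n (chart_inv c y)) * \<delta> y) \<in> borel_measurable lebesgue" for n
        by (rule borel_measurable_times[OF fv \<delta>m])
      show "integrable lebesgue (\<lambda>y. F * d * indicator ?B y)" using iB by auto
      show "AE y in lebesgue. (\<lambda>n. indicator ?B y * f p (vs n (chart_inv c y)) * \<delta> y) \<longlonglongrightarrow>
          indicator ?B y * f p (u (chart_inv c y)) * \<delta> y"
        using ae_v
      proof eventually_elim
        case (elim y)
        show ?case
        proof (cases "y \<in> ?B")
          case True
          then have "(\<lambda>n. vs n (chart_inv c y)) \<longlonglongrightarrow> u (chart_inv c y)" using elim K by blast
          then have "(\<lambda>n. f p (vs n (chart_inv c y))) \<longlonglongrightarrow> f p (u (chart_inv c y))"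
            by (rule continuous_on_tendsto_compose[OF N.C1c_continuous[OF fD(4)]]) auto
          then show ?thesis by (intro tendsto_intros)
        qed simp
      qed
      show "AE y in lebesgue. norm (indicator ?B y * f p (vs n (chart_inv c y)) * \<delta> y)
          \<le> F * d * indicator ?B y" for n
        using F d by (intro AE_I2) (auto simp: indicator_def abs_mult intro!: mult_mono)
    qed
    then have lim: "(\<lambda>n. - (\<integral>y. indicator ?B y * f p (vs n (chart_inv c y)) * \<delta> y \<partial>lebesgue))
      \<longlonglongrightarrow> - (\<integral>y. indicator ?B y * f p (u (chart_inv c y)) * \<delta> y \<partial>lebesgue)" by (rule tendsto_minus)
    have e1: "(\<integral>y. \<psi> y * X (T n) p k y \<partial>lebesgue)
        = - (\<integral>y. indicator ?B y * f p (vs n (chart_inv c y)) * \<delta> y \<partial>lebesgue)" for n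
      unfolding X_def T_def \<delta>_def by (rule test_matrix_weak(3)[OF vs fD(4) c K \<psi>])
    have e2: "(\<integral>y. \<psi> y * X S p k y \<partial>lebesgue)
        = - (\<integral>y. indicator ?B y * f p (u (chart_inv c y)) * \<delta> y \<partial>lebesgue)"
      unfolding X_def S_def \<delta>_def by (rule test_matrix_weak(3)[OF u(1) fD(4) c K \<psi>])
    show "(\<lambda>n. \<integral>y. \<psi> y * X (T n) p k y \<partial>lebesgue) \<longlonglongrightarrow> (\<integral>y. \<psi> y * X S p k y \<partial>lebesgue)"
      unfolding e1 e2 by (rule lim)
  qed (use \<phi> in auto)
  \<comment> \<open>The weight of a mixed term is \<open>w\<close> times an entry of the limit; the
    product is bounded because \<open>w\<close> vanishes off \<open>P\<close>.\<close>
  have \<phi>b: "\<bar>w p q k l y * X S p' j y\<bar> \<le> m * m * (C * m)" for p q k l p' j y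
  proof (cases "y \<in> P")
    case True
    then have "\<bar>X S p' j y\<bar> \<le> C * m" using Sb[OF True] PB by (auto simp: X_def)
    then show ?thesis unfolding abs_mult using wb[of p q k l y] m by (intro mult_mono) auto
  qed (use w0 C(1) m in simp)
  have \<phi>0: "w p q k l y * X S p' j y = 0" if "y \<notin> ball a r" for p q k l p' j y 
  proof -
    have "y \<notin> P" using that P(2) by blast
    then show ?thesis by (simp add: w0)
  qed
  have \<phi>m: "(\<lambda>y. w p q k l y * X S p' j y) \<in> borel_measurable lebesgue" for p q k l p' j
    by (rule borel_measurable_times[OF wm XmS])
  note weak' = weak[OF \<phi>m \<phi>b \<phi>0]
  have ib: "integrable lebesgue (\<lambda>y. w p q k l y * X S p' j y * X (T n) p'' j' y)"
    "integrable lebesgue (\<lambda>y. w p q k l y * X S p' j y * X S p'' j' y)" for p q k l p' j p'' j' n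
    by (rule integrable_mult_bounded[OF Xi \<phi>m \<phi>b] integrable_mult_bounded[OF XiS \<phi>m \<phi>b])+
  have sum1: "(\<integral>y. E A S y \<partial>lebesgue)
      = (\<Sum>p\<in>UNIV. \<Sum>q\<in>UNIV. \<Sum>k\<in>UNIV. \<Sum>l\<in>UNIV. \<integral>y. w p q k l y * X S q l y * X A p k y \<partial>lebesgue)"
    if "\<And>p q k l. integrable lebesgue (\<lambda>y. w p q k l y * X S q l y * X A p k y)" for A
    unfolding EX using that by
        (simp add: Bochner_Integration.integral_sum Bochner_Integration.integrable_sum mult.assoc
        mult.commute[of "X A _ _ _"])
  have sum2: "(\<integral>y. E S A y \<partial>lebesgue)
      = (\<Sum>p\<in>UNIV. \<Sum>q\<in>UNIV. \<Sum>k\<in>UNIV. \<Sum>l\<in>UNIV. \<integral>y. w p q k l y * X S p k y * X A q l y \<partial>lebesgue)"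
    if "\<And>p q k l. integrable lebesgue (\<lambda>y. w p q k l y * X S p k y * X A q l y)" for A
    unfolding EX using that by (simp add: Bochner_Integration.integral_sum Bochner_Integration.integrable_sum)
  have II: "(\<lambda>n. \<integral>y. E (T n) S y \<partial>lebesgue) \<longlonglongrightarrow> (\<integral>y. E S S y \<partial>lebesgue)"
    unfolding sum1[OF ib(1)] sum1[OF ib(2)] by (intro tendsto_sum weak')
  have III: "(\<lambda>n. \<integral>y. E S (T n) y \<partial>lebesgue) \<longlonglongrightarrow> (\<integral>y. E S S y \<partial>lebesgue)"
    unfolding sum2[OF ib(1)] sum2[OF ib(2)] by (intro tendsto_sum weak')
  \<comment> \<open>The norms of \<open>T n y\<close> converge only with respect to the metric at \<open>vs n
      (chart_inv c y)\<close>; the error made by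
     using the one at \<open>u (chart_inv c y)\<close> instead vanishes since the matrices are bounded on \<open>P\<close>.\<close>
  have I: "(\<lambda>n. \<integral>y. E (T n) (T n) y \<partial>lebesgue) \<longlonglongrightarrow> (\<integral>y. E S S y \<partial>lebesgue)"
  proof (rule integral_dominated_convergence[where w="\<lambda>y. Z * indicator P y"])
    show "E S S \<in> borel_measurable lebesgue" "E (T n) (T n) \<in> borel_measurable lebesgue" for n using E1
        by (auto intro: borel_measurable_integrable)
    show "integrable lebesgue (\<lambda>y. Z * indicator P y)" using iP by auto
    show "AE y in lebesgue. norm (E (T n) (T n) y) \<le> Z * indicator P y" for n
      unfolding real_norm_def by (intro AE_I2 EZ Tb)
    show "AE y in lebesgue. (\<lambda>n. E (T n) (T n) y) \<longlonglongrightarrow> E S S y"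
      using ae_v ae_h
    proof eventually_elim
      case (elim y)
      show ?case
      proof (cases "y \<in> P")
        case True
        let ?x = "chart_inv c y"
        have yI: "y \<in> chart_image c" "y \<in> ?B" using True PI PB by auto
        have v: "(\<lambda>n. vs n ?x) \<longlonglongrightarrow> u ?x" and hl: "(\<lambda>n. hs n y) \<longlonglongrightarrow> h y" using elim yI by auto
        have ev: "eventually (\<lambda>n. vs n ?x \<in> W) sequentially"
            using topological_tendstoD[OF v fD(2) PW[OF True]] .
        define A where "A n = N.gram e (vs n ?x)" for n
        have Al: "A \<longlonglongrightarrow> G y"
          unfolding A_def G_def
          using continuous_on_tendsto_compose[OF continuous_on_subset[OF N.gram_cont[OF fD(1)] fD(3)] v
              PW[OF True] ev] by simp
        have sS: "hs_product (G y) (V y) (S y) (S y) = (h y)\<^sup>2"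
          unfolding G_def V_def S_def h
              by (rule test_matrix_hs[where v=u and c=c and y=y, OF f PW[OF True] c yI(1)])
        have sT: "hs_product (A n) (V y) (T n y) (T n y) = (hs n y)\<^sup>2" if "vs n ?x \<in> W" for n
          unfolding A_def V_def T_def hs
              by (rule test_matrix_hs[where v="vs n" and c=c and y=y, OF f that c yI(1)])
        define \<alpha> where "\<alpha> n = (\<Sum>p\<in>UNIV. \<Sum>q\<in>UNIV. \<bar>(G y - A n) $ p $ q\<bar>)" for n
        have \<alpha>b: "\<bar>(G y - A n) $ p $ q\<bar> \<le> \<alpha> n" for n p q
          unfolding \<alpha>_def
          by (rule order_trans[OF member_le_sum[of q UNIV "\<lambda>q. \<bar>(G y
              - A n) $ p $ q\<bar>"] member_le_sum[of p UNIV "\<lambda>p. \<Sum>q\<in>UNIV. \<bar>(G y - A n) $ p $ q\<bar>"]])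
             (auto intro: sum_nonneg)
        have "\<alpha> \<longlonglongrightarrow> (\<Sum>p\<in>(UNIV::'n set). \<Sum>q\<in>(UNIV::'n set). \<bar>(G y - G y) $ p $ q\<bar>)"
          unfolding \<alpha>_def by (intro tendsto_intros Al)
        then have \<alpha>l: "\<alpha> \<longlonglongrightarrow> 0" by simp
        have db: "\<bar>hs_product (G y - A n) (V y) (T n y) (T n y)\<bar>
            \<le> (real CARD('n))\<^sup>2 * (real CARD('m))\<^sup>2 * (\<alpha> n * m * (C * m) * (C * m))" for n
          by (rule hs_product_bound) (use \<alpha>b PV[OF True] Tb[OF True] in \<open>auto simp: V_def\<close>)
        have "(\<lambda>n. (real CARD('n))\<^sup>2 * (real CARD('m))\<^sup>2 * (\<alpha> n * m * (C * m) * (C * m))) \<longlonglongrightarrow>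
            (real CARD('n))\<^sup>2 * (real CARD('m))\<^sup>2 * (0 * m * (C * m) * (C * m))"
          by (intro tendsto_intros \<alpha>l)
        then have l0: "(\<lambda>n. (real CARD('n))\<^sup>2 * (real CARD('m))\<^sup>2 * (\<alpha> n * m * (C * m) * (C * m))) \<longlonglongrightarrow> 0"
            by simp
        have "(\<lambda>n. hs_product (G y - A n) (V y) (T n y) (T n y)) \<longlonglongrightarrow> 0"
          by (rule Lim_null_comparison[OF always_eventually l0]) (simp only: real_norm_def db simp_thms)
        then have "(\<lambda>n. (hs n y)\<^sup>2 + hs_product (G y - A n) (V y) (T n y) (T n y)) \<longlonglongrightarrow> (h y)\<^sup>2 + 0"
          by (intro tendsto_intros hl)
        moreover have "eventually (\<lambda>n. (hs n y)\<^sup>2 + hs_product (G y - A n) (V y) (T n y) (T n y)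
            = hs_product (G y) (V y) (T n y) (T n y)) sequentially"
          using ev by eventually_elim (simp add: sT[symmetric] hs_product_diff_left[symmetric])
        ultimately have "(\<lambda>n. hs_product (G y) (V y) (T n y) (T n y)) \<longlonglongrightarrow> (h y)\<^sup>2 + 0"
          by (rule Lim_transform_eventually)
        then have "(\<lambda>n. hs_product (G y) (V y) (T n y) (T n y)) \<longlonglongrightarrow> hs_product (G y) (V y) (S y) (S y)"
          unfolding sS by simp
        then show ?thesis using True by (simp add: E_def)
      qed (simp add: E_def)
    qed
  qed
  have Qe: "Q n y = E (T n) (T n) y - E (T n) S y - E S (T n) y + E S S y" for n y
    unfolding Q_def E_def T_def[symmetric] S_def[symmetric] G_def[symmetric] V_def[symmetric] hs_product_diff
    by (simp add: algebra_simps)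
  have Qi: "integrable lebesgue (Q n)" for n unfolding Qe[abs_def] using E1 by auto
  then show "Q n \<in> borel_measurable lebesgue" for n by (rule borel_measurable_integrable)
  show Q0: "0 \<le> Q n y" for n y
  proof (cases "y \<in> P")
    case True
    have "chart_inv c y \<in> fst c" "u (chart_inv c y) \<in> fst e" using True PI M.inv_into_dom[OF c] PW fD(3)
        by blast+
    from hs_product_gram_nonneg[OF c this(1) fD(1) this(2)] show ?thesis by (simp add: Q_def)
  qed (simp add: Q_def)
  \<comment> \<open>Four equal limits with the signs +, -, -, + cancel.\<close>
  have "(\<lambda>n. (\<integral>y. E (T n) (T n) y \<partial>lebesgue) - (\<integral>y. E (T n) S y \<partial>lebesgue) - (\<integral>y. E S (T n) y \<partial>lebesgue)
      + (\<integral>y. E S S y \<partial>lebesgue)) \<longlonglongrightarrow>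
     (\<integral>y. E S S y \<partial>lebesgue) - (\<integral>y. E S S y \<partial>lebesgue) - (\<integral>y. E S S y \<partial>lebesgue) + (\<integral>y. E S S y \<partial>lebesgue)"
    by (intro tendsto_intros I II III)
  moreover have "(\<integral>y. Q n y \<partial>lebesgue)
      = (\<integral>y. E (T n) (T n) y \<partial>lebesgue) - (\<integral>y. E (T n) S y \<partial>lebesgue) - (\<integral>y. E S (T n) y \<partial>lebesgue)
      + (\<integral>y. E S S y \<partial>lebesgue)" for n
    unfolding Qe using E1 by simp
  ultimately have "(\<lambda>n. \<integral>y. Q n y \<partial>lebesgue) \<longlonglongrightarrow> 0" by simp
  then have "(\<lambda>n. ennreal (\<integral>y. Q n y \<partial>lebesgue)) \<longlonglongrightarrow> ennreal 0" by (rule tendsto_ennrealI)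
  moreover have "(\<integral>\<^sup>+y. ennreal (Q n y) \<partial>lebesgue) = ennreal (\<integral>y. Q n y \<partial>lebesgue)" for n
    by (rule nn_integral_eq_integral[OF Qi]) (use Q0 in auto)
  ultimately show "(\<lambda>n. \<integral>\<^sup>+y. ennreal (Q n y) \<partial>lebesgue) \<longlonglongrightarrow> 0" by simp
qed

end

section \<open>Strong convergence\<close>

context riemannian_pair
begin

text \<open>The bundle coordinates of a linear map are its coordinate matrix; this lets openness in
  \<open>hom_topology\<close> be tested on matrices.\<close>

lemma hom_param_coord_matrix:
  assumes c: "c \<in> M" "y \<in> chart_image c" and e: "e \<in> N" "z \<in> fst e"
  shows "hom_param M N c e (y, snd e z, Blinfun ((*v) (coord_matrix M N c e (chart_inv c y) z \<xi>)))
      = (chart_inv c y, z, \<xi>)"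
proof -
  let ?x = "chart_inv c y"
  have x: "?x \<in> fst c" by (rule M.inv_into_dom[OF c])
  have B: "blinfun_apply (Blinfun ((*v) A)) = (*v) A" for A :: "real ^ 'm ^ 'n"
    by (simp add: bounded_linear_Blinfun_apply linear_conv_bounded_linear[symmetric])
  have "coord_matrix M N c e ?x z \<xi> *v w = chart_diff N e z (\<xi> (inv (chart_diff M c ?x) w))" for w
    unfolding linear_eq_sum_axis[OF coord_linear[OF c(1) x e, of \<xi>], of w]
    by (simp add: coord_matrix_def matrix_vector_mult_def matrix_def vec_eq_iff mult.commute)
  then have "Blinfun (\<lambda>v. inv (chart_diff N e z) (coord_matrix M N c e ?x z \<xi> *v chart_diff M c ?x v)) = \<xi>"
    using c x e by (simp add: blinfun_apply_inverse)
  then show ?thesis using e by (simp add: hom_param_def B)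
qed

text \<open>Convergence of base points and matrix entries is convergence in a single bundle chart,
  where the preimage of \<open>U\<close> is open. Finitely many of the maps may still send the point
  outside \<open>W\<close>, hence only eventual membership is used.\<close>

lemma section_convergence:
  assumes c: "c \<in> M" "y \<in> chart_image c" and f: "coord_functions N gN e W f L" and z: "u (chart_inv c y) \<in> W"
    and v: "(\<lambda>n. vs n (chart_inv c y)) \<longlonglongrightarrow> u (chart_inv c y)"
    and T: "\<And>p j. (\<lambda>n. test_matrix M N c f (vs n) (Ds n) y $ p $ j) \<longlonglongrightarrow> test_matrix M N c f u D y $ p $ j"
    and U: "hom_open M N U" "bundle_section u D (chart_inv c y) \<in> U"
  shows "eventually (\<lambda>n. bundle_section (vs n) (Ds n) (chart_inv c y) \<in> U) sequentially"
proof -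
  let ?x = "chart_inv c y"
  have e: "e \<in> N" "open W" "W \<subseteq> fst e" using f by (auto simp: coord_functions_def)
  have B: "blinfun_apply (Blinfun ((*v) A)) = (*v) A" for A :: "real ^ 'm ^ 'n"
    by (simp add: bounded_linear_Blinfun_apply linear_conv_bounded_linear[symmetric])
  have ev: "eventually (\<lambda>n. vs n ?x \<in> W) sequentially" using topological_tendstoD[OF v e(2) z] .
  let ?q = "\<lambda>w E. (y, snd e (w ?x), Blinfun ((*v) (test_matrix M N c f w E y)))"
  have q: "hom_param M N c e (?q w E) = bundle_section w E ?x" if "w ?x \<in> W" for w E
    unfolding test_matrix_eq_coord[where v=w and c=c and y=y, OF f that] bundle_section_def
    by (rule hom_param_coord_matrix[OF c e(1)]) (use that e(3) in blast)
  let ?O = "hom_param M N c e -` U \<inter> (chart_image c \<times> chart_image e \<times> UNIV)"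
  have O: "open ?O" using U(1) c(1) e(1) by (simp add: hom_open_def)
  have dom: "?q w E \<in> chart_image c \<times> chart_image e \<times> UNIV" if "w ?x \<in> W" for w E
    using that e(3) c N.chart_into[OF e(1)] by auto
  have lim: "(\<lambda>n. ?q (vs n) (Ds n)) \<longlonglongrightarrow> ?q u D"
  proof (intro tendsto_Pair tendsto_const)
    show "(\<lambda>n. snd e (vs n ?x)) \<longlonglongrightarrow> snd e (u ?x)"
      by (rule continuous_on_tendsto_compose[OF continuous_on_subset[OF N.chart_cont[OF e(1)] e(3)] v z ev])
    show "(\<lambda>n. Blinfun ((*v) (test_matrix M N c f (vs n) (Ds n) y))) \<longlonglongrightarrow>
        Blinfun ((*v) (test_matrix M N c f u D y))"
    \<comment> \<open>On a finite-dimensional space convergence of linear maps may be checked on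
      basis vectors.\<close>
    proof (rule tendsto_componentwise1)
      fix j :: "real ^ 'm" assume "j \<in> Basis"
      show "(\<lambda>n. blinfun_apply (Blinfun ((*v) (test_matrix M N c f (vs n) (Ds n) y))) j) \<longlonglongrightarrow>
          blinfun_apply (Blinfun ((*v) (test_matrix M N c f u D y))) j"
        unfolding B by (rule vec_tendstoI) (simp add: matrix_vector_mult_def, intro tendsto_intros T)
    qed
  qed
  have "?q u D \<in> ?O" using dom[where w=u and E=D, OF z] q[where w=u and E=D, OF z] U(2) by simp
  from topological_tendstoD[OF lim O this] ev show ?thesis
    by eventually_elim (use q in auto)
qed

text \<open>Lindelof again: the neighbourhoods are selected as a countable family of sets, and their
  charts and functions are chosen afterwards.\<close>

lemma countable_coord_functions:
  obtains e W f L where "\<And>k::nat. coord_functions N gN (e k) (W k) (f k) (L k)" "(\<Union>k. W k) = UNIV"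
proof -
  have ex: "\<exists>e W f L. coord_functions N gN e W f L \<and> z \<in> W" for z
  proof -
    let ?e = "ref_chart N z"
    obtain W f L where "open W" "z \<in> W" "W \<subseteq> fst ?e" "0 \<le> L"
    "\<And>i :: 'n. f i \<in> C1c_functions N" "\<And>i. bounded (range (f i))"
    "\<And>i y v. \<bar>mdiff N (f i) y v\<bar> \<le> L * sqrt (gN y v v)"
    "\<And>i y v. y \<in> W \<Longrightarrow> mdiff N (f i) y v = chart_diff N ?e y v $ i"
      using N.coordinate_functions[OF N.ref_chart] by metis
    then have "coord_functions N gN ?e W f L \<and> z \<in> W" using N.ref_chart(1) by (simp add: coord_functions_def)
    then show ?thesis by blast
  qed
  define F' where "F' = {W. \<exists>e f L. coord_functions N gN e W f L}"
  have op: "open S" if "S \<in> F'" for S using that by (auto simp: F'_def coord_functions_def)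
  obtain F where F: "F \<subseteq> F'" "countable F" "\<Union>F = \<Union>F'" using Lindelof[of F'] op by blast
  have "z \<in> \<Union>F'" for z using ex[of z] unfolding F'_def by blast
  then have FU: "\<Union>F = UNIV" using F(3) by (metis UNIV_eq_I)
  then have "F \<noteq> {}" by auto
  then have rF: "range (from_nat_into F) = F" using F(2) by (rule range_from_nat_into)
  have "\<exists>e f L. coord_functions N gN e (from_nat_into F k) f L" for k using rF F(1) unfolding F'_def by blast
  then obtain e f L where "\<And>k. coord_functions N gN (e k) (from_nat_into F k) (f k) (L k)" by metis
  moreover have "(\<Union>k. from_nat_into F k) = UNIV" using rF FU by simp
  ultimately show ?thesis by (rule that)
qed

text \<open>The projection of the bundle to \<open>N\<close> is continuous, so every open set of
  \<open>N\<close> yields an open set of the bundle to test with.\<close>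

lemma base_map_converges_locally_in_measure:
  assumes "converges_locally_in_measure M (hom_topology M N) (\<lambda>l. bundle_section (us l) (Ds l))
      (bundle_section u D)"
  shows "converges_locally_in_measure M euclidean us u"
  unfolding converges_locally_in_measure_def
proof
  fix x
  obtain c where c: "c \<in> M" "x \<in> fst c" and lim: "\<And>U. openin (hom_topology M N) U \<Longrightarrow>
      (\<lambda>l. emeasure lebesgue (snd c ` ((bundle_section u D -` U \<inter> fst c)
          - bundle_section (us l) (Ds l) -` U))) \<longlonglongrightarrow> 0"
    using assms unfolding converges_locally_in_measure_def by blast
  have "(\<lambda>l. emeasure lebesgue (snd c ` ((u -` U \<inter> fst c) - us l -` U))) \<longlonglongrightarrow> 0" if U: "openin euclidean U" for U
  proof -
    let ?U = "{p :: ('a, 'b, 'm, 'n) hom_bundle. fst (snd p) \<in> U}"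
    have "hom_open M N ?U"
      unfolding hom_open_def
    proof (intro ballI)
      fix c' e assume ce: "c' \<in> M" "e \<in> N"
      have "hom_param M N c' e -` ?U \<inter> (chart_image c' \<times> chart_image e \<times> UNIV)
        = chart_image c' \<times> (chart_image e \<inter> chart_inv e -` U) \<times> UNIV"
        by (auto simp: hom_param_def)
      moreover have "open (chart_image c' \<times> (chart_image e \<inter> chart_inv e -` U) \<times> (UNIV :: ((real ^ 'm) \<Rightarrow>\<^sub>L
          (real ^ 'n)) set))"
        using U by (intro open_Times M.image_open[OF ce(1)] open_chart_preimage[OF N.top_chart[OF ce(2)]]
            open_UNIV) simp
      ultimately show "open (hom_param M N c' e -` ?U \<inter> (chart_image c' \<times> chart_image e \<times> UNIV))" by simp
    qed
    then have "openin (hom_topology M N) ?U" by (simp add: openin_hom_topology)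
    from lim[OF this] show ?thesis by (simp add: bundle_section_def vimage_def)
  qed
  then show "\<exists>c\<in>M. x \<in> fst c \<and> (\<forall>U. openin euclidean U \<longrightarrow>
      (\<lambda>l. emeasure lebesgue (snd c ` (u -` U \<inter> fst c - us l -` U))) \<longlonglongrightarrow> 0)" using c by blast
qed

text \<open>Almost every point of the ball lies in some set \<open>P k m\<close>: its image is in
  some \<open>W k\<close>, and a convergent sequence of norms is bounded. These sets are countably
  many, so one diagonal subsequence makes the energy density tend to 0 almost everywhere on all of
  them.\<close>

lemma AE_eventually_section:
  assumes c: "c \<in> M" and r: "0 < r" "r < R" and K: "cball a R \<subseteq> chart_image c"
    and vs: "\<And>n::nat. has_colocal_weak_derivative M N (vs n) (Ds n)"
    and u: "has_colocal_weak_derivative M N u D" "measurable_map M euclidean u"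
    and hs: "\<And>n y. hs n y = hs_norm (gM (chart_inv c y)) (gN (vs n (chart_inv c y))) (Ds n (chart_inv c y))"
    and h: "\<And>y. h y = hs_norm (gM (chart_inv c y)) (gN (u (chart_inv c y))) (D (chart_inv c y))"
    and hs_int: "\<And>n. integrable lebesgue (\<lambda>y. indicator (cball a R) y * hs n y)"
    and h_int: "integrable lebesgue (\<lambda>y. indicator (cball a R) y * h y)"
    and hs_lim: "(\<lambda>n. \<integral>y. \<bar>indicator (cball a R) y * hs n y - indicator (cball a R) y * h y\<bar> \<partial>lebesgue) \<longlonglongrightarrow> 0"
    and ae_v: "AE y in lebesgue. y \<in> chart_image c \<longrightarrow> (\<lambda>n. vs n (chart_inv c y)) \<longlonglongrightarrow> u (chart_inv c y)"
    and ae_h: "AE y in lebesgue. y \<in> cball a R \<longrightarrow> (\<lambda>n. hs n y) \<longlonglongrightarrow> h y"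
  obtains s :: "nat \<Rightarrow> nat" where "strict_mono s"
    "AE y in lebesgue. y \<in> ball a r \<longrightarrow> (\<forall>U. hom_open M N U \<longrightarrow> bundle_section u D (chart_inv c y) \<in> U \<longrightarrow>
       eventually (\<lambda>n. bundle_section (vs (s n)) (Ds (s n)) (chart_inv c y) \<in> U) sequentially)"
proof -
  let ?B = "cball a R"
  obtain e W f L where f: "\<And>k::nat. coord_functions N gN (e k) (W k) (f k) (L k)" and WU: "(\<Union>k. W k) = UNIV"
    using countable_coord_functions by metis
  have fD: "e k \<in> N" "open (W k)" "W k \<subseteq> fst (e k)" for k using f[of k] by (auto simp: coord_functions_def)
  have BI: "ball a r \<subseteq> chart_image c" and BB: "ball a r \<subseteq> ?B" using r K by (auto simp: subset_iff)
  define S where "S k = {y \<in> ball a r. u (chart_inv c y) \<in> W k}" for k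
  define G where "G k y = N.gram (e k) (u (chart_inv c y))" for k y
  define V where "V y = matrix_inv (M.gram c (chart_inv c y))" for y
  \<comment> \<open>One bound for all \<open>n\<close>, as the dominating function in
    \<open>energy_convergence\<close> must not depend on \<open>n\<close>.\<close>
  define P where "P k m = {y \<in> S k. (\<forall>n. hs n y \<le> real m) \<and> h y \<le> real m \<and> (\<forall>p q. \<bar>G k y $ p $ q\<bar>
      \<le> real m) \<and> (\<forall>p q. \<bar>V y $ p $ q\<bar> \<le> real m)}" for k and m :: nat
  have Sm: "S k \<in> sets lebesgue" for k
  proof -
    have "u -` W k \<in> lebesgue_sets M" using u(2) fD(2) by (simp add: measurable_map_def)
    then have "chart_image c \<inter> chart_inv c -` (u -` W k) \<in> sets lebesgue" using c
        by (simp add: M.lebesgue_sets_iff)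
    then have "ball a r \<inter> (chart_image c \<inter> chart_inv c -` (u -` W k)) \<in> sets lebesgue"
        by (rule sets.Int[rotated]) simp
    also have "ball a r \<inter> (chart_image c \<inter> chart_inv c -` (u -` W k)) = S k" using BI by (auto simp: S_def)
    finally show ?thesis .
  qed
  have SI: "S k \<subseteq> chart_image c" "S k \<subseteq> ?B" for k using BI BB by (auto simp: S_def)
  have SW: "u (chart_inv c y) \<in> W k" if "y \<in> S k" for y k using that by (simp add: S_def)
  have Gm: "(\<lambda>y. indicator (S k) y * G k y $ p $ q) \<in> borel_measurable lebesgue" for k p q
    unfolding G_def by (rule gram_along_map_measurable[OF u(2) c fD Sm SI(1) SW])
  have Vm: "(\<lambda>y. indicator (S k) y * V y $ p $ q) \<in> borel_measurable lebesgue" for k p q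
    unfolding V_def by (rule indicator_mult_measurable_lebesgue[OF M.matrix_inv_gram_cont[OF c] SI(1) Sm])
  have Pm: "P k m \<in> sets lebesgue" for k m
  proof -
    have 1: "{y. F y \<le> real m} \<in> sets lebesgue" if "F \<in> borel_measurable lebesgue" for F :: "real ^ 'm \<Rightarrow> real"
      using borel_measurable_le[OF that borel_measurable_const, of "real m"] by simp
    have 2: "{y. \<bar>F y\<bar> \<le> real m} \<in> sets lebesgue" if "F \<in> borel_measurable lebesgue"
        for F :: "real ^ 'm \<Rightarrow> real"
      using 1[of "\<lambda>y. \<bar>F y\<bar>"] that by simp
    have eq: "P k m = S k \<inter> (\<Inter>n. {y. indicator ?B y * hs n y \<le> real m}) \<inter> {y. indicator ?B y * h y \<le> real m}
      \<inter> (\<Inter>p. \<Inter>q. {y. \<bar>indicator (S k) y * G k y $ p $ q\<bar>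
          \<le> real m}) \<inter> (\<Inter>p. \<Inter>q. {y. \<bar>indicator (S k) y * V y $ p $ q\<bar> \<le> real m})"
    proof (rule set_eqI)
      fix y show "y \<in> P k m \<longleftrightarrow>
          y \<in> S k \<inter> (\<Inter>n. {y. indicator ?B y * hs n y \<le> real m}) \<inter> {y. indicator ?B y * h y \<le> real m}
        \<inter> (\<Inter>p. \<Inter>q. {y. \<bar>indicator (S k) y * G k y $ p $ q\<bar>
            \<le> real m}) \<inter> (\<Inter>p. \<Inter>q. {y. \<bar>indicator (S k) y * V y $ p $ q\<bar> \<le> real m})"
        using SI(2)[of k] by (cases "y \<in> S k") (auto simp: P_def subset_iff)
    qed
    show ?thesis unfolding eq
      by (intro sets.Int Sm sets.countable_INT'' sets.finite_INT 1 2 Gm Vm borel_measurable_integrable[OF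
          hs_int] borel_measurable_integrable[OF h_int]) auto
  qed
  define T where "T k n = test_matrix M N c (f k) (vs n) (Ds n)" for k n
  define Tu where "Tu k = test_matrix M N c (f k) u D" for k
  define Q where "Q k m n y = indicator (P k m) y * hs_product (G k y) (V y) (T k n y - Tu k y) (T k n y
      - Tu k y)" for k m n y
  have QE: "Q k m n \<in> borel_measurable lebesgue" "0
      \<le> Q k m n y" "(\<lambda>n. \<integral>\<^sup>+y. ennreal (Q k m n y) \<partial>lebesgue) \<longlonglongrightarrow> 0" for k m n y
  proof -
    have P': "P k m \<subseteq> ball a r" by (auto simp: P_def S_def)
    note E = energy_convergence[OF c r K f[of k] vs u hs h hs_int h_int hs_lim ae_v ae_h Pm[of k m] P', of
        "real m"]
    show "Q k m n \<in> borel_measurable lebesgue" unfolding Q_def[abs_def] G_def V_def T_def Tu_def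
      by (rule E(1)) (auto simp: P_def S_def G_def V_def)
    show "0 \<le> Q k m n y" unfolding Q_def G_def V_def T_def Tu_def
      by (rule E(2)) (auto simp: P_def S_def G_def V_def)
    show "(\<lambda>n. \<integral>\<^sup>+y. ennreal (Q k m n y) \<partial>lebesgue) \<longlonglongrightarrow> 0" unfolding Q_def G_def V_def T_def Tu_def
      by (rule E(3)) (auto simp: P_def S_def G_def V_def)
  qed
  obtain s where s: "strict_mono s"
    and Q0: "AE y in lebesgue. \<forall>i. (\<lambda>n. Q (fst (prod_decode i)) (snd (prod_decode i)) (s n) y) \<longlonglongrightarrow> 0"
    by (rule countable_AE_subsequence[of "\<lambda>i n. Q (fst (prod_decode i)) (snd
        (prod_decode i)) n" lebesgue]) (use QE in auto)
  have "AE y in lebesgue. y \<in> ball a r \<longrightarrow> (\<forall>U. hom_open M N U \<longrightarrow> bundle_section u D (chart_inv c y) \<in> U \<longrightarrow>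
       eventually (\<lambda>n. bundle_section (vs (s n)) (Ds (s n)) (chart_inv c y) \<in> U) sequentially)"
    using Q0 ae_v ae_h
  proof eventually_elim
    case (elim y)
    show ?case
    proof (intro impI allI)
      fix U assume y: "y \<in> ball a r" and U: "hom_open M N U" "bundle_section u D (chart_inv c y) \<in> U"
      have yI: "y \<in> chart_image c" and yB: "y \<in> ?B" using y BI BB by auto
      have v: "(\<lambda>n. vs n (chart_inv c y)) \<longlonglongrightarrow> u (chart_inv c y)" and hl: "(\<lambda>n. hs n y) \<longlonglongrightarrow> h y"
          using elim yI yB by auto
      obtain k where k: "u (chart_inv c y) \<in> W k" using WU by blast
      obtain b where b: "\<And>n. hs n y \<le> b"
      proof -
        have "Bseq (\<lambda>n. hs n y)" using hl by (intro convergent_imp_Bseq convergentI)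
        then obtain b where "\<And>n. norm (hs n y) \<le> b" unfolding Bseq_def by blast
        then show ?thesis by (intro that[of b]) (auto dest: abs_le_D1)
      qed
      obtain m :: nat where m: "max (max b (h y)) (max (norm (G k y)) (norm (V y))) \<le> real m"
          using real_arch_simple by blast
      have Gb: "\<bar>G k y $ p $ q\<bar> \<le> real m" for p q
        using order_trans[OF component_le_norm_cart[of "G k y $ p" q]
            Finite_Cartesian_Product.norm_nth_le[of "G k y" p]] m by simp
      have Vb: "\<bar>V y $ p $ q\<bar> \<le> real m" for p q
        using order_trans[OF component_le_norm_cart[of "V y $ p" q]
            Finite_Cartesian_Product.norm_nth_le[of "V y" p]] m by simp
      have "hs n y \<le> real m" for n using b[of n] m by simp
      then have yP: "y \<in> P k m" using y k m Gb Vb by (simp add: P_def S_def)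
      have "(\<lambda>n. Q k m (s n) y) \<longlonglongrightarrow> 0" using elim(1)[rule_format, of "prod_encode (k, m)"] by simp
      then have q: "(\<lambda>n. sqrt (hs_product (G k y) (V y) (T k (s n) y - Tu k y) (T k (s n) y - Tu k y))) \<longlonglongrightarrow>
          sqrt 0"
        using yP by (intro tendsto_real_sqrt) (simp add: Q_def)
      have x: "chart_inv c y \<in> fst c" "u (chart_inv c y) \<in> fst (e k)"
          using M.inv_into_dom[OF c yI] k fD(3) by auto
      obtain C where C: "\<And>A p j. \<bar>A $ p $ j\<bar> \<le> C * sqrt (hs_product (G k y) (V y) A A)"
        using hs_product_gram_bounds[OF c x(1) fD(1) x(2)] unfolding G_def V_def by metis
      have "(\<lambda>n. test_matrix M N c (f k) (vs (s n)) (Ds (s n)) y $ p $ j) \<longlonglongrightarrow>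
          test_matrix M N c (f k) u D y $ p $ j" for p j
      proof -
        have l0: "(\<lambda>n. C * sqrt (hs_product (G k y) (V y) (T k (s n) y - Tu k y) (T k (s n) y - Tu k y))) \<longlonglongrightarrow> 0"
          using tendsto_mult_left[OF q, of C] by simp
        have "(\<lambda>n. (T k (s n) y - Tu k y) $ p $ j) \<longlonglongrightarrow> 0"
          by (rule Lim_null_comparison[OF always_eventually l0]) (simp only: real_norm_def C simp_thms)
        then have "(\<lambda>n. T k (s n) y $ p $ j - Tu k y $ p $ j) \<longlonglongrightarrow> 0" by simp
        from LIM_zero_cancel[OF this] show ?thesis by (simp add: T_def Tu_def)
      qed
      moreover have "(\<lambda>n. vs (s n) (chart_inv c y)) \<longlonglongrightarrow> u (chart_inv c y)"
        using LIMSEQ_subseq_LIMSEQ[OF v s] by (simp add: o_def)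
      ultimately show "eventually (\<lambda>n. bundle_section (vs (s n)) (Ds (s n)) (chart_inv c y) \<in> U) sequentially"
        using section_convergence[where u=u and vs="\<lambda>n. vs (s n)"
            and Ds="\<lambda>n. Ds (s n)", OF c yI f[of k] k _ _ U] by blast
    qed
  qed
  then show ?thesis using that s by blast
qed

end

section \<open>The equivalence\<close>

locale sobolev_setting = riemannian_pair M gM N gN + ac_measure M \<mu>
  for M :: "('a::{t2_space, second_countable_topology}, 'm::finite) chart set"
    and gM and N :: "('b::{t2_space, second_countable_topology}, 'n::finite) chart set" and gN and \<mu>
begin

text \<open>Three successive subsequences are extracted: for the maps, for the norms of the
  derivatives, and for the energies. The last gives eventual membership in \<open>U\<close> almost
  everywhere, and the finite volume of a coordinate ball turns this into convergence of
  measures.\<close>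

lemma bundle_converges_locally_in_measure:
  assumes p: "1 \<le> p" and us: "\<And>l. us l \<in> sobolev_maps M gM N gN p" and u: "u \<in> sobolev_maps M gM N gN p"
    and sub: "\<And>s :: nat \<Rightarrow> nat. strict_mono s \<Longrightarrow>
        \<exists>s' :: nat \<Rightarrow> nat. strict_mono s' \<and> (AE x in completion \<mu>. (\<lambda>n. us (s (s' n)) x) \<longlonglongrightarrow> u x)"
    and lim: "(\<lambda>l. (\<integral>x. \<bar>deriv_norm M gM N gN (us l) x
        - deriv_norm M gM N gN u x\<bar> powr p \<partial>riemannian_measure M gM) powr (1 / p)) \<longlonglongrightarrow> 0"
  shows "converges_locally_in_measure M (hom_topology M N)
       (\<lambda>l. bundle_section (us l) (colocal_weak_derivative M N (us l))) (bundle_section u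
           (colocal_weak_derivative M N u))"
  unfolding converges_locally_in_measure_def openin_hom_topology
proof
  fix x
  define w where "w v = bundle_section v (colocal_weak_derivative M N v)" for v :: "'a \<Rightarrow> 'b"
  let ?c = "ref_chart M x" and ?D = "colocal_weak_derivative M N"
  have c: "?c \<in> M" "x \<in> fst ?c" by (rule M.ref_chart)+
  let ?a = "snd ?c x"
  obtain R where R: "0 < R" "cball ?a R \<subseteq> chart_image ?c"
    using M.image_open[OF c(1)] M.chart_into[OF c] open_contains_cball by blast
  \<comment> \<open>The larger ball carries integrability and the supports of test functions, the
    smaller one the sets to be measured; \<open>weak_convergence_bounded_measurable\<close> needs a
    gap between the two.\<close>
  let ?r = "R / 2"
  have r: "0 < ?r" "?r < R" using R by auto
  let ?V = "fst ?c \<inter> snd ?c -` ball ?a ?r"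
  have V: "open ?V" by (rule open_chart_preimage'[OF M.top_chart[OF c(1)] open_ball])
  have usD: "has_colocal_weak_derivative M N (us l) (?D (us l))" "in_Lp (riemannian_measure M gM) p
      (deriv_norm M gM N gN (us l))" for l
    using us[of l] by (auto simp: sobolev_maps_def)
  have uD: "has_colocal_weak_derivative M N u (?D u)" "in_Lp (riemannian_measure M gM) p
      (deriv_norm M gM N gN u)" "measurable_map M euclidean u"
    using u by (auto simp: sobolev_maps_def colocally_weakly_differentiable_def)
  define H where "H v y = deriv_norm M gM N gN v (chart_inv ?c y)" for v :: "'a \<Rightarrow> 'b" and y
  note L1 = M.Lp_imp_L1_coord[OF c(1) R(2,1) p uD(2) usD(2) lim, folded H_def]
  have "(\<lambda>l. emeasure lebesgue (snd ?c ` ((w u -` U \<inter> ?V) - w (us l) -` U))) \<longlonglongrightarrow> 0" if U: "hom_open M N U" for U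
  proof (rule tendsto_if_subsequences)
    fix s :: "nat \<Rightarrow> nat" assume s: "strict_mono s"
    obtain s1 where s1: "strict_mono s1" "AE x in completion \<mu>. (\<lambda>n. us (s (s1 n)) x) \<longlonglongrightarrow> u x"
        using sub[OF s] by blast
    have ss1: "strict_mono (\<lambda>n. s (s1 n))" using strict_mono_o[OF s s1(1)] by (simp add: o_def)
    \<comment> \<open>Null sets of the completed \<open>\<mu>\<close> are those of Lebesgue measure
      in charts, so the exceptional set stays negligible in coordinates.\<close>
    have ae1: "AE y in lebesgue. y \<in> chart_image ?c \<longrightarrow> (\<lambda>n. us (s (s1 n)) (chart_inv ?c y)) \<longlonglongrightarrow>
        u (chart_inv ?c y)"
      using M.almost_everywhere_coord[OF _ c(1)] s1(2) unfolding AE_completion_iff_almost_everywhere by blast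
    define q where "q n y = \<bar>indicator (cball ?a R) y * H (us (s (s1 n))) y
        - indicator (cball ?a R) y * H u y\<bar>" for n y
    have qi: "integrable lebesgue (q n)" for n unfolding q_def using L1(1,2) by auto
    have ql: "(\<lambda>n. \<integral>y. q n y \<partial>lebesgue) \<longlonglongrightarrow> 0"
      using LIMSEQ_subseq_LIMSEQ[OF L1(3) ss1] by (simp add: o_def q_def)
    have "(\<lambda>n. ennreal (\<integral>y. q n y \<partial>lebesgue)) \<longlonglongrightarrow> ennreal 0" by (rule tendsto_ennrealI[OF ql])
    moreover have "(\<integral>\<^sup>+y. ennreal (q n y) \<partial>lebesgue) = ennreal (\<integral>y. q n y \<partial>lebesgue)" for n
      by (rule nn_integral_eq_integral[OF qi]) (simp add: q_def)
    ultimately have qn: "(\<lambda>n. \<integral>\<^sup>+y. ennreal (q n y) \<partial>lebesgue) \<longlonglongrightarrow> 0" by simp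
    obtain s2 where s2: "strict_mono s2" "AE y in lebesgue. \<forall>i::nat. (\<lambda>n. q (s2 n) y) \<longlonglongrightarrow> 0"
      by (rule countable_AE_subsequence[of "\<lambda>i n. q n" lebesgue])
          (use qn borel_measurable_integrable[OF qi] in \<open>auto simp: q_def\<close>)
    define \<rho> where "\<rho> n = s (s1 (s2 n))" for n
    have ae_v: "AE y in lebesgue. y \<in> chart_image ?c \<longrightarrow> (\<lambda>n. us (\<rho> n) (chart_inv ?c y)) \<longlonglongrightarrow> u (chart_inv ?c y)"
      using ae1
    proof eventually_elim
      case (elim y)
      show ?case
      proof
        assume "y \<in> chart_image ?c"
        with elim have "(\<lambda>n. us (s (s1 n)) (chart_inv ?c y)) \<longlonglongrightarrow> u (chart_inv ?c y)" by blast
        from LIMSEQ_subseq_LIMSEQ[OF this s2(1)] show "(\<lambda>n. us (\<rho> n) (chart_inv ?c y)) \<longlonglongrightarrow> u (chart_inv ?c y)"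
          by (simp add: o_def \<rho>_def)
      qed
    qed
    have ae_h: "AE y in lebesgue. y \<in> cball ?a R \<longrightarrow> (\<lambda>n. H (us (\<rho> n)) y) \<longlonglongrightarrow> H u y"
      using s2(2)
    proof eventually_elim
      case (elim y)
      show ?case
      proof
        assume y: "y \<in> cball ?a R"
        have "(\<lambda>n. q (s2 n) y) \<longlonglongrightarrow> 0" using elim by blast
        then have "(\<lambda>n. \<bar>H (us (\<rho> n)) y - H u y\<bar>) \<longlonglongrightarrow> 0" using y by (simp add: q_def \<rho>_def)
        from tendsto_rabs_zero_cancel[OF this] show "(\<lambda>n. H (us (\<rho> n)) y) \<longlonglongrightarrow> H u y" by (rule LIM_zero_cancel)
      qed
    qed
    have hl: "(\<lambda>n. \<integral>y. \<bar>indicator (cball ?a R) y * H (us (\<rho> n)) y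
        - indicator (cball ?a R) y * H u y\<bar> \<partial>lebesgue) \<longlonglongrightarrow> 0"
      using LIMSEQ_subseq_LIMSEQ[OF ql s2(1)] by (simp add: o_def q_def \<rho>_def)
    obtain s3 :: "nat \<Rightarrow> nat" where s3: "strict_mono s3"
      "AE y in lebesgue. y \<in> ball ?a ?r \<longrightarrow> (\<forall>U. hom_open M N U \<longrightarrow> bundle_section u (?D u) (chart_inv ?c y) \<in> U \<longrightarrow>
       eventually (\<lambda>n. bundle_section (us (\<rho> (s3 n))) (?D (us (\<rho> (s3 n)))) (chart_inv ?c y)
           \<in> U) sequentially)"
      by (rule AE_eventually_section[where vs="\<lambda>n. us (\<rho> n)" and Ds="\<lambda>n. ?D (us (\<rho> n))"
          and hs="\<lambda>n. H (us (\<rho> n))" and h="H u",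
            OF c(1) r R(2) usD(1) uD(1,3) _ _ L1(1,2) hl ae_v ae_h]) (auto simp: H_def deriv_norm_def)
    let ?A = "\<lambda>l. (w u -` U \<inter> ?V) - w (us l) -` U"
    have Asub: "?A l \<subseteq> fst ?c" for l by auto
    have Am: "?A l \<in> lebesgue_sets M" for l
    proof -
      have "w u -` U \<in> lebesgue_sets M" "w (us l) -` U \<in> lebesgue_sets M"
        using uD(1) usD(1)[of l] U
            unfolding has_colocal_weak_derivative_def measurable_map_def openin_hom_topology w_def by auto
      then show ?thesis by (intro M.leb.Diff M.leb.Int M.open_lebesgue_sets[OF V])
    qed
    have "(\<lambda>n. emeasure lebesgue (snd ?c ` ?A (\<rho> (s3 n)))) \<longlonglongrightarrow> 0"
    proof (rule emeasure_tendsto_zero[where B="ball ?a ?r"])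
      show "snd ?c ` ?A (\<rho> (s3 n)) \<in> sets lebesgue" for n by (rule M.lebesgue_sets_image_sub[OF Am c(1) Asub])
      show "snd ?c ` ?A (\<rho> (s3 n)) \<subseteq> ball ?a ?r" for n by auto
      show "emeasure lebesgue (ball ?a ?r) < \<infinity>"
        using emeasure_bounded_finite[OF bounded_ball, of ?a ?r] by simp
      show "AE y in lebesgue. eventually (\<lambda>n. y \<notin> snd ?c ` ?A (\<rho> (s3 n))) sequentially"
        using s3(2)
      proof eventually_elim
        case (elim y)
        show ?case
        proof (cases "y \<in> ball ?a ?r \<and> w u (chart_inv ?c y) \<in> U")
          case True
          then have "eventually (\<lambda>n. w (us (\<rho> (s3 n))) (chart_inv ?c y) \<in> U) sequentially" using elim U
              by (simp add: w_def)
          then show ?thesis by eventually_elim (use c(1) in auto)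
        next
          case False
          then have "y \<notin> snd ?c ` ?A (\<rho> (s3 n))" for n using c(1) by auto
          then show ?thesis by simp
        qed
      qed
    qed auto
    moreover have "strict_mono (\<lambda>n. s1 (s2 (s3 n)))"
      using strict_mono_o[OF s1(1) strict_mono_o[OF s2(1) s3(1)]] by (simp add: o_def)
    ultimately show "\<exists>s'. strict_mono s' \<and> (\<lambda>n. emeasure lebesgue (snd ?c ` ?A (s (s' n)))) \<longlonglongrightarrow> 0"
      unfolding \<rho>_def by blast
  qed
  then show "\<exists>c\<in>M. x \<in> fst c \<and> (\<forall>U. hom_open M N U \<longrightarrow>
      (\<lambda>l. emeasure lebesgue (snd c ` (bundle_section u (?D u) -` U \<inter> fst c
          - bundle_section (us l) (?D (us l)) -` U))) \<longlonglongrightarrow> 0)"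
    unfolding w_def using M.chart_restrict(1)[OF c(1) V Int_lower1] c(2) r
        by (intro bexI[of _ "(?V, snd ?c)"]) auto
qed

end

theorem proposition4p6:
  fixes M :: "('a::{t2_space, second_countable_topology}, 'm::finite) chart set"
    and gM :: "'a \<Rightarrow> real ^ 'm \<Rightarrow> real ^ 'm \<Rightarrow> real"
    and N :: "('b::{t2_space, second_countable_topology}, 'n::finite) chart set"
    and gN :: "'b \<Rightarrow> real ^ 'n \<Rightarrow> real ^ 'n \<Rightarrow> real"
    and p :: real
    and d :: "'b \<Rightarrow> 'b \<Rightarrow> real"
    and \<mu> :: "'a measure"
    and us :: "nat \<Rightarrow> 'a \<Rightarrow> 'b"
    and u :: "'a \<Rightarrow> 'b"
  assumes "riemannian_manifold M gM"
    and "riemannian_manifold N gN"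
    and "1 \<le> p"
    and "Metric_space UNIV d"
    and "Metric_space.mtopology UNIV d = euclidean"
    and "radon_measure \<mu>"
    and "finite_measure \<mu>"
    and "positive_absolutely_continuous M \<mu>"
    and "\<And>l. us l \<in> sobolev_maps M gM N gN p"
    and "u \<in> sobolev_maps M gM N gN p"
  shows "converges_strongly M gM N gN p us u \<longleftrightarrow>
         (\<lambda>l. sobolev_dist M gM N gN p d \<mu> (us l) u) \<longlonglongrightarrow> 0"
proof -
  interpret M: riemannian_atlas M gM by (rule riemannian_atlasI[OF assms(1)])
  interpret N: riemannian_atlas N gN by (rule riemannian_atlasI[OF assms(2)])
  have "sets \<mu> = sets borel" using assms(6) by (simp add: radon_measure_def)
  then interpret ac_measure M \<mu>
    by (intro ac_measure.intro ac_measure_axioms.intro assms(7,8) M.C1_manifold_axioms)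
  interpret sobolev_setting M gM N gN \<mu> by unfold_locales
  define I where "I l = (\<integral>x. d (us l x) (u x) / (1 + d (us l x) (u x)) \<partial>completion \<mu>)" for l
  define J where "J l = (\<integral>x. \<bar>deriv_norm M gM N gN (us l) x
      - deriv_norm M gM N gN u x\<bar> powr p \<partial>riemannian_measure M gM) powr (1 / p)" for l
  have dist: "(\<lambda>l. sobolev_dist M gM N gN p d \<mu> (us l) u) = (\<lambda>l. I l + J l)"
    by (simp add: sobolev_dist_def I_def J_def)
  have dn: "0 \<le> d y z" for y z using Metric_space.nonneg[OF assms(4)] .
  have nn: "0 \<le> I l" "0 \<le> J l" for l
    unfolding I_def J_def using dn by (auto intro!: integral_nonneg_AE)
  \<comment> \<open>Both terms are nonnegative, so neither can hide the other in the sum.\<close>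
  have IJ: "(\<lambda>l. I l + J l) \<longlonglongrightarrow> 0 \<longleftrightarrow> I \<longlonglongrightarrow> 0 \<and> J \<longlonglongrightarrow> 0"
  proof
    assume l: "(\<lambda>l. I l + J l) \<longlonglongrightarrow> 0"
    show "I \<longlonglongrightarrow> 0 \<and> J \<longlonglongrightarrow> 0"
      using nn by (intro conjI tendsto_sandwich[OF always_eventually always_eventually tendsto_const l]) auto
  next
    assume "I \<longlonglongrightarrow> 0 \<and> J \<longlonglongrightarrow> 0"
    then show "(\<lambda>l. I l + J l) \<longlonglongrightarrow> 0" using tendsto_add[of I 0 sequentially J 0] by simp
  qed
  have m: "measurable_map M euclidean u" "measurable_map M euclidean (us l)" for l
    using assms(9)[of l] assms(10) by (auto simp: sobolev_maps_def colocally_weakly_differentiable_def)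
  note I_iff = metric_integral_tendsto_iff_AE_subsequences[OF m(1) m(2) assms(4,5), folded I_def]
  have Lp: "in_Lp (riemannian_measure M gM) p (deriv_norm M gM N gN u)" "in_Lp (riemannian_measure M gM) p
      (deriv_norm M gM N gN (us l))" for l
    using assms(9)[of l] assms(10) by (auto simp: sobolev_maps_def)
  show ?thesis
    unfolding dist IJ converges_strongly_def Lp_converges_def J_def[symmetric]
  \<comment> \<open>Convergence of \<open>J\<close> stands on both sides, and membership in L^p
    comes from \<open>sobolev_maps\<close>. What is left relates convergence of the bundle sections
    to convergence of \<open>I\<close>; the direction starting from \<open>I\<close> also draws on
    \<open>J\<close>.\<close>
  proof (intro iffI conjI; (elim conjE)?)
    assume "converges_locally_in_measure M (hom_topology M N)
       (\<lambda>l. bundle_section (us l) (colocal_weak_derivative M N (us l))) (bundle_section u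
           (colocal_weak_derivative M N u))"
    then have "converges_locally_in_measure M euclidean us u" by (rule base_map_converges_locally_in_measure)
    from AE_subsequence_of_local_measure_convergence[OF m(1) m(2) this] show "I \<longlonglongrightarrow> 0"
      unfolding I_iff by blast
  next
    assume I0: "I \<longlonglongrightarrow> 0" and J0: "J \<longlonglongrightarrow> 0"
    show "converges_locally_in_measure M (hom_topology M N)
       (\<lambda>l. bundle_section (us l) (colocal_weak_derivative M N (us l))) (bundle_section u
           (colocal_weak_derivative M N u))"
      by (rule bundle_converges_locally_in_measure[OF assms(3) assms(9) assms(10) _ J0[unfolded J_def]])
         (use I0 in \<open>unfold I_iff, blast\<close>)
  qed (use Lp in auto)
qed

end
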